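(* Let $K$ be a closed convex subset of $\mathbf{R}^d$ with $k=\dim(K)\in\{1,\ldots,d-1\}$ and with $k_\infty=k$. Let $\Omega=\mathbf{R}^d\setminus K$, $\Gamma=\partial\Omega$, and $c_\Omega=c\circ d_\Gamma$ where $c(s)=s^\delta(1+s)^{\delta'-\delta}$ for $s>0$, with $\delta,\delta'\geq0$. Let $p\in[1,\infty)$ with $d-k+(\delta\wedge\delta')-p>0$. Then the optimal constant $$\mu_p(\Omega)=\inf\Big\{\int_\Omega c_\Omega\,|\nabla\varphi|^p\Big/\int_\Omega c_\Omega\,d_\Gamma^{\,-p}\,|\varphi|^p:\ \varphi\in C_c^1(\Omega),\ \varphi\neq0\Big\}$$ in the weighted Hardy inequality on $\Omega$ is given by $\mu_p(\Omega)=\big((d-k+\delta\wedge\delta'-p)/p\big)^p$.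
   Context: All functions are real-valued. $\dim(K)$ is the dimension of the affine hull $A_K$ of $K$. Identifying $A_K$ with $\mathbf{R}^k$, the dimension at infinity of $K$ is $k_\infty=\liminf_{r\to\infty}\big(\log|K\cap B_r|/\log r\big)$, where $B_r=\{y\in\mathbf{R}^k:|y|<r\}$ and $|S|$ is the $k$-dimensional Lebesgue measure of $S$. $d_\Gamma(x)=\inf_{y\in\mathbf{R}^d\setminus\Omega}|x-y|$ for $x\in\Omega$ is the Euclidean distance to $\Gamma$. $|\nabla\varphi|=(\sum_{j=1}^d|\partial_j\varphi|^2)^{1/2}$; $\delta\wedge\delta'=\min(\delta,\delta')$. *)

theory Defs
  imports "HOL-Analysis.Analysis"
begin

section \<open>Lebesgue measure on affine hulls and the dimension at infinity\<close>

text \<open>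
  Points of \<open>\<real>\<^sup>k\<close>, for a natural number \<open>k\<close>, are the extensional functions on \<open>{..<k}\<close>. An
  identification of a \<open>k\<close>-dimensional affine set \<open>A\<close> with \<open>\<real>\<^sup>k\<close> is given by an origin \<open>a\<close> and an
  orthonormal family \<open>e 0, \<dots>, e (k - 1)\<close> such that the isometry
  \<open>y \<mapsto> a + (\<Sum>i<k. y i *\<^sub>R e i)\<close> maps \<open>\<real>\<^sup>k\<close> onto \<open>A\<close>.
\<close>

definition frame_map ::
    "nat \<Rightarrow> 'a::euclidean_space \<Rightarrow> (nat \<Rightarrow> 'a) \<Rightarrow> (nat \<Rightarrow> real) \<Rightarrow> 'a" where
  "frame_map k a e y = a + (\<Sum>i<k. y i *\<^sub>R e i)"

definition is_frame ::
    "nat \<Rightarrow> 'a::euclidean_space \<Rightarrow> (nat \<Rightarrow> 'a) \<Rightarrow> 'a set \<Rightarrow> bool" where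
  "is_frame k a e A \<longleftrightarrow>
     (\<forall>i<k. \<forall>j<k. e i \<bullet> e j = (if i = j then 1 else 0)) \<and>
     frame_map k a e ` ({..<k} \<rightarrow>\<^sub>E UNIV) = A"

definition coord_ball :: "nat \<Rightarrow> real \<Rightarrow> (nat \<Rightarrow> real) set" where
  "coord_ball k r = {y \<in> {..<k} \<rightarrow>\<^sub>E UNIV. L2_set y {..<k} < r}"

definition vol_in_ball ::
    "nat \<Rightarrow> 'a::euclidean_space \<Rightarrow> (nat \<Rightarrow> 'a) \<Rightarrow> 'a set \<Rightarrow> real \<Rightarrow> real" where
  "vol_in_ball k a e K r =
     measure (\<Pi>\<^sub>M i\<in>{..<k}. lborel) {y \<in> coord_ball k r. frame_map k a e y \<in> K}"

definition dim_at_infinity ::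
    "nat \<Rightarrow> 'a::euclidean_space \<Rightarrow> (nat \<Rightarrow> 'a) \<Rightarrow> 'a set \<Rightarrow> ereal" where
  "dim_at_infinity k a e K = Liminf at_top (\<lambda>r::real. ereal (ln (vol_in_ball k a e K r) / ln r))"

text \<open>Every nonempty affine set admits such an identification.\<close>

lemma is_frame_exists:
  fixes A :: "'a::euclidean_space set"
  assumes "affine A" "aff_dim A = int k"
  shows "\<exists>a e. is_frame k a e A"
proof -
  from assms(2) have "A \<noteq> {}"
    by auto
  then obtain a where a: "a \<in> A"
    by blast
  define L where "L = (\<lambda>x. x - a) ` A"
  have L: "subspace L"
    unfolding L_def by (rule affine_diffs_subspace_subtract[OF assms(1) a])
  have A: "A = (+) a ` L"
    unfolding L_def by (simp add: image_image)
  have "aff_dim A = aff_dim L"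
    unfolding A by (rule aff_dim_translation_eq)
  also have "\<dots> = int (dim L)"
    by (rule aff_dim_subspace[OF L])
  finally have dimL: "dim L = k"
    using assms(2) by simp
  obtain B where B: "B \<subseteq> L" "pairwise orthogonal B" "\<And>x. x \<in> B \<Longrightarrow> norm x = 1"
      "independent B" "card B = dim L" "span B = L"
    by (rule orthonormal_basis_subspace[OF L]) blast
  have finB: "finite B"
    using B(4) by (rule independent_imp_finite)
  obtain e where e: "bij_betw e {..<k} B"
    using ex_bij_betw_nat_finite[OF finB] B(5) dimL by (auto simp: atLeast0LessThan)
  have orth: "e i \<bullet> e j = (if i = j then 1 else 0)" if "i < k" "j < k" for i j
  proof (cases "i = j")
    case True
    then show ?thesis
      using B(3)[of "e i"] e that by (auto simp: bij_betw_def norm_eq_1)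
  next
    case False
    then have "e i \<noteq> e j" "e i \<in> B" "e j \<in> B"
      using e that by (auto simp: bij_betw_def inj_on_def)
    then show ?thesis
      using B(2) False by (auto simp: pairwise_def orthogonal_def)
  qed
  have "frame_map k a e ` ({..<k} \<rightarrow>\<^sub>E UNIV) = A"
  proof (intro equalityI subsetI)
    fix x assume "x \<in> frame_map k a e ` ({..<k} \<rightarrow>\<^sub>E UNIV)"
    then obtain y where x: "x = a + (\<Sum>i<k. y i *\<^sub>R e i)"
      by (auto simp: frame_map_def)
    have "e i \<in> L" if "i < k" for i
      using e that B(1) by (auto simp: bij_betw_def)
    then have "(\<Sum>i<k. y i *\<^sub>R e i) \<in> L"
      by (intro subspace_sum[OF L] subspace_scale[OF L]) auto
    then show "x \<in> A"
      unfolding x A by blast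
  next
    fix x assume "x \<in> A"
    then obtain v where v: "v \<in> L" "x = a + v"
      unfolding A by blast
    then have "v \<in> span B"
      using B(6) by simp
    then obtain u where "v = (\<Sum>b\<in>B. u b *\<^sub>R b)"
      using span_finite[OF finB] by auto
    also have "\<dots> = (\<Sum>i<k. u (e i) *\<^sub>R e i)"
      by (rule sum.reindex_bij_betw[OF e, symmetric])
    finally have "x = frame_map k a e (restrict (u \<circ> e) {..<k})"
      using v(2) by (simp add: frame_map_def)
    then show "x \<in> frame_map k a e ` ({..<k} \<rightarrow>\<^sub>E UNIV)"
      by (simp only:) (rule imageI, simp add: PiE_def extensional_def)
  qed
  with orth show ?thesis
    unfolding is_frame_def by blast
qed


section \<open>The weighted Hardy constant\<close>

definition bdry_dist :: "'a::metric_space set \<Rightarrow> 'a \<Rightarrow> real" where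
  "bdry_dist \<Omega> x = infdist x (- \<Omega>)"

definition hardy_weight :: "real \<Rightarrow> real \<Rightarrow> real \<Rightarrow> real" where
  "hardy_weight \<delta> \<delta>' s = s powr \<delta> * (1 + s) powr (\<delta>' - \<delta>)"

definition partial_deriv :: "'n::finite \<Rightarrow> (real^'n \<Rightarrow> real) \<Rightarrow> real^'n \<Rightarrow> real" where
  "partial_deriv j \<phi> x = frechet_derivative \<phi> (at x) (axis j 1)"

definition grad_norm :: "(real^'n::finite \<Rightarrow> real) \<Rightarrow> real^'n \<Rightarrow> real" where
  "grad_norm \<phi> x = sqrt (\<Sum>j\<in>UNIV. \<bar>partial_deriv j \<phi> x\<bar>\<^sup>2)"

text \<open>
  Functions in \<open>C\<^sub>c\<^sup>1(\<Omega>)\<close> are identified with their extensions by zero, which are \<open>C\<^sup>1\<close> on the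
  whole space.
\<close>

definition C1c :: "(real^'n::finite) set \<Rightarrow> (real^'n \<Rightarrow> real) set" where
  "C1c \<Omega> = {\<phi>. \<phi> differentiable_on UNIV \<and> (\<forall>j. continuous_on UNIV (partial_deriv j \<phi>)) \<and>
               compact (closure {x. \<phi> x \<noteq> 0}) \<and> closure {x. \<phi> x \<noteq> 0} \<subseteq> \<Omega>}"

definition hardy_constant ::
    "real \<Rightarrow> (real^'n::finite \<Rightarrow> real) \<Rightarrow> (real^'n) set \<Rightarrow> real" where
  "hardy_constant p w \<Omega> =
     Inf {(LINT x:\<Omega>|lborel. w x * grad_norm \<phi> x powr p) /
          (LINT x:\<Omega>|lborel. w x * bdry_dist \<Omega> x powr (- p) * \<bar>\<phi> x\<bar> powr p)
          | \<phi>. \<phi> \<in> C1c \<Omega> \<and> \<phi> \<noteq> (\<lambda>x. 0)}"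

end

theory Submission
  imports Defs
begin

text \<open>
Let \<open>d\<close> be the distance to \<open>K\<close>, \<open>P\<close> the nearest point map, \<open>m = CARD('n) - k\<close> the codimension and
\<open>a = (m + min \<delta> \<delta>' - p) / p\<close>.

For the lower bound, the field \<open>V x = x - P x = d \<nabla>d\<close> is half the gradient of the convex function
\<open>d\<^sup>2\<close>, and it grows with unit slope in each of the \<open>m\<close> directions orthogonal to the affine hull of \<open>K\<close>;
hence \<open>div V \<ge> m\<close> in the weak sense. Since the logarithmic derivative of the weight is at least
\<open>min \<delta> \<delta>'\<close>, the field \<open>c(d) d\<^bsup>-p\<^esup> V\<close> has divergence at least \<open>p a c(d) d\<^bsup>-p\<^esup>\<close>. Testing this with \<open>|\<phi>|\<^sup>p\<close> and
applying Young's inequality gives the Hardy inequality with constant \<open>a\<^sup>p\<close>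
(\<open>hardy_divergence_inequality\<close>, \<open>hardy_inequality_convex\<close>). The integrations by parts are obtained from
translation invariance of Lebesgue measure applied to difference quotients, one direction of an
orthonormal basis at a time (\<open>integration_by_parts_inequality\<close>).

For the upper bound, full dimension at infinity forces \<open>K\<close> to contain arbitrarily large relative
balls: otherwise each point of \<open>K\<close> leaves \<open>K\<close> after a bounded step along some signed axis, and the
volume would grow at most like \<open>r\<^bsup>k - 1\<^esup>\<close> (\<open>large_relative_balls\<close>). Over such a ball \<open>d\<close> is the norm of
the orthogonal component \<open>z\<close>, and the situation is that of a flat \<open>k\<close>-plane. The virtual minimiser there
is \<open>(c(s) s\<^bsup>m - p\<^esup>)\<^bsup>-1/p\<^esup>\<close> with \<open>s = |z|\<close>; it is cut off slowly in \<open>ln s\<close> on a window where the logarithmic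
derivative of \<open>c\<close> is close to \<open>min \<delta> \<delta>'\<close>, that is, near \<open>0\<close> if \<open>\<delta> \<le> \<delta>'\<close> and near infinity otherwise, and
cut off along \<open>K\<close> at a radius \<open>R\<close> that is much larger still. The invariance of \<open>|z|\<^bsup>-m\<^esup> dz\<close> under dilations
(\<open>log_radial_integral_zero\<close>) and a doubling property in the directions along \<open>K\<close>
(\<open>slab_doubling_exists\<close>) show that both cut-offs cost arbitrarily little (\<open>test_function_ratio\<close>).
\<close>

section \<open>Integration by parts by translation\<close>

lemma integrable_continuous_compact_support:
  fixes g :: "'a::euclidean_space \<Rightarrow> real"
  assumes S: "compact S" and g: "continuous_on S g" and out: "\<And>x. x \<notin> S \<Longrightarrow> g x = 0"
  shows "integrable lborel g"
proof -
  have "(\<lambda>x. indicator S x *\<^sub>R g x) = g"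
    using out by (auto simp: fun_eq_iff indicator_def)
  with borel_integrable_compact[OF S g] show ?thesis by simp
qed

lemma lborel_integral_translation:
  fixes g :: "'a::euclidean_space \<Rightarrow> real"
  assumes [measurable]: "g \<in> borel_measurable borel"
  shows "(\<integral>x. g (x + v) \<partial>lborel) = (\<integral>x. g x \<partial>lborel)"
proof -
  have "(\<integral>x. g x \<partial>lborel) = (\<integral>x. g x \<partial>distr lborel borel ((+) v))"
    by (simp only: lborel_distr_plus)
  also have "\<dots> = (\<integral>x. g (v + x) \<partial>lborel)"
    by (rule integral_distr) auto
  finally show ?thesis by (simp add: add.commute)
qed

lemma directional_derivative_zero_outside:
  fixes \<psi> :: "'a::euclidean_space \<Rightarrow> real"
  assumes S: "closed S" "x \<notin> S" and out: "\<And>x. x \<notin> S \<Longrightarrow> \<psi> x = 0"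
  shows "((\<lambda>t. \<psi> (x + t *\<^sub>R u)) has_real_derivative 0) (at 0)"
proof -
  have "open ((\<lambda>t. x + t *\<^sub>R u) -` (- S))"
    using S(1) by (intro open_vimage) (auto intro!: continuous_intros)
  moreover have "0 \<in> (\<lambda>t. x + t *\<^sub>R u) -` (- S)" using S(2) by simp
  ultimately have ev: "eventually (\<lambda>t. t \<in> (\<lambda>t. x + t *\<^sub>R u) -` (- S)) (nhds 0)"
    by (rule eventually_nhds_in_open)
  have "((\<lambda>t. \<psi> (x + t *\<^sub>R u)) has_real_derivative 0) (at 0)
      \<longleftrightarrow> ((\<lambda>t. 0) has_real_derivative 0) (at (0::real))"
    by (rule DERIV_cong_ev) (use ev out in \<open>auto elim: eventually_mono\<close>)
  then show ?thesis by simp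
qed

text \<open>
The substitute for the divergence theorem. Translation invariance of Lebesgue measure turns
\<open>\<integral> f(x) (\<psi>(x + h u) - \<psi>(x)) / h\<close> into \<open>- \<integral> (f(x) - f(x - h u)) / h \<sqdot> \<psi>(x)\<close>, and only the sign and
size of the increments of \<open>f\<close> along \<open>u\<close> matter in the second integral; \<open>h \<rightarrow> 0\<close> by dominated
convergence. Thus \<open>f\<close> need not be differentiable, and no coordinate system adapted to \<open>u\<close> has to
be chosen. The increment hypothesis is multiplied by \<open>\<psi>(x + h u)\<close> so that it can be used for
\<open>\<psi> \<ge> 0\<close> with a monotone \<open>f\<close>, and for \<open>\<psi>\<close> of any sign (twice, with \<open>f\<close> and \<open>- f\<close>) when the
increments are known exactly.
\<close>

lemma integration_by_parts_inequality:
  fixes f \<psi> \<psi>' :: "'a::euclidean_space \<Rightarrow> real"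
  assumes f: "continuous_on UNIV f" and \<psi>: "continuous_on UNIV \<psi>" and \<psi>': "continuous_on UNIV \<psi>'"
    and S: "compact S" and out: "\<And>x. x \<notin> S \<Longrightarrow> \<psi> x = 0"
    and deriv: "\<And>x. ((\<lambda>t. \<psi> (x + t *\<^sub>R u)) has_real_derivative \<psi>' x) (at 0)"
    and incr: "\<And>x h. h > 0 \<Longrightarrow>
      c * h * \<psi> (x + h *\<^sub>R u) \<le> (f (x + h *\<^sub>R u) - f x) * \<psi> (x + h *\<^sub>R u)"
  shows "integrable lborel (\<lambda>x. f x * \<psi>' x)"
    and "(\<integral>x. f x * \<psi>' x \<partial>lborel) \<le> - c * (\<integral>x. \<psi> x \<partial>lborel)"
proof -
  obtain r where r: "\<And>x. x \<in> S \<Longrightarrow> norm x \<le> r"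
    using compact_imp_bounded[OF S] by (auto simp: bounded_iff)
  \<comment> \<open>For \<open>0 < h \<le> 1\<close> all difference quotients vanish outside this ball.\<close>
  define B where "B = cball (0::'a) (r + norm u)"
  have B: "compact B" by (simp add: B_def)
  have SB: "S \<subseteq> B" using r by (auto simp: B_def intro!: add_increasing2)
  have out': "\<psi>' x = 0" if "x \<notin> S" for x
    using DERIV_unique[OF deriv directional_derivative_zero_outside[OF compact_imp_closed[OF S] that out]] .
  have bounded_on_B: "\<exists>M. \<forall>x\<in>B. \<bar>g x\<bar> \<le> M" if "continuous_on UNIV g" for g :: "'a \<Rightarrow> real"
  proof -
    have "compact (g ` B)" using that B by (meson compact_continuous_image continuous_on_subset subset_UNIV)
    then show ?thesis by (auto dest!: compact_imp_bounded simp: bounded_iff)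
  qed
  obtain Mf where Mf: "\<And>x. x \<in> B \<Longrightarrow> \<bar>f x\<bar> \<le> Mf" using bounded_on_B[OF f] by blast
  obtain M0 where M0: "\<And>x. x \<in> B \<Longrightarrow> \<bar>\<psi>' x\<bar> \<le> M0" using bounded_on_B[OF \<psi>'] by blast
  define M where "M = max M0 0"
  have M: "\<bar>\<psi>' x\<bar> \<le> M" for x
  proof (cases "x \<in> B")
    case False
    then have "x \<notin> S" using SB by blast
    then show ?thesis by (simp add: out' M_def)
  qed (use M0[of x] in \<open>simp add: M_def\<close>)
  have D: "((\<lambda>t. \<psi> (x + t *\<^sub>R u)) has_real_derivative \<psi>' (x + t *\<^sub>R u)) (at t)" for x t
    using deriv[of "x + t *\<^sub>R u"] DERIV_shift[of "\<lambda>t. \<psi> (x + t *\<^sub>R u)" "\<psi>' (x + t *\<^sub>R u)" 0 t]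
    by (simp add: algebra_simps)
  have Lip: "\<bar>\<psi> (x + h *\<^sub>R u) - \<psi> x\<bar> \<le> M * h" if hpos: "h > 0" for x h
  proof -
    obtain z where "\<psi> (x + h *\<^sub>R u) - \<psi> (x + 0 *\<^sub>R u) = (h - 0) * \<psi>' (x + z *\<^sub>R u)"
      using MVT2[OF hpos, of "\<lambda>t. \<psi> (x + t *\<^sub>R u)" "\<lambda>t. \<psi>' (x + t *\<^sub>R u)"] D by blast
    then show ?thesis using M[of "x + z *\<^sub>R u"] that by (simp add: abs_mult mult.commute)
  qed
  have [measurable]: "f \<in> borel_measurable borel" "\<psi> \<in> borel_measurable borel"
      "\<psi>' \<in> borel_measurable borel"
    using f \<psi> \<psi>' by (auto intro: borel_measurable_continuous_onI)
  define h where "h = (\<lambda>n::nat. 1 / (real n + 1))"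
  have h: "0 < h n" "h n \<le> 1" for n by (auto simp: h_def)
  have h0: "h \<longlonglongrightarrow> 0" unfolding h_def using LIMSEQ_inverse_real_of_nat by (simp add: inverse_eq_divide add.commute)
  define q where "q = (\<lambda>n x. f x * ((\<psi> (x + h n *\<^sub>R u) - \<psi> x) / h n))"
  have qB: "q n x = 0" if "x \<notin> B" for n x
  proof -
    have "norm (h n *\<^sub>R u) \<le> norm u"
      using h[of n] by (simp add: mult_left_le_one_le)
    moreover have "norm x \<le> norm (x + h n *\<^sub>R u) + norm (h n *\<^sub>R u)"
      by (metis add_diff_cancel norm_triangle_ineq4)
    moreover have "norm x > r + norm u" using that by (simp add: B_def)
    ultimately have "x + h n *\<^sub>R u \<notin> S" "x \<notin> S" using r[of "x + h n *\<^sub>R u"] that SB by auto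
    then show ?thesis by (simp add: q_def out)
  qed
  have qbound: "norm (q n x) \<le> Mf * M * indicator B x" for n x
  proof (cases "x \<in> B")
    case True
    have "\<bar>(\<psi> (x + h n *\<^sub>R u) - \<psi> x) / h n\<bar> \<le> M"
      using Lip[OF h(1), of x n] h[of n] by (simp add: field_simps)
    then have "\<bar>f x\<bar> * \<bar>(\<psi> (x + h n *\<^sub>R u) - \<psi> x) / h n\<bar> \<le> Mf * M"
      using Mf[OF True] by (intro mult_mono) (auto intro: order_trans[OF abs_ge_zero])
    then show ?thesis using True by (simp add: q_def abs_mult)
  qed (simp add: qB)
  have qlim: "(\<lambda>n. q n x) \<longlonglongrightarrow> f x * \<psi>' x" for x
  proof -
    have "((\<lambda>t. (\<psi> (x + t *\<^sub>R u) - \<psi> x) / t) \<longlongrightarrow> \<psi>' x) (at 0)"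
      using deriv[of x] by (simp add: DERIV_def)
    moreover have "filterlim h (at 0) sequentially"
      using h0 h by (auto simp: filterlim_at less_imp_neq[THEN not_sym])
    ultimately have "(\<lambda>n. (\<psi> (x + h n *\<^sub>R u) - \<psi> x) / h n) \<longlonglongrightarrow> \<psi>' x"
      by (rule filterlim_compose)
    then show ?thesis unfolding q_def by (intro tendsto_intros)
  qed
  have dom: "integrable lborel (\<lambda>x. Mf * M * indicator B x)"
    using B by (intro integrable_mult_right integrable_real_indicator)
      (use emeasure_lborel_cball_finite[of "0::'a" "r + norm u"] in \<open>auto simp: B_def less_top[symmetric]\<close>)
  have qm: "q n \<in> borel_measurable lborel" for n
    unfolding q_def by measurable
  have m: "(\<lambda>x. f x * \<psi>' x) \<in> borel_measurable lborel" by measurable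
  have int: "integrable lborel (\<lambda>x. f x * \<psi>' x)"
    by (rule integrable_dominated_convergence[where s=q, OF m qm dom]) (use qlim qbound in \<open>simp_all\<close>)
  have lim: "(\<lambda>n. \<integral>x. q n x \<partial>lborel) \<longlonglongrightarrow> (\<integral>x. f x * \<psi>' x \<partial>lborel)"
    by (rule integral_dominated_convergence[where s=q, OF m qm dom]) (use qlim qbound in \<open>simp_all\<close>)
  show "integrable lborel (\<lambda>x. f x * \<psi>' x)" by (rule int)
  have "(\<integral>x. q n x \<partial>lborel) \<le> - c * (\<integral>x. \<psi> x \<partial>lborel)" for n
  proof -
    define k where "k = h n"
    have k: "k > 0" using h by (simp add: k_def)
    have supp: "integrable lborel (\<lambda>x. g x * \<psi> x)" if "continuous_on UNIV g" for g
      by (rule integrable_continuous_compact_support[OF S])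
        (auto simp: out intro!: continuous_on_mult continuous_on_subset[OF that] continuous_on_subset[OF \<psi>])
    have i1: "integrable lborel (\<lambda>x. f x * \<psi> x)" by (rule supp[OF f])
    have i2: "integrable lborel (\<lambda>x. f (x - k *\<^sub>R u) * \<psi> x)"
      by (rule supp) (intro continuous_intros continuous_on_compose2[OF f]; simp)
    have i3: "integrable lborel \<psi>" using supp[of "\<lambda>_. 1"] by simp
    have i4: "integrable lborel (\<lambda>x. f x * \<psi> (x + k *\<^sub>R u))"
    proof (rule integrable_continuous_compact_support)
      show "compact ((\<lambda>x. x - k *\<^sub>R u) ` S)"
        by (intro compact_continuous_image S continuous_intros)
      show "continuous_on ((\<lambda>x. x - k *\<^sub>R u) ` S) (\<lambda>x. f x * \<psi> (x + k *\<^sub>R u))"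
        by (intro continuous_intros continuous_on_compose2[OF \<psi>] continuous_on_subset[OF f]) auto
      show "f x * \<psi> (x + k *\<^sub>R u) = 0" if "x \<notin> (\<lambda>x. x - k *\<^sub>R u) ` S" for x
      proof -
        have "x + k *\<^sub>R u \<notin> S"
        proof
          assume "x + k *\<^sub>R u \<in> S"
          then have "(x + k *\<^sub>R u) - k *\<^sub>R u \<in> (\<lambda>x. x - k *\<^sub>R u) ` S" by blast
          with that show False by simp
        qed
        then show ?thesis by (simp add: out)
      qed
    qed
    have "k * (\<integral>x. q n x \<partial>lborel) = (\<integral>x. k * q n x \<partial>lborel)" by simp
    also have "\<dots> = (\<integral>x. f x * \<psi> (x + k *\<^sub>R u) - f x * \<psi> x \<partial>lborel)"
      using k by (intro Bochner_Integration.integral_cong) (auto simp: q_def k_def field_simps)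
    also have "\<dots> = (\<integral>x. f x * \<psi> (x + k *\<^sub>R u) \<partial>lborel) - (\<integral>x. f x * \<psi> x \<partial>lborel)"
      using i4 i1 by (rule Bochner_Integration.integral_diff)
    also have "(\<integral>x. f x * \<psi> (x + k *\<^sub>R u) \<partial>lborel) = (\<integral>x. f (x - k *\<^sub>R u) * \<psi> x \<partial>lborel)"
      using lborel_integral_translation[of "\<lambda>x. f (x - k *\<^sub>R u) * \<psi> x" "k *\<^sub>R u"] by simp
    also have "\<dots> - (\<integral>x. f x * \<psi> x \<partial>lborel) = (\<integral>x. f (x - k *\<^sub>R u) * \<psi> x - f x * \<psi> x \<partial>lborel)"
      using i2 i1 by (rule Bochner_Integration.integral_diff[symmetric])
    also have "\<dots> \<le> (\<integral>x. - c * k * \<psi> x \<partial>lborel)"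
    proof (rule integral_mono)
      show "f (x - k *\<^sub>R u) * \<psi> x - f x * \<psi> x \<le> - c * k * \<psi> x" for x
        using incr[OF k, of "x - k *\<^sub>R u"] by (simp add: algebra_simps)
    qed (use i1 i2 i3 in auto)
    also have "\<dots> = k * (- c * (\<integral>x. \<psi> x \<partial>lborel))" by simp
    finally show ?thesis using k by (simp only: mult_le_cancel_left_pos)
  qed
  then show "(\<integral>x. f x * \<psi>' x \<partial>lborel) \<le> - c * (\<integral>x. \<psi> x \<partial>lborel)"
    using LIMSEQ_le_const2[OF lim] by blast
qed

section \<open>The residual of the nearest point projection\<close>

lemma infdist_eq_dist_closest_point:
  fixes K :: "'a::euclidean_space set"
  assumes "closed K" "K \<noteq> {}"
  shows "infdist x K = norm (x - closest_point K x)"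
proof (rule antisym)
  show "infdist x K \<le> norm (x - closest_point K x)"
    using closest_point_in_set[OF assms, of x] by (metis infdist_le dist_norm)
  show "norm (x - closest_point K x) \<le> infdist x K"
    using assms by (auto simp: infdist_notempty dist_norm[symmetric] intro!: cINF_greatest closest_point_le)
qed

text \<open>
The residual \<open>x - P x\<close> is half the gradient of the convex function \<open>d\<^sup>2\<close>, hence monotone; here this
follows from the nearest point map being a contraction.
\<close>

lemma closest_point_residual_monotone:
  fixes K :: "'a::euclidean_space set"
  assumes "closed K" "convex K" "K \<noteq> {}"
  shows "((x - closest_point K x) - (y - closest_point K y)) \<bullet> (x - y) \<ge> 0"
proof -
  let ?P = "closest_point K"
  have "norm (?P x - ?P y) \<le> norm (x - y)"
    using closest_point_lipschitz[of K x y] assms by (simp add: dist_norm)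
  moreover have "(?P x - ?P y) \<bullet> (x - y) \<le> norm (?P x - ?P y) * norm (x - y)"
    by (rule norm_cauchy_schwarz)
  ultimately have "(?P x - ?P y) \<bullet> (x - y) \<le> norm (x - y) * norm (x - y)"
    by (meson mult_right_mono norm_ge_zero order_trans)
  moreover have "norm (x - y) * norm (x - y) = (x - y) \<bullet> (x - y)"
    by (simp add: power2_norm_eq_inner[symmetric] power2_eq_square)
  ultimately have "(?P x - ?P y) \<bullet> (x - y) \<le> (x - y) \<bullet> (x - y)" by simp
  moreover have "(x - ?P x) - (y - ?P y) = (x - y) - (?P x - ?P y)" by simp
  ultimately show ?thesis by (simp only: inner_diff_left[of "x - y"] diff_ge_0_iff_ge)
qed

text \<open>
Comparing \<open>d(y)\<close> with the distance from \<open>y\<close> to the point nearest to \<open>x\<close>, and conversely, bounds the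
linearisation error of \<open>d\<^sup>2\<close> by \<open>|y - x|\<^sup>2\<close> on both sides; monotonicity of the residual moves the
base point of the second comparison from \<open>y\<close> to \<open>x\<close>.
\<close>

lemma has_derivative_infdist_square:
  fixes K :: "'a::euclidean_space set"
  assumes K: "closed K" "convex K" "K \<noteq> {}"
  shows "((\<lambda>x. (infdist x K)\<^sup>2) has_derivative (\<lambda>v. 2 * ((x - closest_point K x) \<bullet> v))) (at x)"
proof -
  let ?P = "closest_point K"
  have est: "\<bar>(infdist y K)\<^sup>2 - (infdist x K)\<^sup>2 - 2 * ((x - ?P x) \<bullet> (y - x))\<bar> \<le> (norm (y - x))\<^sup>2" for y
  proof -
    have le: "(infdist b K)\<^sup>2 \<le> (infdist a K)\<^sup>2 + 2 * ((a - ?P a) \<bullet> (b - a)) + (norm (b - a))\<^sup>2" for a b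
    proof -
      have "infdist b K \<le> norm (b - ?P a)"
        using closest_point_in_set[OF K(1,3), of a] by (metis infdist_le dist_norm)
      then have "(infdist b K)\<^sup>2 \<le> (norm (b - ?P a))\<^sup>2"
        by (intro power_mono infdist_nonneg)
      also have "b - ?P a = (a - ?P a) + (b - a)" by simp
      also have "(norm ((a - ?P a) + (b - a)))\<^sup>2
          = (norm (a - ?P a))\<^sup>2 + 2 * ((a - ?P a) \<bullet> (b - a)) + (norm (b - a))\<^sup>2"
        unfolding power2_norm_eq_inner inner_add_left inner_add_right
        by (simp add: inner_commute[of "b - a" "a - ?P a"])
      finally show ?thesis
        by (simp only: infdist_eq_dist_closest_point[OF K(1,3)])
    qed
    have "(y - ?P y) \<bullet> (x - y) \<le> (x - ?P x) \<bullet> (x - y)"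
      using closest_point_residual_monotone[OF K, of x y]
      by (simp add: inner_diff_left)
    then show ?thesis
      using le[of y x] le[of x y] by (simp add: inner_diff_right norm_minus_commute abs_le_iff)
  qed
  show ?thesis
    unfolding has_derivative_at_within
  proof (intro conjI)
    show "bounded_linear (\<lambda>v. 2 * ((x - ?P x) \<bullet> v))"
      by (intro bounded_linear_const_mult bounded_linear_inner_right)
    have "((\<lambda>y. norm (y - x)) \<longlongrightarrow> 0) (at x)"
      by (auto intro!: tendsto_eq_intros)
    then show "((\<lambda>y. ((infdist y K)\<^sup>2 - (infdist x K)\<^sup>2 - 2 * ((x - ?P x) \<bullet> (y - x))) /\<^sub>R norm (y - x)) \<longlongrightarrow> 0) (at x)"
    proof (rule Lim_null_comparison[rotated])
      show "\<forall>\<^sub>F y in at x. norm (((infdist y K)\<^sup>2 - (infdist x K)\<^sup>2 - 2 * ((x - ?P x) \<bullet> (y - x))) /\<^sub>R norm (y - x)) \<le> norm (y - x)"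
        unfolding eventually_at_filter
      proof (rule always_eventually, intro allI impI)
        fix y assume "y \<noteq> x"
        then show "norm (((infdist y K)\<^sup>2 - (infdist x K)\<^sup>2 - 2 * ((x - ?P x) \<bullet> (y - x))) /\<^sub>R norm (y - x)) \<le> norm (y - x)"
          using est[of y] by (simp add: field_simps power2_eq_square)
      qed
    qed
  qed
qed

lemma has_derivative_infdist:
  fixes K :: "'a::euclidean_space set"
  assumes K: "closed K" "convex K" "K \<noteq> {}" and x: "x \<notin> K"
  shows "((\<lambda>x. infdist x K) has_derivative (\<lambda>v. ((x - closest_point K x) \<bullet> v) / infdist x K)) (at x)"
proof -
  have pos: "infdist x K > 0"
    using infdist_pos_not_in_closed[OF K(1) K(3) x] .
  have "((\<lambda>x. sqrt ((infdist x K)\<^sup>2)) has_derivative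
      (\<lambda>v. (2 * ((x - closest_point K x) \<bullet> v)) * (inverse (sqrt ((infdist x K)\<^sup>2)) / 2))) (at x)"
    using pos by (intro has_derivative_real_sqrt has_derivative_infdist_square[OF K]) auto
  then show ?thesis
    using pos by (simp add: infdist_nonneg field_simps)
qed

text \<open>
Moving orthogonally to \<open>K\<close> changes the residual by exactly the displacement. Each such unit
direction contributes \<open>1\<close> to the divergence of the residual field, which is where the codimension
enters the Hardy constant.
\<close>

lemma closest_point_orthogonal_shift:
  fixes K :: "'a::euclidean_space set"
  assumes K: "closed K" "convex K" "K \<noteq> {}"
    and u: "\<And>y z. y \<in> K \<Longrightarrow> z \<in> K \<Longrightarrow> u \<bullet> (y - z) = 0"
  shows "closest_point K (x + u) = closest_point K x"
proof -
  let ?P = "closest_point K"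
  have "\<forall>z\<in>K. dist (x + u) (?P x) \<le> dist (x + u) z"
  proof
    fix z assume z: "z \<in> K"
    have "(x - ?P x) \<bullet> (z - ?P x) \<le> 0" "u \<bullet> (z - ?P x) = 0"
      using closest_point_dot[OF K(2,1) z, of x] u[OF z closest_point_in_set[OF K(1,3)]] by auto
    then have "((x + u) - ?P x) \<bullet> (z - ?P x) \<le> 0"
      by (simp add: inner_add_left inner_diff_left algebra_simps)
    moreover have "(norm ((x + u) - z))\<^sup>2 = (norm ((x + u) - ?P x))\<^sup>2
        - 2 * (((x + u) - ?P x) \<bullet> (z - ?P x)) + (norm (z - ?P x))\<^sup>2"
      unfolding power2_norm_eq_inner by (simp add: algebra_simps inner_commute)
    ultimately have "(norm ((x + u) - ?P x))\<^sup>2 \<le> (norm ((x + u) - z))\<^sup>2"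
      by (smt (verit) zero_le_power2)
    then show "dist (x + u) (?P x) \<le> dist (x + u) z"
      unfolding dist_norm by (rule power2_le_imp_le) simp
  qed
  then show ?thesis
    using closest_point_unique[OF K(2,1) closest_point_in_set[OF K(1,3)]] by metis
qed

section \<open>The divergence inequality for distance weights\<close>

lemma continuous_on_UNIV_extend_zero:
  fixes g :: "'a::topological_space \<Rightarrow> 'b::real_normed_vector"
  assumes g: "continuous_on U g" and U: "open U" and S: "closed S" "S \<subseteq> U"
    and out: "\<And>x. x \<notin> S \<Longrightarrow> g x = 0"
  shows "continuous_on UNIV g"
proof -
  have "continuous_on (- S) g"
    using continuous_on_const[of "- S" 0] by (rule continuous_on_eq) (simp add: out)
  then have "continuous_on (U \<union> - S) g"
    using U S g by (intro continuous_on_open_Un) auto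
  moreover have "U \<union> - S = UNIV" using S by blast
  ultimately show ?thesis by simp
qed

definition orthonormal_basis :: "'a::euclidean_space set \<Rightarrow> bool" where
  "orthonormal_basis B \<longleftrightarrow> finite B \<and> (\<forall>u\<in>B. \<forall>v\<in>B. u \<bullet> v = (if u = v then 1 else 0)) \<and>
     (\<forall>x. x = (\<Sum>u\<in>B. (x \<bullet> u) *\<^sub>R u))"

lemma orthonormal_basis_inner:
  assumes "orthonormal_basis B"
  shows "x \<bullet> y = (\<Sum>u\<in>B. (x \<bullet> u) * (y \<bullet> u))"
proof -
  have "x \<bullet> y = (\<Sum>u\<in>B. (x \<bullet> u) *\<^sub>R u) \<bullet> y"
    using assms by (metis orthonormal_basis_def)
  then show ?thesis by (simp add: inner_sum_left inner_commute[of y])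
qed

lemma linear_orthonormal_basis_expand:
  fixes f :: "'a::euclidean_space \<Rightarrow> real"
  assumes "orthonormal_basis B" "linear f"
  shows "f x = (\<Sum>u\<in>B. (x \<bullet> u) * f u)"
proof -
  have "f x = f (\<Sum>u\<in>B. (x \<bullet> u) *\<^sub>R u)"
    using assms by (metis orthonormal_basis_def)
  then show ?thesis using assms(2) by (simp add: linear_sum linear_scale)
qed

text \<open>
With \<open>V x = x - P x\<close> and \<open>d\<close> the distance to \<open>K\<close>, the function \<open>F\<close> is \<open>V \<sqdot> \<nabla>(\<omega>(d) \<rho>)\<close>, because
\<open>V = d \<nabla>d\<close>. The claim is the weak form of \<open>div V \<ge> card W\<close>: in an orthonormal basis, every
direction in \<open>W\<close>, being orthogonal to \<open>K\<close>, contributes exactly \<open>1\<close>, and every other direction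
contributes at least \<open>0\<close> by monotonicity of \<open>V\<close>.
\<close>

lemma hardy_divergence_inequality:
  fixes K :: "'a::euclidean_space set" and \<rho> :: "'a \<Rightarrow> real" and \<rho>' :: "'a \<Rightarrow> 'a \<Rightarrow> real"
    and \<omega> \<omega>' :: "real \<Rightarrow> real"
  assumes K: "closed K" "convex K" "K \<noteq> {}"
    and B: "orthonormal_basis B" "W \<subseteq> B"
    and W: "\<And>u y z. u \<in> W \<Longrightarrow> y \<in> K \<Longrightarrow> z \<in> K \<Longrightarrow> u \<bullet> (y - z) = 0"
    and \<omega>: "\<And>s. s > 0 \<Longrightarrow> (\<omega> has_real_derivative \<omega>' s) (at s)"
    and \<omega>': "continuous_on {0<..} \<omega>'" and \<omega>0: "\<And>s. s > 0 \<Longrightarrow> \<omega> s \<ge> 0"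
    and S: "compact S" "S \<inter> K = {}"
    and out: "\<And>x. x \<notin> S \<Longrightarrow> \<rho> x = 0" "\<And>x v. x \<notin> S \<Longrightarrow> \<rho>' x v = 0"
    and \<rho>0: "\<And>x. \<rho> x \<ge> 0"
    and \<rho>: "\<And>x. (\<rho> has_derivative \<rho>' x) (at x)" and \<rho>': "\<And>v. continuous_on UNIV (\<lambda>x. \<rho>' x v)"
  defines "F \<equiv> \<lambda>x. \<omega>' (infdist x K) * infdist x K * \<rho> x
                 + \<omega> (infdist x K) * \<rho>' x (x - closest_point K x)"
  shows "integrable lborel F" and "(\<integral>x. F x \<partial>lborel) \<le> - card W * (\<integral>x. \<omega> (infdist x K) * \<rho> x \<partial>lborel)"
proof -
  define d where "d = (\<lambda>x. infdist x K)"
  define V where "V = (\<lambda>x. x - closest_point K x)"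
  define \<psi> where "\<psi> = (\<lambda>x. \<omega> (d x) * \<rho> x)"
  define \<psi>' where "\<psi>' = (\<lambda>u x. (\<omega>' (d x) * ((V x \<bullet> u) / d x)) * \<rho> x + \<omega> (d x) * \<rho>' x u)"
  have clS: "closed S" using S(1) by (rule compact_imp_closed)
  have SU: "S \<subseteq> - K" using S(2) by blast
  have oU: "open (- K)" using K(1) by (simp add: open_Compl)
  have dpos: "d x > 0" if "x \<notin> K" for x
    using infdist_pos_not_in_closed[OF K(1,3) that] by (simp add: d_def)
  have d_eq: "infdist x K = d x" and V_eq: "x - closest_point K x = V x" for x
    by (simp_all add: d_def V_def)
  have contd: "continuous_on X d" for X
    unfolding d_def by (intro continuous_intros)
  have contV: "continuous_on X V" for X
    unfolding V_def by (intro continuous_intros continuous_on_closest_point K)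
  have cont\<rho>: "continuous_on X \<rho>" for X
    using \<rho> by (meson continuous_at_imp_continuous_on has_derivative_continuous)
  have cont\<omega>: "continuous_on {0<..} \<omega>"
    using \<omega> by (meson DERIV_isCont continuous_at_imp_continuous_on greaterThan_iff)
  have \<psi>cont: "continuous_on UNIV \<psi>"
  proof (rule continuous_on_UNIV_extend_zero[OF _ oU clS SU])
    show "continuous_on (- K) \<psi>" unfolding \<psi>_def
      by (intro continuous_intros cont\<rho> continuous_on_compose2[OF cont\<omega> contd]) (auto simp: dpos)
  qed (simp add: \<psi>_def out)
  have \<psi>'cont: "continuous_on UNIV (\<psi>' u)" for u
  proof (rule continuous_on_UNIV_extend_zero[OF _ oU clS SU])
    show "continuous_on (- K) (\<psi>' u)" unfolding \<psi>'_def
      by (intro continuous_intros cont\<rho> continuous_on_compose2[OF cont\<omega> contd] contV contd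
            continuous_on_compose2[OF \<omega>' contd] continuous_on_subset[OF \<rho>'])
         (auto simp: dpos less_imp_neq[OF dpos, THEN not_sym])
  qed (simp add: \<psi>'_def out)
  have deriv: "((\<lambda>t. \<psi> (x + t *\<^sub>R u)) has_real_derivative \<psi>' u x) (at 0)" for u x
  proof (cases "x \<in> K")
    case False
    have "((\<lambda>x. \<omega> (d x)) has_derivative (\<lambda>v. \<omega>' (d x) * ((V x \<bullet> v) / d x))) (at x)"
      using has_derivative_compose[OF has_derivative_infdist[OF K False], of \<omega> "(*) (\<omega>' (d x))"]
        \<omega>[OF dpos[OF False]] by (simp add: has_field_derivative_def d_def V_def)
    from has_derivative_mult[OF this \<rho>[of x]]
    have "(\<psi> has_derivative (\<lambda>v. \<psi>' v x)) (at x)"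
      unfolding \<psi>_def \<psi>'_def by (rule has_derivative_eq_rhs) (auto simp: algebra_simps)
    then have D: "(\<psi> has_derivative (\<lambda>v. \<psi>' v x)) (at (x + 0 *\<^sub>R u))" by simp
    have "((\<lambda>t. x + t *\<^sub>R u) has_derivative (\<lambda>t. t *\<^sub>R u)) (at 0)"
      by (auto intro!: derivative_eq_intros)
    from has_derivative_compose[OF this D]
    have "((\<lambda>t. \<psi> (x + t *\<^sub>R u)) has_derivative (\<lambda>t. \<psi>' (t *\<^sub>R u) x)) (at 0)" .
    moreover have "\<psi>' (t *\<^sub>R u) x = \<psi>' u x * t" for t
      using linear_scale[OF has_derivative_linear[OF \<open>(\<psi> has_derivative (\<lambda>v. \<psi>' v x)) (at x)\<close>], of t u]
      by (simp add: mult.commute)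
    ultimately show ?thesis by (simp add: has_field_derivative_def)
  next
    case True
    have xS: "x \<notin> S" using True S by blast
    then have "((\<lambda>t. \<psi> (x + t *\<^sub>R u)) has_real_derivative 0) (at 0)"
      by (rule directional_derivative_zero_outside[OF clS]) (simp add: \<psi>_def out)
    moreover have "\<psi>' u x = 0" using xS by (simp add: \<psi>'_def out)
    ultimately show ?thesis by simp
  qed
  have \<psi>0: "\<psi> x \<ge> 0" for x
  proof (cases "x \<in> S")
    case True
    then have "d x > 0" using dpos S by blast
    then show ?thesis by (simp add: \<psi>_def \<omega>0 \<rho>0)
  qed (simp add: \<psi>_def out)
  define c where "c = (\<lambda>u. if u \<in> W then 1 else 0 :: real)"
  have incr: "c u * h * \<psi> (x + h *\<^sub>R u) \<le> (V (x + h *\<^sub>R u) \<bullet> u - V x \<bullet> u) * \<psi> (x + h *\<^sub>R u)"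
    if "h > 0" "u \<in> B" for u x h
  proof (rule mult_right_mono[OF _ \<psi>0])
    show "c u * h \<le> V (x + h *\<^sub>R u) \<bullet> u - V x \<bullet> u"
    proof (cases "u \<in> W")
      case True
      have "closest_point K (x + h *\<^sub>R u) = closest_point K x"
        by (rule closest_point_orthogonal_shift[OF K]) (simp add: W[OF True])
      then show ?thesis using B that
        by (auto simp: V_def c_def orthonormal_basis_def algebra_simps)
    next
      case False
      have "(V (x + h *\<^sub>R u) - V x) \<bullet> ((x + h *\<^sub>R u) - x) \<ge> 0"
        unfolding V_def by (rule closest_point_residual_monotone[OF K])
      then show ?thesis using False that(1)
        by (simp add: c_def inner_diff_left zero_le_mult_iff)
    qed
  qed
  have contVu: "continuous_on UNIV (\<lambda>x. V x \<bullet> u)" for u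
    by (intro continuous_intros contV)
  have out\<psi>: "\<psi> x = 0" if "x \<notin> S" for x using that by (simp add: \<psi>_def out)
  note ibp = integration_by_parts_inequality[OF contVu \<psi>cont \<psi>'cont S(1) out\<psi> deriv incr]
  have F: "F x = (\<Sum>u\<in>B. (V x \<bullet> u) * \<psi>' u x)" for x
  proof (cases "x \<in> S")
    case False
    then show ?thesis by (simp add: F_def \<psi>'_def out)
  next
    case True
    then have "d x > 0" using dpos S by blast
    have d2: "d x * d x = V x \<bullet> V x"
      using infdist_eq_dist_closest_point[OF K(1,3), of x]
      by (simp add: d_def V_def power2_norm_eq_inner[symmetric] power2_eq_square)
    have "(\<Sum>u\<in>B. (V x \<bullet> u) * \<psi>' u x)
        = (\<Sum>u\<in>B. (\<omega>' (d x) / d x * \<rho> x) * ((V x \<bullet> u) * (V x \<bullet> u)) + \<omega> (d x) * ((V x \<bullet> u) * \<rho>' x u))"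
      by (intro sum.cong) (auto simp: \<psi>'_def algebra_simps)
    also have "\<dots> = (\<omega>' (d x) / d x * \<rho> x) * (V x \<bullet> V x) + \<omega> (d x) * \<rho>' x (V x)"
      by (simp only: sum.distrib sum_distrib_left[symmetric] orthonormal_basis_inner[OF B(1), symmetric]
          linear_orthonormal_basis_expand[OF B(1) has_derivative_linear[OF \<rho>], symmetric])
    also have "\<dots> = F x"
      using \<open>d x > 0\<close> by (simp add: F_def d_eq V_eq d2[symmetric])
    finally show ?thesis by simp
  qed
  have F': "F = (\<lambda>x. \<Sum>u\<in>B. (V x \<bullet> u) * \<psi>' u x)" using F by (simp add: fun_eq_iff)
  show "integrable lborel F"
    unfolding F' by (intro Bochner_Integration.integrable_sum ibp(1)) auto
  have "(\<integral>x. F x \<partial>lborel) = (\<Sum>u\<in>B. \<integral>x. (V x \<bullet> u) * \<psi>' u x \<partial>lborel)"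
    unfolding F' by (intro Bochner_Integration.integral_sum ibp(1)) auto
  also have "\<dots> \<le> (\<Sum>u\<in>B. - c u * (\<integral>x. \<psi> x \<partial>lborel))"
    by (intro sum_mono ibp(2)) auto
  also have "\<dots> = - card W * (\<integral>x. \<psi> x \<partial>lborel)"
  proof -
    have "finite B" using B by (simp add: orthonormal_basis_def)
    then have "(\<Sum>u\<in>B. c u) = real (card W)"
      using B(2) by (simp add: c_def sum.If_cases Int_absorb1)
    then show ?thesis by (simp add: sum_distrib_right[symmetric] sum_negf)
  qed
  finally show "(\<integral>x. F x \<partial>lborel) \<le> - card W * (\<integral>x. \<omega> (infdist x K) * \<rho> x \<partial>lborel)"
    by (simp add: \<psi>_def d_def)
qed

section \<open>The Hardy inequality outside a convex set\<close>

lemma powr_ge_tangent_at_1: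
  fixes y p :: real
  assumes "p \<ge> 1" "y \<ge> 0"
  shows "1 + p * (y - 1) \<le> y powr p"
proof (cases "y = 0")
  case False
  then have "y powr p - 1 powr p \<ge> p * (y - 1)"
    using assms
    by (intro convex_on_imp_above_tangent[OF powr_convex])
      (auto intro!: derivative_eq_intros simp: interior_open)
  then show ?thesis by simp
qed (use assms in simp)

text \<open>
Young's inequality with the weight \<open>a\<close> chosen so that, with \<open>a\<close> the claimed constant, it gives the
sharp inequality by absorption, without passing through Hoelder's inequality.
\<close>

lemma young_hardy:
  fixes a p r t :: real
  assumes "p \<ge> 1" "a > 0" "r > 0" "t \<ge> 0"
  shows "p * r powr (p - 1) * t \<le> (p - 1) * a * r powr p + a powr (1 - p) * t powr p"
proof -
  define y where "y = t / (a * r)"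
  have t: "t = y * (a * r)" using assms by (simp add: y_def)
  have y0: "y \<ge> 0" using assms by (simp add: y_def)
  have p1: "r powr p = r * r powr (p - 1)" 
    using assms by (simp add: powr_mult_base)
  have p2: "a powr (1 - p) * a powr p = a"
    using assms by (simp add: powr_add[symmetric])
  have "p * r powr (p - 1) * t = a * r powr p * (p * y)"
    by (simp add: t p1 algebra_simps)
  also have "\<dots> \<le> a * r powr p * ((p - 1) + y powr p)"
    using powr_ge_tangent_at_1[OF assms(1) y0] assms
    by (intro mult_left_mono) (auto simp: algebra_simps)
  also have "t powr p = y powr p * (a powr p * r powr p)"
    using assms y0 by (simp add: t powr_mult)
  then have "a * r powr p * ((p - 1) + y powr p)
      = (p - 1) * a * r powr p + a powr (1 - p) * t powr p"
    using p2 by (simp add: algebra_simps)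
  finally show ?thesis .
qed

text \<open>
The logarithmic derivative \<open>s c'(s) / c(s)\<close> of the weight \<open>c(s) = s\<^sup>\<delta> (1 + s)\<^bsup>\<delta>' - \<delta>\<^esup>\<close>. It moves
monotonically from \<open>\<delta>\<close> at \<open>0\<close> to \<open>\<delta>'\<close> at infinity, so its infimum \<open>min \<delta> \<delta>'\<close> is approached at
one of the two ends; this is why only the minimum is seen by the optimal constant.
\<close>

definition hardy_log_deriv :: "real \<Rightarrow> real \<Rightarrow> real \<Rightarrow> real" where
  "hardy_log_deriv \<delta> \<delta>' s = \<delta> + (\<delta>' - \<delta>) * (s / (1 + s))"

lemma hardy_log_deriv_ge:
  assumes "s > 0" shows "min \<delta> \<delta>' \<le> hardy_log_deriv \<delta> \<delta>' s"
proof -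
  have e: "hardy_log_deriv \<delta> \<delta>' s = (\<delta> + s * \<delta>') / (1 + s)"
    using assms by (simp add: hardy_log_deriv_def field_simps)
  have "min \<delta> \<delta>' \<le> \<delta>" "s * min \<delta> \<delta>' \<le> s * \<delta>'"
    using assms by (auto intro!: mult_left_mono)
  then have "min \<delta> \<delta>' * (1 + s) \<le> \<delta> + s * \<delta>'"
    by (simp add: algebra_simps)
  then show ?thesis using assms by (simp add: e pos_le_divide_eq)
qed

lemma hardy_weight_pos: "s > 0 \<Longrightarrow> hardy_weight \<delta> \<delta>' s > 0"
  by (simp add: hardy_weight_def)

lemma hardy_weight_powr_deriv:
  assumes s: "s > 0"
  shows "((\<lambda>s. hardy_weight \<delta> \<delta>' s * s powr b) has_real_derivative
     hardy_weight \<delta> \<delta>' s * s powr b * ((hardy_log_deriv \<delta> \<delta>' s + b) / s)) (at s)"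
proof -
  have "((\<lambda>s. hardy_weight \<delta> \<delta>' s * s powr b) has_real_derivative
     (\<delta> * s powr (\<delta> - 1) * (1 + s) powr (\<delta>' - \<delta>)
      + s powr \<delta> * ((\<delta>' - \<delta>) * (1 + s) powr (\<delta>' - \<delta> - 1))) * s powr b
      + s powr \<delta> * (1 + s) powr (\<delta>' - \<delta>) * (b * s powr (b - 1))) (at s)"
    unfolding hardy_weight_def using s
    by (auto intro!: derivative_eq_intros simp: algebra_simps)
  moreover have "s powr (\<delta> - 1) = s powr \<delta> / s" "s powr (b - 1) = s powr b / s"
      "(1 + s) powr (\<delta>' - \<delta> - 1) = (1 + s) powr (\<delta>' - \<delta>) / (1 + s)"
    using s by (simp_all add: powr_diff)
  moreover have "(\<delta> * (A / s) * C + A * ((\<delta>' - \<delta>) * (C / (1 + s)))) * P + A * C * (b * (P / s))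
      = A * C * P * ((\<delta> + (\<delta>' - \<delta>) * (s / (1 + s)) + b) / s)" for A C P
  proof -
    have "1 + s \<noteq> 0" using s by simp
    then show ?thesis using s by (simp add: divide_simps) (simp add: algebra_simps)
  qed
  ultimately show ?thesis
    by (simp only: hardy_weight_def hardy_log_deriv_def)
qed

lemma C1c_has_derivative:
  fixes \<phi> :: "real^'n::finite \<Rightarrow> real"
  assumes "\<phi> \<in> C1c \<Omega>"
  obtains D where "\<And>x. (\<phi> has_derivative D x) (at x)" "\<And>v. continuous_on UNIV (\<lambda>x. D x v)"
    "\<And>x v. \<bar>D x v\<bar> \<le> norm v * grad_norm \<phi> x" "continuous_on UNIV (grad_norm \<phi>)"
    "\<And>x. x \<notin> closure {x. \<phi> x \<noteq> 0} \<Longrightarrow> D x = (\<lambda>v. 0)" 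
    "\<And>x. x \<notin> closure {x. \<phi> x \<noteq> 0} \<Longrightarrow> grad_norm \<phi> x = 0" 
proof -
  define D where "D = (\<lambda>x. frechet_derivative \<phi> (at x))"
  have "\<phi> differentiable at x" for x
    using assms by (auto simp: C1c_def differentiable_on_def)
  then have D: "(\<phi> has_derivative D x) (at x)" for x
    unfolding D_def by (simp add: frechet_derivative_works)
  have exp: "D x v = (\<Sum>j\<in>UNIV. v $ j * partial_deriv j \<phi> x)" for x v
  proof -
    have lin: "linear (D x)" by (rule has_derivative_linear[OF D])
    have "D x v = D x (\<Sum>j\<in>UNIV. (v $ j) *\<^sub>R axis j 1)"
      by (simp add: basis_expansion scalar_mult_eq_scaleR[symmetric])
    also have "\<dots> = (\<Sum>j\<in>UNIV. v $ j * partial_deriv j \<phi> x)"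
      using lin by (simp add: linear_sum linear_scale partial_deriv_def D_def)
    finally show ?thesis .
  qed
  have cont: "continuous_on UNIV (partial_deriv j \<phi>)" for j using assms by (simp add: C1c_def)
  have c1: "continuous_on UNIV (\<lambda>x. D x v)" for v
    unfolding exp by (intro continuous_intros cont)
  have c2: "continuous_on UNIV (grad_norm \<phi>)"
    unfolding grad_norm_def[abs_def] by (intro continuous_intros cont)
  have bd: "\<bar>D x v\<bar> \<le> norm v * grad_norm \<phi> x" for x v
  proof -
    define g where "g = (\<chi> j. partial_deriv j \<phi> x)"
    have "D x v = v \<bullet> g" by (simp add: exp g_def inner_vec_def)
    moreover have "norm g = grad_norm \<phi> x"
      by (simp add: g_def grad_norm_def norm_vec_def L2_set_def)
    ultimately show ?thesis using Cauchy_Schwarz_ineq2[of v g] by simp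
  qed
  have \<phi>0: "\<phi> x = 0" if "x \<notin> closure {x. \<phi> x \<noteq> 0}" for x
    using that closure_subset[of "{x. \<phi> x \<noteq> 0}"] by auto
  have z: "D x = (\<lambda>v. 0)" if "x \<notin> closure {x. \<phi> x \<noteq> 0}" for x
  proof -
    have ev: "eventually (\<lambda>y. y \<in> - closure {x. \<phi> x \<noteq> 0}) (nhds x)"
      using that by (intro eventually_nhds_in_open) auto
    have "((\<lambda>y. 0) has_derivative D x) (at x)"
    proof (rule has_derivative_transform_eventually[OF D])
      show "\<forall>\<^sub>F y in at x. \<phi> y = 0"
        unfolding eventually_at_filter using ev
        by (rule eventually_mono) (use \<phi>0 in blast)
      show "\<phi> x = 0" using that by (rule \<phi>0)
    qed simp
    then show ?thesis
      using has_derivative_unique[OF _ has_derivative_const] by blast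
  qed
  have z2: "grad_norm \<phi> x = 0" if "x \<notin> closure {x. \<phi> x \<noteq> 0}" for x
    using z[OF that] by (simp add: grad_norm_def partial_deriv_def D_def)
  show thesis by (rule that[OF D c1 bd c2 z z2])
qed

text \<open>
The divergence inequality is applied to \<open>\<omega>(s) = c(s) s\<^bsup>-p\<^esup>\<close> and to the regularisation
\<open>\<rho> = (\<phi>\<^sup>2 + \<epsilon>\<^sup>2)\<^bsup>p/2\<^esup> - \<epsilon>\<^sup>p\<close> of \<open>|\<phi>|\<^sup>p\<close>, which is continuously differentiable also for \<open>p = 1\<close> and
vanishes wherever \<open>\<phi>\<close> does. Since \<open>s \<omega>'(s) \<ge> (min \<delta> \<delta>' - p) \<omega>(s)\<close>, this yields
\<open>p a \<integral> \<omega> \<rho> \<le> \<integral> \<omega> d |\<nabla>\<rho>|\<close>; Young's inequality bounds the right side by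
\<open>(p - 1) a \<integral> \<omega> (\<rho> + \<epsilon>\<^sup>p) + a\<^bsup>1-p\<^esup> \<integral> c |\<nabla>\<phi>|\<^sup>p\<close> on the support, the first term is absorbed, and \<open>\<epsilon> \<rightarrow> 0\<close>.
\<close>

theorem hardy_inequality_convex:
  fixes K :: "(real^'n::finite) set" and \<phi> :: "real^'n \<Rightarrow> real" and p \<delta> \<delta>' :: real
  assumes K: "closed K" "convex K" "K \<noteq> {}"
    and B: "orthonormal_basis B" "W \<subseteq> B"
    and W: "\<And>u y z. u \<in> W \<Longrightarrow> y \<in> K \<Longrightarrow> z \<in> K \<Longrightarrow> u \<bullet> (y - z) = 0"
    and p: "p \<ge> 1" and pos: "card W + min \<delta> \<delta>' - p > 0"
    and \<phi>: "\<phi> \<in> C1c (- K)"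
  defines "a \<equiv> (card W + min \<delta> \<delta>' - p) / p"
  defines "w \<equiv> \<lambda>x. hardy_weight \<delta> \<delta>' (infdist x K)"
  shows "a powr p * (LINT x:-K|lborel. w x * infdist x K powr (-p) * \<bar>\<phi> x\<bar> powr p)
     \<le> (LINT x:-K|lborel. w x * grad_norm \<phi> x powr p)"
proof -
  obtain D where D: "\<And>x. (\<phi> has_derivative D x) (at x)" "\<And>v. continuous_on UNIV (\<lambda>x. D x v)"
    "\<And>x v. \<bar>D x v\<bar> \<le> norm v * grad_norm \<phi> x" "continuous_on UNIV (grad_norm \<phi>)"
    "\<And>x. x \<notin> closure {x. \<phi> x \<noteq> 0} \<Longrightarrow> D x = (\<lambda>v. 0)" 
    "\<And>x. x \<notin> closure {x. \<phi> x \<noteq> 0} \<Longrightarrow> grad_norm \<phi> x = 0"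
    by (rule C1c_has_derivative[OF \<phi>], rule that)
  define S where "S = closure {x. \<phi> x \<noteq> 0}"
  have S: "compact S" "S \<inter> K = {}" using \<phi> by (auto simp: C1c_def S_def)
  have \<phi>0: "\<phi> x = 0" if "x \<notin> S" for x using that closure_subset[of "{x. \<phi> x \<noteq> 0}"] by (auto simp: S_def)
  define d where "d = (\<lambda>x. infdist x K)"
  define g where "g = grad_norm \<phi>"
  have a: "a > 0" "p * a = card W + min \<delta> \<delta>' - p" using p pos by (auto simp: a_def)
  define \<omega> where "\<omega> = (\<lambda>s. hardy_weight \<delta> \<delta>' s * s powr (-p))"
  define \<omega>' where "\<omega>' = (\<lambda>s. \<omega> s * ((hardy_log_deriv \<delta> \<delta>' s + - p) / s))"
  have \<omega>d: "(\<omega> has_real_derivative \<omega>' s) (at s)" if "s > 0" for s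
    unfolding \<omega>_def \<omega>'_def by (rule hardy_weight_powr_deriv[OF that])
  have cont\<omega>: "continuous_on {0<..} \<omega>"
    using \<omega>d by (meson DERIV_isCont continuous_at_imp_continuous_on greaterThan_iff)
  have cont\<omega>': "continuous_on {0<..} \<omega>'"
    unfolding \<omega>'_def hardy_log_deriv_def by (intro continuous_intros cont\<omega>) auto
  have \<omega>pos: "\<omega> s > 0" if "s > 0" for s
    using that by (simp add: \<omega>_def hardy_weight_pos)
  have dpos: "d x > 0" if "x \<in> S" for x
    using infdist_pos_not_in_closed[OF K(1,3)] that S(2) unfolding d_def by blast
  have cont\<phi>: "continuous_on X \<phi>" for X
    using D(1) by (meson continuous_at_imp_continuous_on has_derivative_continuous)
  have d_eq: "infdist x K = d x" for x by (simp add: d_def)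
  have contd: "continuous_on X d" for X unfolding d_def by (intro continuous_intros)
  have cont\<omega>d: "continuous_on S (\<lambda>x. \<omega> (d x))"
    by (rule continuous_on_compose2[OF cont\<omega> contd]) (auto simp: dpos)
  have on_S: "integrable lborel (\<lambda>x. indicator S x * f x)" if "continuous_on S f" for f :: "real^'n \<Rightarrow> real"
    using borel_integrable_compact[OF S(1) that] by simp
  have contp: "continuous_on X (\<lambda>x. f x powr p)" if "continuous_on X f" "\<And>x. f x \<ge> 0"
    for f :: "real^'n \<Rightarrow> real" and X
    using that p by (intro continuous_on_powr') auto
  define L where "L = (\<integral>x. indicator S x * (\<omega> (d x) * \<bar>\<phi> x\<bar> powr p) \<partial>lborel)"
  define R where "R = (\<integral>x. indicator S x * (\<omega> (d x) * (d x powr p * g x powr p)) \<partial>lborel)"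
  define M where "M = (\<integral>x. indicator S x * \<omega> (d x) \<partial>lborel)"
  have iL: "integrable lborel (\<lambda>x. indicator S x * (\<omega> (d x) * \<bar>\<phi> x\<bar> powr p))"
    by (intro on_S continuous_on_mult cont\<omega>d contp continuous_on_rabs cont\<phi>) simp
  have iR: "integrable lborel (\<lambda>x. indicator S x * (\<omega> (d x) * (d x powr p * g x powr p)))"
    unfolding g_def
    by (intro on_S continuous_on_mult cont\<omega>d contp contd continuous_on_subset[OF D(4)])
      (auto simp: d_def infdist_nonneg grad_norm_def sum_nonneg)
  have iM: "integrable lborel (\<lambda>x. indicator S x * \<omega> (d x))"
    by (intro on_S cont\<omega>d)
  have main: "a * L - p * a * \<epsilon> powr p * M - a powr (1 - p) * R \<le> 0" if \<epsilon>: "\<epsilon> > 0" for \<epsilon>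
  proof -
    define \<rho> where "\<rho> = (\<lambda>x. ((\<phi> x)\<^sup>2 + \<epsilon>\<^sup>2) powr (p / 2) - \<epsilon> powr p)"
    define \<rho>' where "\<rho>' = (\<lambda>x v. p * ((\<phi> x)\<^sup>2 + \<epsilon>\<^sup>2) powr (p / 2 - 1) * \<phi> x * D x v)"
    define r where "r = (\<lambda>x. sqrt ((\<phi> x)\<^sup>2 + \<epsilon>\<^sup>2))"
    have q: "(\<phi> x)\<^sup>2 + \<epsilon>\<^sup>2 > 0" for x using \<epsilon> by (simp add: add_nonneg_pos)
    have rpos: "r x > 0" for x using q by (simp add: r_def)
    have r\<phi>: "\<bar>\<phi> x\<bar> \<le> r x" and r\<epsilon>: "\<epsilon> \<le> r x" for x
      using \<epsilon> by (auto simp: r_def intro!: real_le_rsqrt)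
    have rp: "((\<phi> x)\<^sup>2 + \<epsilon>\<^sup>2) powr (b / 2) = r x powr b" for b x
      using q[of x] by (simp add: r_def powr_half_sqrt[symmetric] powr_powr)
    have \<rho>r: "\<rho> x = r x powr p - \<epsilon> powr p" for x by (simp add: \<rho>_def rp)
    have \<rho>0: "\<rho> x \<ge> 0" for x
      using r\<epsilon>[of x] p \<epsilon> by (simp add: \<rho>r powr_mono2)
    have \<rho>'bd: "\<bar>\<rho>' x v\<bar> \<le> p * r x powr (p - 1) * (norm v * g x)" for x v
    proof -
      have "((\<phi> x)\<^sup>2 + \<epsilon>\<^sup>2) powr (p / 2 - 1) = r x powr (p - 2)"
        using rp[of x "p - 2"] by (simp add: diff_divide_distrib)
      then have "\<bar>\<rho>' x v\<bar> = p * (r x powr (p - 2) * \<bar>\<phi> x\<bar>) * \<bar>D x v\<bar>"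
        using p by (simp add: \<rho>'_def abs_mult)
      also have "\<dots> \<le> p * (r x powr (p - 2) * r x) * (norm v * g x)"
        using p r\<phi>[of x] D(3)[of x v] rpos[of x] by (intro mult_mono) (auto simp: g_def)
      also have "r x powr (p - 2) * r x = r x powr (p - 1)"
        using powr_mult_base[of "r x" "p - 2"] rpos[of x] by (simp add: mult.commute)
      finally show ?thesis .
    qed
    have \<rho>d: "(\<rho> has_derivative \<rho>' x) (at x)" for x
    proof -
      have "((\<lambda>v. (v\<^sup>2 + \<epsilon>\<^sup>2) powr (p / 2) - \<epsilon> powr p) has_real_derivative
          p * ((\<phi> x)\<^sup>2 + \<epsilon>\<^sup>2) powr (p / 2 - 1) * \<phi> x) (at (\<phi> x))"
        using q[of x] by (auto intro!: derivative_eq_intros)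
      from has_derivative_compose[OF D(1)[of x] this[unfolded has_field_derivative_def]]
      show ?thesis unfolding \<rho>_def \<rho>'_def by simp
    qed
    have \<rho>'c: "continuous_on UNIV (\<lambda>x. \<rho>' x v)" for v
      unfolding \<rho>'_def using q
      by (intro continuous_intros cont\<phi> D(2)) (auto simp: less_imp_neq[THEN not_sym])
    have \<epsilon>r: "(\<epsilon>\<^sup>2) powr (p / 2) = \<epsilon> powr p"
      using \<epsilon> by (simp add: powr_powr flip: powr_numeral)
    have \<rho>out: "\<rho> x = 0" "\<rho>' x v = 0" if "x \<notin> S" for x v
      using that D(5) by (simp_all add: \<rho>_def \<rho>'_def \<phi>0 \<epsilon>r)
    have \<omega>0: "\<omega> s \<ge> 0" if "s > 0" for s using \<omega>pos[OF that] by simp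
    define F where "F = (\<lambda>x. \<omega>' (infdist x K) * infdist x K * \<rho> x
                 + \<omega> (infdist x K) * \<rho>' x (x - closest_point K x))"
    note div = hardy_divergence_inequality[OF K B W \<omega>d cont\<omega>' \<omega>0 S \<rho>out \<rho>0 \<rho>d \<rho>'c, folded F_def]
    have i\<rho>: "integrable lborel (\<lambda>x. \<omega> (d x) * \<rho> x)"
    proof (rule integrable_continuous_compact_support[OF S(1)])
      show "continuous_on S (\<lambda>x. \<omega> (d x) * \<rho> x)" unfolding \<rho>_def using q
        by (intro continuous_intros cont\<omega>d cont\<phi>) (auto simp: less_imp_neq[THEN not_sym])
    qed (simp add: \<rho>out)
    have pw: "a * (indicator S x * (\<omega> (d x) * \<bar>\<phi> x\<bar> powr p)) - p * a * \<epsilon> powr p * (indicator S x * \<omega> (d x))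
        - a powr (1 - p) * (indicator S x * (\<omega> (d x) * (d x powr p * g x powr p)))
        \<le> F x + card W * (\<omega> (d x) * \<rho> x)" for x
    proof (cases "x \<in> S")
      case False
      then show ?thesis by (simp add: F_def \<rho>out)
    next
      case True
      note dx = dpos[OF True]
      have g0: "g x \<ge> 0" by (simp add: g_def grad_norm_def sum_nonneg)
      have "norm (x - closest_point K x) = d x"
        by (simp add: d_def infdist_eq_dist_closest_point[OF K(1,3)])
      then have "- \<rho>' x (x - closest_point K x) \<le> p * r x powr (p - 1) * (d x * g x)"
        using \<rho>'bd[of x "x - closest_point K x"] by simp
      also have "\<dots> \<le> (p - 1) * a * r x powr p + a powr (1 - p) * (d x * g x) powr p"
        using young_hardy[OF p a(1) rpos, of "d x * g x" x] dx g0 by simp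
      finally have 1: "- \<rho>' x (x - closest_point K x)
          \<le> (p - 1) * a * (\<rho> x + \<epsilon> powr p) + a powr (1 - p) * (d x powr p * g x powr p)"
        using dx g0 by (simp add: \<rho>r powr_mult)
      have 2: "(min \<delta> \<delta>' - p) * \<rho> x \<le> (hardy_log_deriv \<delta> \<delta>' (d x) - p) * \<rho> x"
        using hardy_log_deriv_ge[OF dx, of \<delta> \<delta>'] \<rho>0[of x] by (intro mult_right_mono) auto
      have "\<bar>\<phi> x\<bar> powr p \<le> r x powr p" using r\<phi>[of x] p by (intro powr_mono2) auto
      then have 3: "a * \<bar>\<phi> x\<bar> powr p \<le> a * (\<rho> x + \<epsilon> powr p)"
        using a by (intro mult_left_mono) (auto simp: \<rho>r)
      have "a * \<bar>\<phi> x\<bar> powr p - p * a * \<epsilon> powr p - a powr (1 - p) * (d x powr p * g x powr p)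
          \<le> (hardy_log_deriv \<delta> \<delta>' (d x) - p) * \<rho> x + \<rho>' x (x - closest_point K x) + card W * \<rho> x"
      proof -
        have "(p * a) * \<rho> x = (card W + min \<delta> \<delta>' - p) * \<rho> x" by (simp only: a(2))
        then show ?thesis using 1 2 3 by (simp add: algebra_simps)
      qed
      from mult_left_mono[OF this, of "\<omega> (d x)"]
      have "\<omega> (d x) * (a * \<bar>\<phi> x\<bar> powr p - p * a * \<epsilon> powr p - a powr (1 - p) * (d x powr p * g x powr p))
          \<le> \<omega> (d x) * ((hardy_log_deriv \<delta> \<delta>' (d x) - p) * \<rho> x + \<rho>' x (x - closest_point K x) + card W * \<rho> x)"
        using \<omega>0[OF dx] by simp
      also have "\<dots> = F x + card W * (\<omega> (d x) * \<rho> x)"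
      proof -
        have "\<omega>' (d x) * d x = \<omega> (d x) * (hardy_log_deriv \<delta> \<delta>' (d x) - p)"
          using dx by (simp add: \<omega>'_def)
        then show ?thesis
          unfolding F_def d_eq by (simp only:) (simp add: algebra_simps)
      qed
      finally show ?thesis using True by (simp add: algebra_simps)
    qed
    have "a * L - p * a * \<epsilon> powr p * M - a powr (1 - p) * R
      = (\<integral>x. a * (indicator S x * (\<omega> (d x) * \<bar>\<phi> x\<bar> powr p)) - p * a * \<epsilon> powr p * (indicator S x * \<omega> (d x))
        - a powr (1 - p) * (indicator S x * (\<omega> (d x) * (d x powr p * g x powr p))) \<partial>lborel)"
      unfolding L_def M_def R_def using iL iM iR by simp
    also have "\<dots> \<le> (\<integral>x. F x + card W * (\<omega> (d x) * \<rho> x) \<partial>lborel)"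
      by (rule integral_mono[OF _ _ pw]) (use iL iM iR i\<rho> div(1) in auto)
    also have "\<dots> = (\<integral>x. F x \<partial>lborel) + card W * (\<integral>x. \<omega> (d x) * \<rho> x \<partial>lborel)"
      using i\<rho> div(1) by simp
    also have "\<dots> \<le> 0" using div(2) by (simp add: d_def)
    finally show ?thesis .
  qed
  have lim: "((\<lambda>\<epsilon>. a * L - p * a * \<epsilon> powr p * M - a powr (1 - p) * R)
      \<longlongrightarrow> a * L - p * a * 0 powr p * M - a powr (1 - p) * R) (at_right 0)"
    using p by (intro tendsto_intros tendsto_powr') (auto simp: eventually_at_filter)
  have "a * L - p * a * 0 powr p * M - a powr (1 - p) * R \<le> 0"
    by (rule tendsto_upperbound[OF lim eventually_mono[OF eventually_at_right_less main]]) auto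
  then have "a powr (p - 1) * (a * L) \<le> a powr (p - 1) * (a powr (1 - p) * R)"
    by (intro mult_left_mono) auto
  moreover have "a powr (p - 1) * a = a powr p"
    using powr_mult_base[of a "p - 1"] a(1) by (simp add: mult.commute)
  moreover have "a powr (p - 1) * a powr (1 - p) = 1"
    using a(1) by (simp add: powr_add[symmetric])
  ultimately have LR: "a powr p * L \<le> R"
    by (simp only: mult.assoc[symmetric] mult_1_left)
  have "(LINT x:-K|lborel. w x * infdist x K powr (-p) * \<bar>\<phi> x\<bar> powr p) = L"
    unfolding L_def set_lebesgue_integral_def
    using S(2) by (intro Bochner_Integration.integral_cong)
      (auto simp: indicator_def w_def \<omega>_def d_def \<phi>0)
  moreover have "(LINT x:-K|lborel. w x * grad_norm \<phi> x powr p) = R"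
    unfolding R_def set_lebesgue_integral_def
  proof (intro Bochner_Integration.integral_cong refl)
    fix x
    show "indicator (- K) x *\<^sub>R (w x * grad_norm \<phi> x powr p)
        = indicator S x * (\<omega> (d x) * (d x powr p * g x powr p))"
    proof (cases "x \<in> S")
      case True
      then have "x \<notin> K" "d x powr (- p) * d x powr p = 1"
        using S(2) dpos[OF True] by (auto simp: powr_add[symmetric])
      then show ?thesis using True by (simp add: w_def \<omega>_def d_eq g_def)
    qed (use D(6) in \<open>simp add: S_def\<close>)
  qed
  ultimately show ?thesis using LR by simp
qed

section \<open>Large relative balls in sets of full dimension at infinity\<close>

lemma distr_PiM_lborel_coordinate_shift:
  fixes c :: real and i k :: nat
  assumes "i < k"
  defines "M \<equiv> \<Pi>\<^sub>M j\<in>{..<k}. (lborel :: real measure)"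
  shows "distr M M (\<lambda>y. y(i := y i + c)) = M"
    and "(\<lambda>y. y(i := y i + c)) \<in> measurable M M"
proof -
  interpret product_sigma_finite "\<lambda>j::nat. lborel :: real measure"
    by standard
  show meas: "(\<lambda>y. y(i := y i + c)) \<in> measurable M M"
    unfolding M_def
  proof (rule measurable_fun_upd[where J="{..<k}"])
    show "(\<lambda>y. y i + c) \<in> measurable (\<Pi>\<^sub>M j\<in>{..<k}. lborel) lborel"
      using assms(1) by (auto intro!: borel_measurable_add measurable_component_singleton)
  qed (use assms in auto)
  show "distr M M (\<lambda>y. y(i := y i + c)) = M"
    unfolding M_def
  proof (intro PiM_eqI)
    fix A :: "nat \<Rightarrow> real set"
    assume A: "\<And>j. j \<in> {..<k} \<Longrightarrow> A j \<in> sets lborel"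
    define A' where "A' = A(i := (\<lambda>x. x + c) -` A i)"
    have shift: "(\<lambda>x. x + c) -` A i \<in> sets lborel"
      using measurable_sets[of "\<lambda>x. x + c" lborel lborel "A i"] A assms(1) by simp
    have A': "A' j \<in> sets lborel" if "j \<in> {..<k}" for j
      using A shift that by (simp add: A'_def)
    have em: "emeasure lborel (A' j) = emeasure lborel (A j)" if "j \<in> {..<k}" for j
    proof (cases "j = i")
      case True
      have "emeasure lborel (A i) = emeasure (distr lborel borel ((+) c)) (A i)"
        by (simp only: lborel_distr_plus)
      also have "\<dots> = emeasure lborel (((+) c) -` A i \<inter> space lborel)"
        using A assms(1) by (intro emeasure_distr) auto
      also have "((+) c) -` A i \<inter> space lborel = A' i"
        by (auto simp: A'_def add.commute)
      finally show ?thesis using True by simp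
    qed (simp add: A'_def)
    have PiE: "Pi\<^sub>E {..<k} A \<in> sets (\<Pi>\<^sub>M j\<in>{..<k}. lborel)"
      using A by (intro sets_PiM_I_finite) auto
    have "emeasure (distr (\<Pi>\<^sub>M j\<in>{..<k}. lborel) (\<Pi>\<^sub>M j\<in>{..<k}. lborel) (\<lambda>y. y(i := y i + c))) (Pi\<^sub>E {..<k} A)
        = emeasure (\<Pi>\<^sub>M j\<in>{..<k}. lborel)
            ((\<lambda>y. y(i := y i + c)) -` Pi\<^sub>E {..<k} A \<inter> space (\<Pi>\<^sub>M j\<in>{..<k}. lborel))"
      using meas PiE unfolding M_def by (rule emeasure_distr)
    also have "(\<lambda>y. y(i := y i + c)) -` Pi\<^sub>E {..<k} A \<inter> space (\<Pi>\<^sub>M j\<in>{..<k}. lborel) = Pi\<^sub>E {..<k} A'"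
    proof -
      have sp: "space (\<Pi>\<^sub>M j\<in>{..<k}. (lborel :: real measure)) = extensional {..<k}"
        by (simp add: space_PiM PiE_def)
      have iff: "y(i := y i + c) \<in> Pi\<^sub>E {..<k} A \<longleftrightarrow> y \<in> Pi\<^sub>E {..<k} A'"
        if y: "y \<in> extensional {..<k}" for y
      proof -
        have "y(i := y i + c) \<in> extensional {..<k}"
          using y assms(1) by (auto simp: extensional_def)
        moreover have "(\<forall>j\<in>{..<k}. (y(i := y i + c)) j \<in> A j) \<longleftrightarrow> (\<forall>j\<in>{..<k}. y j \<in> A' j)"
          by (intro ball_cong) (auto simp: A'_def)
        ultimately show ?thesis using y by (simp only: PiE_iff simp_thms)
      qed
      show ?thesis
        unfolding sp using iff by (auto simp: PiE_def[of _ A'])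
    qed
    also have "emeasure (\<Pi>\<^sub>M j\<in>{..<k}. lborel) (Pi\<^sub>E {..<k} A') = (\<Prod>j<k. emeasure lborel (A' j))"
      using A' by (intro emeasure_PiM) auto
    also have "\<dots> = (\<Prod>j<k. emeasure lborel (A j))"
      using em by (intro prod.cong) auto
    finally show "emeasure (distr (\<Pi>\<^sub>M j\<in>{..<k}. lborel) (\<Pi>\<^sub>M j\<in>{..<k}. lborel) (\<lambda>y. y(i := y i + c))) (Pi\<^sub>E {..<k} A)
        = (\<Prod>j<k. emeasure lborel (A j))" .
  qed auto
qed

text \<open>
A cross-polytope of radius \<open>k R\<close> contains the cube of half side \<open>R\<close>: the point is the average of \<open>k\<close>
points, the \<open>i\<close>-th of which lies on the segment from \<open>x\<close> to one of the two vertices on the \<open>i\<close>-th axis.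
\<close>

lemma convex_ball_from_axis_points:
  fixes e :: "nat \<Rightarrow> 'a::euclidean_space"
  assumes K: "convex K" and x: "x \<in> K" and R: "R > 0" and k: "k \<ge> 1"
    and ax: "\<And>i \<sigma>. i < k \<Longrightarrow> \<sigma> \<in> {-1, 1} \<Longrightarrow> x + (\<sigma> * (k * R)) *\<^sub>R e i \<in> K"
    and v: "\<And>i. i < k \<Longrightarrow> \<bar>v i\<bar> \<le> R"
  shows "x + (\<Sum>i<k. v i *\<^sub>R e i) \<in> K"
proof -
  define \<rho> where "\<rho> = k * R"
  have \<rho>: "\<rho> > 0" using R k by (simp add: \<rho>_def)
  define y where "y = (\<lambda>i. x + ((if v i < 0 then -1 else 1) * \<rho>) *\<^sub>R e i)"
  define z where "z = (\<lambda>i. x + (v i / R) *\<^sub>R (\<rho> *\<^sub>R e i))"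
  have z: "z i \<in> K" if "i < k" for i
  proof -
    have yK: "y i \<in> K" using ax[OF that, of "if v i < 0 then -1 else 1"] by (simp add: y_def \<rho>_def)
    have "z i = (1 - \<bar>v i\<bar> / R) *\<^sub>R x + (\<bar>v i\<bar> / R) *\<^sub>R y i"
      by (simp add: z_def y_def algebra_simps)
    moreover have "\<bar>v i\<bar> / R \<le> 1" "\<bar>v i\<bar> / R \<ge> 0" using v[OF that] R by auto
    ultimately show ?thesis using convexD_alt[OF K x yK] by simp
  qed
  have "(\<Sum>i<k. (1 / k) *\<^sub>R z i) \<in> K"
    by (rule convex_sum[OF _ K]) (use k z in auto)
  also have "(\<Sum>i<k. (1 / k) *\<^sub>R z i) = x + (\<Sum>i<k. v i *\<^sub>R e i)"
  proof -
    have "(\<Sum>i<k. (1 / k) *\<^sub>R z i) = (\<Sum>i<k. (1 / k) *\<^sub>R x) + (\<Sum>i<k. v i *\<^sub>R e i)"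
      using k R by (simp add: z_def \<rho>_def scaleR_add_right sum.distrib)
    also have "(\<Sum>i<k. (1 / k) *\<^sub>R x) = x" using k by (simp add: sum_constant_scaleR)
    finally show ?thesis .
  qed
  finally show ?thesis .
qed

lemma abs_interval: "\<bar>t\<bar> \<le> b \<Longrightarrow> - b \<le> t \<and> t \<le> b" for t b :: real
  by (auto simp: abs_le_iff)

text \<open>
About \<open>r / |c|\<close> translates of \<open>S\<close> by multiples of \<open>c\<close> in the \<open>i\<close>-th coordinate are disjoint and fit
into a cube of side \<open>4 r + 2 |c|\<close>, so \<open>S\<close> has at most the corresponding fraction of its volume.
\<close>

lemma measure_le_of_disjoint_shifts:
  fixes S :: "(nat \<Rightarrow> real) set" and c :: real
  assumes i: "i < k" and c: "c \<noteq> 0" and r: "r > 0"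
  defines "M \<equiv> \<Pi>\<^sub>M j\<in>{..<k}. (lborel :: real measure)"
  assumes S: "S \<in> sets M" and bd: "\<And>y j. y \<in> S \<Longrightarrow> j < k \<Longrightarrow> \<bar>y j\<bar> \<le> r"
    and disj: "\<And>y m. y \<in> S \<Longrightarrow> m \<ge> 1 \<Longrightarrow> y(i := y i + real m * c) \<notin> S"
  shows "r * measure M S \<le> \<bar>c\<bar> * (4 * r + 2 * \<bar>c\<bar>) ^ k"
proof -
  interpret product_sigma_finite "\<lambda>j::nat. lborel :: real measure"
    by standard
  define N where "N = nat \<lceil>r / \<bar>c\<bar>\<rceil>"
  have N1: "r \<le> N * \<bar>c\<bar>" and N2: "N * \<bar>c\<bar> \<le> r + \<bar>c\<bar>"
  proof -
    have N: "real N = of_int \<lceil>r / \<bar>c\<bar>\<rceil>" using r c by (simp add: N_def)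
    have "r / \<bar>c\<bar> \<le> N" "N \<le> r / \<bar>c\<bar> + 1" unfolding N by (linarith+)
    then show "r \<le> N * \<bar>c\<bar>" "N * \<bar>c\<bar> \<le> r + \<bar>c\<bar>" using c by (simp_all add: field_simps)
  qed
  define \<tau> where "\<tau> = (\<lambda>(m::nat) y. y(i := y i + (- real m * c)))"
  define T where "T = (\<lambda>m. \<tau> m -` S \<inter> space M)"
  define Q where "Q = Pi\<^sub>E {..<k} (\<lambda>j. {- (2 * r + \<bar>c\<bar>) .. 2 * r + \<bar>c\<bar>})"
  have \<tau>m: "\<tau> m \<in> measurable M M" for m
    unfolding \<tau>_def M_def by (rule distr_PiM_lborel_coordinate_shift(2)[OF i])
  have T: "T m \<in> sets M" for m
    unfolding T_def using \<tau>m S by (rule measurable_sets)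
  have emT: "emeasure M (T m) = emeasure M S" for m
  proof -
    have "emeasure M S = emeasure (distr M M (\<tau> m)) S"
      unfolding \<tau>_def M_def by (simp only: distr_PiM_lborel_coordinate_shift(1)[OF i])
    also have "\<dots> = emeasure M (T m)"
      unfolding T_def using \<tau>m S by (rule emeasure_distr)
    finally show ?thesis by simp
  qed
  have TQ: "T m \<subseteq> Q" if "m \<in> {1..N}" for m
  proof
    fix y assume y: "y \<in> T m"
    have "\<bar>y j\<bar> \<le> 2 * r + \<bar>c\<bar>" if j: "j < k" for j
    proof -
      have "\<bar>(\<tau> m y) j\<bar> \<le> r" using bd[of "\<tau> m y" j] y j by (simp add: T_def)
      moreover have "\<bar>real m * c\<bar> \<le> r + \<bar>c\<bar>"
        using N2 \<open>m \<in> {1..N}\<close> mult_right_mono[of "real m" "real N" "\<bar>c\<bar>"] by (simp add: abs_mult)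
      ultimately show ?thesis using r by (cases "j = i") (simp_all add: \<tau>_def)
    qed
    then have "- (2 * r + \<bar>c\<bar>) \<le> y j \<and> y j \<le> 2 * r + \<bar>c\<bar>" if "j < k" for j
      using that abs_interval by blast
    then show "y \<in> Q" using y by (auto simp: Q_def T_def M_def space_PiM PiE_iff)
  qed
  have Q: "Q \<in> sets M" unfolding Q_def M_def by (intro sets_PiM_I_finite) auto
  have emQ: "emeasure M Q = ennreal ((4 * r + 2 * \<bar>c\<bar>) ^ k)"
  proof -
    have "emeasure M Q = (\<Prod>j<k. emeasure lborel {- (2 * r + \<bar>c\<bar>) .. 2 * r + \<bar>c\<bar>})"
      unfolding Q_def M_def by (intro emeasure_PiM) auto
    also have "\<dots> = (\<Prod>j<k. ennreal (4 * r + 2 * \<bar>c\<bar>))"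
      using r by (intro prod.cong) auto
    also have "\<dots> = ennreal ((4 * r + 2 * \<bar>c\<bar>) ^ k)"
      using r by (simp add: ennreal_power del: ennreal_plus)
    finally show ?thesis .
  qed
  have disjT: "disjoint_family_on T {1..N}"
  proof -
    have "T m \<inter> T n = {}" if "m < n" for m n
    proof (rule ccontr)
      assume "T m \<inter> T n \<noteq> {}"
      then obtain y where y: "\<tau> m y \<in> S" "\<tau> n y \<in> S" by (auto simp: T_def)
      have "(\<tau> n y)(i := (\<tau> n y) i + real (n - m) * c) = \<tau> m y"
        using that by (auto simp: \<tau>_def algebra_simps of_nat_diff)
      moreover have "1 \<le> n - m" using that by simp
      ultimately show False using disj[OF y(2), of "n - m"] y(1) by metis
    qed
    then show ?thesis unfolding disjoint_family_on_def
      by (metis Int_commute linorder_neqE_nat)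
  qed
  have finQ: "emeasure M Q < \<infinity>" using emQ by simp
  have meas_eq: "measure M (T m) = measure M S" for m using emT by (simp add: measure_def)
  have "N * measure M S = (\<Sum>m\<in>{1..N}. measure M (T m))" by (simp add: meas_eq)
  also have "\<dots> = measure M (\<Union>m\<in>{1..N}. T m)"
  proof (rule measure_finite_Union[symmetric])
    show "emeasure M (T m) \<noteq> \<infinity>" if "m \<in> {1..N}" for m
      using emeasure_mono[OF TQ[OF that] Q] finQ by auto
  qed (use T disjT in auto)
  also have "\<dots> \<le> measure M Q"
  proof (rule measure_mono_fmeasurable)
    show "(\<Union>m\<in>{1..N}. T m) \<subseteq> Q" using TQ by blast
  qed (use T Q finQ in \<open>auto simp: fmeasurable_def\<close>)
  also have "\<dots> = (4 * r + 2 * \<bar>c\<bar>) ^ k"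
    using emQ r by (simp add: measure_def)
  finally have le: "N * measure M S \<le> (4 * r + 2 * \<bar>c\<bar>) ^ k" .
  have "r * measure M S \<le> (N * \<bar>c\<bar>) * measure M S"
    using N1 by (intro mult_right_mono) auto
  also have "\<dots> = \<bar>c\<bar> * (N * measure M S)" by simp
  also have "\<dots> \<le> \<bar>c\<bar> * (4 * r + 2 * \<bar>c\<bar>) ^ k"
    using le by (intro mult_left_mono) auto
  finally show ?thesis .
qed

text \<open>
A convex set without a cross-polytope of radius \<open>\<rho>\<close> has one dimension less of volume growth. Every
point of it leaves the set after one step of length \<open>\<rho>\<close> along some signed axis. For a fixed signed
axis, convexity makes the multiples of that step carry the set of such points to disjoint sets:
a point that returned to \<open>K\<close> after \<open>m\<close> steps would not have left it after one.
\<close>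

lemma vol_in_ball_le_of_bounded_inradius:
  fixes K :: "'a::euclidean_space set"
  assumes K: "closed K" "convex K" and k: "k \<ge> 1" and \<rho>: "\<rho> > 0" and r: "r \<ge> \<rho>"
    and thin: "\<And>x. x \<in> K \<Longrightarrow> \<exists>i<k. \<exists>\<sigma>\<in>{-1, 1}. x + (\<sigma> * \<rho>) *\<^sub>R e i \<notin> K"
  shows "vol_in_ball k a e K r \<le> (2 * k * \<rho> * 6 ^ k) * r ^ (k - 1)"
proof -
  define M where "M = (\<Pi>\<^sub>M j\<in>{..<k}. (lborel :: real measure))"
  define f where "f = frame_map k a e"
  define T where "T = {y \<in> coord_ball k r. f y \<in> K}"
  define S where "S = (\<lambda>(i, \<sigma>). {y \<in> T. f y + (\<sigma> * \<rho>) *\<^sub>R e i \<notin> K})"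
  define I where "I = {..<k} \<times> {-1, 1::real}"
  have r0: "r > 0" using \<rho> r by simp
  have f[measurable]: "f \<in> borel_measurable M"
    unfolding f_def frame_map_def[abs_def] M_def by measurable
  have [measurable]: "K \<in> sets borel" using K by simp
  have L2[measurable]: "(\<lambda>y. L2_set y {..<k}) \<in> borel_measurable M"
    unfolding L2_set_def M_def by measurable
  have Teq: "T = {y \<in> space M. L2_set y {..<k} < r \<and> f y \<in> K}"
    by (auto simp: T_def coord_ball_def M_def space_PiM)
  have S_sets: "S p \<in> sets M" for p
  proof (cases p)
    case (Pair i \<sigma>)
    have "S p = {y \<in> space M. L2_set y {..<k} < r \<and> f y \<in> K \<and> f y + (\<sigma> * \<rho>) *\<^sub>R e i \<notin> K}"
      by (auto simp: S_def Teq Pair)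
    also have "\<dots> \<in> sets M" by measurable
    finally show ?thesis .
  qed
  have upd: "f (y(i := y i + t)) = f y + t *\<^sub>R e i" if "i < k" for y i t
  proof -
    have "(\<Sum>j<k. (y(i := y i + t)) j *\<^sub>R e j) = (\<Sum>j<k. y j *\<^sub>R e j + (if j = i then t *\<^sub>R e j else 0))"
      by (intro sum.cong) (auto simp: scaleR_add_left)
    also have "\<dots> = (\<Sum>j<k. y j *\<^sub>R e j) + t *\<^sub>R e i"
      using that by (simp add: sum.distrib)
    finally show ?thesis by (simp add: f_def frame_map_def)
  qed
  have bound: "measure M (S p) \<le> \<rho> * 6 ^ k * r ^ (k - 1)" and fin: "S p \<in> fmeasurable M" if pI: "p \<in> I" for p
  proof -
    obtain i \<sigma> where p: "p = (i, \<sigma>)" "i < k" "\<sigma> = -1 \<or> \<sigma> = 1"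
      using pI unfolding I_def by blast
    have abs\<sigma>: "\<bar>\<sigma> * \<rho>\<bar> = \<rho>" using p \<rho> by (auto simp: abs_mult)
    have bd: "\<bar>y j\<bar> \<le> r" if "y \<in> S p" "j < k" for y j
    proof -
      have "\<bar>y j\<bar> \<le> L2_set y {..<k}" using that(2) member_le_sum[of j "{..<k}" "\<lambda>i. (y i)\<^sup>2"]
        unfolding L2_set_def by (intro real_le_rsqrt) simp
      also have "\<dots> \<le> r" using that(1) by (simp add: S_def p Teq)
      finally show ?thesis .
    qed
    have disj: "y(i := y i + real m * (\<sigma> * \<rho>)) \<notin> S p" if y: "y \<in> S p" and m: "m \<ge> 1" for y m
    proof
      assume "y(i := y i + real m * (\<sigma> * \<rho>)) \<in> S p"
      then have far: "f y + (real m * (\<sigma> * \<rho>)) *\<^sub>R e i \<in> K"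
        using upd[OF p(2)] by (simp add: S_def p Teq)
      have near: "f y \<in> K" "f y + (\<sigma> * \<rho>) *\<^sub>R e i \<notin> K" using y by (auto simp: S_def p Teq)
      have "(1 - 1 / real m) *\<^sub>R f y + (1 / real m) *\<^sub>R (f y + (real m * (\<sigma> * \<rho>)) *\<^sub>R e i) \<in> K"
        using convexD_alt[OF K(2) near(1) far, of "1 / real m"] m by simp
      also have "(1 - 1 / real m) *\<^sub>R f y + (1 / real m) *\<^sub>R (f y + (real m * (\<sigma> * \<rho>)) *\<^sub>R e i)
          = f y + (\<sigma> * \<rho>) *\<^sub>R e i"
        using m by (simp add: scaleR_add_right scaleR_diff_left)
      finally show False using near(2) by simp
    qed
    have "r * measure M (S p) \<le> \<bar>\<sigma> * \<rho>\<bar> * (4 * r + 2 * \<bar>\<sigma> * \<rho>\<bar>) ^ k"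
      unfolding M_def
      by (rule measure_le_of_disjoint_shifts[OF p(2) _ r0])
        (use S_sets[of p] bd disj p(3) \<rho> in \<open>auto simp: M_def\<close>)
    also have "\<dots> = \<rho> * (4 * r + 2 * \<rho>) ^ k" by (simp only: abs\<sigma>)
    also have "\<dots> \<le> \<rho> * (6 * r) ^ k"
      using \<rho> r by (intro mult_left_mono power_mono) auto
    also have "(6 * r) ^ k = 6 ^ k * (r * r ^ (k - 1))"
      using k power_minus_mult[of k r] by (simp add: power_mult_distrib mult.commute)
    finally have "r * measure M (S p) \<le> r * (\<rho> * 6 ^ k * r ^ (k - 1))" by (simp add: mult_ac)
    then show "measure M (S p) \<le> \<rho> * 6 ^ k * r ^ (k - 1)"
      using r0 by (simp only: mult_le_cancel_left_pos)
    show "S p \<in> fmeasurable M"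
    proof (rule fmeasurableI2)
      interpret product_sigma_finite "\<lambda>j::nat. lborel :: real measure" by standard
      show "Pi\<^sub>E {..<k} (\<lambda>j. {- r .. r}) \<in> fmeasurable M"
        unfolding M_def fmeasurable_def using r0
        by (auto simp: emeasure_PiM ennreal_power intro!: sets_PiM_I_finite)
      have "- r \<le> y j \<and> y j \<le> r" if "y \<in> S p" "j < k" for y j
        using abs_interval[OF bd[OF that]] .
      then show "S p \<subseteq> Pi\<^sub>E {..<k} (\<lambda>j. {- r .. r})"
        using S_sets[THEN sets.sets_into_space, of p]
        by (auto simp: M_def space_PiM PiE_iff)
    qed (rule S_sets)
  qed
  have "T = (\<Union>p\<in>I. S p)"
  proof (intro equalityI subsetI)
    fix y assume y: "y \<in> T"
    then have "f y \<in> K" by (simp add: T_def)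
    from thin[OF this] obtain i \<sigma> where "i < k" "\<sigma> \<in> {-1, 1}" "f y + (\<sigma> * \<rho>) *\<^sub>R e i \<notin> K" by blast
    then have "(i, \<sigma>) \<in> I" "y \<in> S (i, \<sigma>)" using y by (auto simp: I_def S_def)
    then show "y \<in> (\<Union>p\<in>I. S p)" by blast
  qed (auto simp: S_def)
  then have "measure M T = measure M (\<Union>p\<in>I. S p)" by simp
  also have "\<dots> \<le> (\<Sum>p\<in>I. measure M (S p))"
    using fin by (intro measure_UNION_le) (auto simp: I_def)
  also have "\<dots> \<le> (\<Sum>p\<in>I. \<rho> * 6 ^ k * r ^ (k - 1))" by (intro sum_mono bound)
  also have "\<dots> = (2 * k * \<rho> * 6 ^ k) * r ^ (k - 1)" by (simp add: I_def)
  finally show ?thesis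
    by (simp add: vol_in_ball_def T_def M_def f_def)
qed

text \<open>
This is the only use of the dimension at infinity: if the relative balls inside \<open>K\<close> had bounded
radius, the volume in a ball of radius \<open>r\<close> would be \<open>O(r\<^bsup>k - 1\<^esup>)\<close> and the logarithmic ratio would
have lower limit at most \<open>k - 1\<close>. The logarithm of the volume is compared separately when the
volume is zero, where \<open>ln 0 = 0\<close>.
\<close>

lemma large_relative_balls:
  fixes K :: "'a::euclidean_space set"
  assumes K: "closed K" "convex K" and k: "k \<ge> 1" and fr: "is_frame k a e (affine hull K)"
    and dim: "dim_at_infinity k a e K = ereal (real k)"
  shows "\<exists>x\<in>K. \<forall>y\<in>affine hull K. dist x y \<le> R \<longrightarrow> y \<in> K"
proof (rule ccontr)
  assume neg: "\<not> ?thesis"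
  define R' where "R' = max R 1"
  define \<rho> where "\<rho> = k * R'"
  have R': "R' > 0" "R \<le> R'" by (auto simp: R'_def)
  have \<rho>: "\<rho> > 0" using R' k by (simp add: \<rho>_def)
  have on: "e i \<bullet> e j = (if i = j then 1 else 0)" if "i < k" "j < k" for i j
    using fr that by (simp add: is_frame_def)
  have hull: "\<exists>v. y = a + (\<Sum>i<k. v i *\<^sub>R e i)" if "y \<in> affine hull K" for y
    using fr that by (auto simp: is_frame_def frame_map_def)
  have thin: "\<exists>i<k. \<exists>\<sigma>\<in>{-1, 1}. x + (\<sigma> * \<rho>) *\<^sub>R e i \<notin> K" if x: "x \<in> K" for x
  proof (rule ccontr)
    assume "\<not> ?thesis"
    then have ax: "\<And>i \<sigma>. i < k \<Longrightarrow> \<sigma> \<in> {-1, 1} \<Longrightarrow> x + (\<sigma> * (k * R')) *\<^sub>R e i \<in> K"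
      by (auto simp: \<rho>_def)
    have "y \<in> K" if y: "y \<in> affine hull K" "dist x y \<le> R" for y
    proof -
      obtain v w where v: "y = a + (\<Sum>i<k. v i *\<^sub>R e i)" and w: "x = a + (\<Sum>i<k. w i *\<^sub>R e i)"
        using hull[OF y(1)] hull[OF hull_inc[OF x]] by blast
      have yx: "y - x = (\<Sum>i<k. (v i - w i) *\<^sub>R e i)"
        by (simp add: v w scaleR_diff_left sum_subtractf)
      have "\<bar>v i - w i\<bar> \<le> R'" if "i < k" for i
      proof -
        have "(y - x) \<bullet> e i = (\<Sum>j<k. if j = i then v j - w j else 0)"
          unfolding yx inner_sum_left using that by (intro sum.cong) (auto simp: on)
        then have "v i - w i = (y - x) \<bullet> e i" using that by simp
        then have "\<bar>v i - w i\<bar> \<le> norm (y - x) * norm (e i)"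
          using Cauchy_Schwarz_ineq2 by metis
        also have "\<dots> = dist x y" using on[OF that that] by (simp add: dist_norm norm_minus_commute norm_eq_1)
        finally show ?thesis using y(2) R' by linarith
      qed
      then have "x + (\<Sum>i<k. (v i - w i) *\<^sub>R e i) \<in> K"
        by (intro convex_ball_from_axis_points[OF K(2) x R'(1) k ax])
      then show ?thesis by (simp add: yx[symmetric])
    qed
    then show False using neg x by blast
  qed
  define C where "C = max 1 (2 * k * \<rho> * 6 ^ k)"
  have le: "ln (vol_in_ball k a e K r) / ln r \<le> ln C / ln r + (real k - 1)" if r: "r \<ge> max \<rho> 2" for r
  proof -
    have r1: "r > 1" "r \<ge> \<rho>" using r by auto
    have lnr: "ln r > 0" using r1 by simp
    have C: "C \<ge> 1" by (simp add: C_def)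
    have "vol_in_ball k a e K r \<le> (2 * k * \<rho> * 6 ^ k) * r ^ (k - 1)"
      using vol_in_ball_le_of_bounded_inradius[OF K k \<rho> r1(2) thin] by simp
    also have "\<dots> \<le> C * r ^ (k - 1)"
      using r1 by (intro mult_right_mono) (auto simp: C_def)
    finally have v: "vol_in_ball k a e K r \<le> C * r ^ (k - 1)" .
    have "ln (vol_in_ball k a e K r) \<le> ln (C * r ^ (k - 1))"
    proof (cases "vol_in_ball k a e K r = 0")
      case True
      have "1 * 1 \<le> C * r ^ (k - 1)" using C r1 by (intro mult_mono) auto
      then show ?thesis using True by simp
    next
      case False
      then have "vol_in_ball k a e K r > 0" by (simp add: vol_in_ball_def zero_less_measure_iff)
      then show ?thesis using v by (subst ln_le_cancel_iff) auto
    qed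
    also have "\<dots> = ln C + (real k - 1) * ln r"
      using C r1 k by (simp add: ln_mult ln_realpow of_nat_diff)
    finally show ?thesis using lnr by (simp add: field_simps)
  qed
  have lim: "((\<lambda>r. ln C / ln r + (real k - 1)) \<longlongrightarrow> 0 + (real k - 1)) at_top"
    by (intro tendsto_add tendsto_const tendsto_divide_0[OF tendsto_const] filterlim_at_top_imp_at_infinity ln_at_top)
  have "ereal k \<le> Liminf at_top (\<lambda>r. ereal (ln C / ln r + (real k - 1)))"
    unfolding dim[symmetric] dim_at_infinity_def
    by (rule Liminf_mono, rule eventually_mono[OF eventually_ge_at_top[of "max \<rho> 2"]]) (use le in simp)
  also have "\<dots> = ereal (0 + (real k - 1))"
    by (rule lim_imp_Liminf) (use lim in auto)
  finally show False by simp
qed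

section \<open>Orthogonal projections and logarithmic translation invariance\<close>

lemma integral_pos_of_pos_on_open:
  fixes f :: "'a::euclidean_space \<Rightarrow> real"
  assumes f: "integrable lborel f" "\<And>x. f x \<ge> 0" and U: "open U" "U \<noteq> {}" "\<And>x. x \<in> U \<Longrightarrow> f x > 0"
  shows "(\<integral>x. f x \<partial>lborel) > 0"
proof (rule ccontr)
  assume "\<not> ?thesis"
  then have "(\<integral>x. f x \<partial>lborel) = 0"
    using integral_nonneg_AE[of f lborel] f(2) by (simp add: not_less antisym)
  then have "AE x in lborel. f x = 0"
    using integral_nonneg_eq_0_iff_AE[OF f(1)] f(2) by simp
  then obtain N where N: "{x \<in> space lborel. f x \<noteq> 0} \<subseteq> N" "emeasure lborel N = 0" "N \<in> sets lborel"
    by (rule AE_E)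
  have "U \<subseteq> N" using U(3) N(1) by fastforce
  moreover have "N \<in> null_sets lebesgue"
    using N by (intro null_sets_completionI) auto
  ultimately have "negligible U"
    by (meson negligible_iff_null_sets negligible_subset)
  then show False using open_not_negligible[OF U(1,2)] by blast
qed

definition proj :: "'a::euclidean_space set \<Rightarrow> 'a \<Rightarrow> 'a" where
  "proj W x = (\<Sum>u\<in>W. (x \<bullet> u) *\<^sub>R u)"

text \<open>
The slabs \<open>|x - proj W x| < \<rho>\<close>, weighted by a function of \<open>proj W x\<close>, have measure that at most
multiplies by \<open>M\<close> when \<open>\<rho>\<close> is doubled. The point is that \<open>M\<close> depends on neither \<open>\<rho>\<close> nor the weight;
the bound \<open>s1\<close> on the support serves only to make the integrals finite.
\<close>

definition slab_doubling :: "'a::euclidean_space set \<Rightarrow> real \<Rightarrow> bool" where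
  "slab_doubling W M \<longleftrightarrow> M > 0 \<and> (\<forall>\<rho> \<kappa> s1. \<rho> > 0 \<longrightarrow> continuous_on UNIV (\<lambda>x. \<kappa> (proj W x)) \<longrightarrow>
      (\<forall>z. \<kappa> z \<ge> 0) \<longrightarrow> (\<forall>z. norm z > s1 \<longrightarrow> \<kappa> z = 0) \<longrightarrow>
      (\<integral>x. indicator {x. norm (x - proj W x) < 2 * \<rho>} x * \<kappa> (proj W x) \<partial>lborel)
      \<le> M * (\<integral>x. indicator {x. norm (x - proj W x) < \<rho>} x * \<kappa> (proj W x) \<partial>lborel))"

context
  fixes B W :: "'a::euclidean_space set"
  assumes B: "orthonormal_basis B" and W: "W \<subseteq> B"
begin

lemma finite_W: "finite W"
  using B W by (auto simp: orthonormal_basis_def intro: finite_subset)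

lemma inner_W: "u \<in> W \<Longrightarrow> v \<in> W \<Longrightarrow> u \<bullet> v = (if u = v then 1 else 0)"
  using B W unfolding orthonormal_basis_def by (meson subsetD)

lemma linear_proj: "linear (proj W)"
  unfolding proj_def by (intro linearI) (simp_all add: inner_add_left scaleR_add_left sum.distrib scaleR_sum_right)

lemma continuous_on_proj: "continuous_on S (proj W)"
  using linear_proj by (rule linear_continuous_on[OF linear_conv_bounded_linear[THEN iffD1]])

lemma proj_inner: "u \<in> W \<Longrightarrow> proj W x \<bullet> u = x \<bullet> u"
  by (simp add: proj_def inner_sum_left inner_W finite_W if_distrib cong: if_cong)

lemma proj_unit: "u \<in> W \<Longrightarrow> proj W u = u"
  by (simp add: proj_def inner_W finite_W if_distrib[of "\<lambda>c. c *\<^sub>R _"] cong: if_cong)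

lemma norm_proj_square: "(norm (proj W x))\<^sup>2 = (\<Sum>u\<in>W. (x \<bullet> u)\<^sup>2)"
proof -
  have "proj W x \<bullet> proj W x = (\<Sum>u\<in>W. (x \<bullet> u) * (proj W x \<bullet> u))"
    by (subst (2) proj_def) (simp add: inner_sum_right)
  then show ?thesis unfolding power2_norm_eq_inner by (simp add: proj_inner power2_eq_square)
qed

lemma proj_orthogonal: "proj W x \<bullet> (y - proj W y) = 0"
proof -
  have "proj W x \<bullet> v = (\<Sum>u\<in>W. (x \<bullet> u) * (u \<bullet> v))" for v
    by (simp add: proj_def inner_sum_left)
  moreover have "u \<bullet> (y - proj W y) = 0" if "u \<in> W" for u
    by (simp add: inner_diff_right inner_commute[of u] proj_inner[OF that])
  ultimately show ?thesis by simp
qed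

lemma proj_proj: "proj W (proj W x) = proj W x"
proof -
  have "proj W (proj W x) = (\<Sum>u\<in>W. (proj W x \<bullet> u) *\<^sub>R u)" by (rule proj_def)
  also have "\<dots> = (\<Sum>u\<in>W. (x \<bullet> u) *\<^sub>R u)" by (intro sum.cong refl) (simp add: proj_inner)
  finally show ?thesis by (simp only: proj_def[of W x])
qed

lemma norm_proj_le: "norm (proj W x) \<le> norm x" "norm (x - proj W x) \<le> norm x"
proof -
  have "(norm x)\<^sup>2 = (norm (proj W x + (x - proj W x)))\<^sup>2" by simp
  also have "\<dots> = (norm (proj W x))\<^sup>2 + (norm (x - proj W x))\<^sup>2"
    using proj_orthogonal[of x x] unfolding power2_norm_eq_inner inner_add_left inner_add_right
    by (simp add: inner_commute[of "x - proj W x" "proj W x"])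
  finally have "(norm (proj W x))\<^sup>2 \<le> (norm x)\<^sup>2" "(norm (x - proj W x))\<^sup>2 \<le> (norm x)\<^sup>2"
    by simp_all
  then show "norm (proj W x) \<le> norm x" "norm (x - proj W x) \<le> norm x"
    by (auto intro: power2_le_imp_le)
qed

lemma proj_shift: "u \<in> W \<Longrightarrow> proj W (x + t *\<^sub>R u) = proj W x + t *\<^sub>R u"
  using linear_add[OF linear_proj] linear_scale[OF linear_proj] by (simp add: proj_unit)

lemma compact_shell:
  "compact {x. norm (x - proj W x) \<le> \<rho> \<and> s0 \<le> norm (proj W x) \<and> norm (proj W x) \<le> s1}"
proof (rule compact_eq_bounded_closed[THEN iffD2], intro conjI)
  show "bounded {x. norm (x - proj W x) \<le> \<rho> \<and> s0 \<le> norm (proj W x) \<and> norm (proj W x) \<le> s1}"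
    unfolding bounded_iff
  proof (intro exI ballI)
    fix x assume "x \<in> {x. norm (x - proj W x) \<le> \<rho> \<and> s0 \<le> norm (proj W x) \<and> norm (proj W x) \<le> s1}"
    then have "norm (x - proj W x) \<le> \<rho>" "norm (proj W x) \<le> s1" by auto
    moreover have "norm x \<le> norm (x - proj W x) + norm (proj W x)"
      using norm_triangle_ineq[of "x - proj W x" "proj W x"] by simp
    ultimately show "norm x \<le> \<rho> + s1" by linarith
  qed
  show "closed {x. norm (x - proj W x) \<le> \<rho> \<and> s0 \<le> norm (proj W x) \<and> norm (proj W x) \<le> s1}"
    by (intro closed_Collect_conj closed_Collect_le continuous_intros continuous_on_proj)
qed

text \<open>
On the span of \<open>W\<close> the measure \<open>|z|\<^bsup>-card W\<^esup> dz\<close> is invariant under dilations, so in the variable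
\<open>ln |z|\<close> it is a multiple of Lebesgue measure and annihilates derivatives of compactly supported
functions. This is proved without polar coordinates or a change of variables: the field \<open>proj W x\<close>
has divergence exactly \<open>card W\<close>, and integrating it by parts against \<open>X(x) H(ln |z|) |z|\<^bsup>-card W\<^esup>\<close>
leaves \<open>\<integral> X(x) H'(ln |z|) |z|\<^bsup>-card W\<^esup> = 0\<close>.
\<close>

lemma log_radial_integral_zero:
  fixes X :: "'a \<Rightarrow> real" and h H :: "real \<Rightarrow> real"
  assumes X: "continuous_on UNIV X" "\<And>x u t. u \<in> W \<Longrightarrow> X (x + t *\<^sub>R u) = X x"
    and X0: "\<And>x. norm (x - proj W x) > \<rho> \<Longrightarrow> X x = 0"
    and H: "\<And>t. (H has_real_derivative h t) (at t)" and h: "continuous_on UNIV h"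
    and H0: "\<And>t. t \<notin> {t0..t1} \<Longrightarrow> H t = 0" "\<And>t. t \<notin> {t0..t1} \<Longrightarrow> h t = 0"
  shows "(\<integral>x. X x * (h (ln (norm (proj W x))) * norm (proj W x) powr (- real (card W))) \<partial>lborel) = 0"
proof -
  define m where "m = real (card W)"
  define \<pi> where "\<pi> = proj W"
  define \<eta> where "\<eta> = (\<lambda>s. H (ln s) * s powr (- m))"
  define \<eta>' where "\<eta>' = (\<lambda>s. (h (ln s) - m * H (ln s)) * s powr (- m) / s)"
  define \<psi> where "\<psi> = (\<lambda>x. X x * \<eta> (norm (\<pi> x)))"
  define \<psi>' where "\<psi>' = (\<lambda>u x. X x * (\<eta>' (norm (\<pi> x)) * ((x \<bullet> u) / norm (\<pi> x))))"
  define S where "S = {x. norm (x - \<pi> x) \<le> \<rho> \<and> exp t0 \<le> norm (\<pi> x) \<and> norm (\<pi> x) \<le> exp t1}"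
  define U where "U = {x. \<pi> x \<noteq> 0}"
  have S: "compact S" unfolding S_def \<pi>_def by (rule compact_shell)
  have cont\<pi>: "continuous_on A \<pi>" for A unfolding \<pi>_def by (rule continuous_on_proj)
  have U: "open U" unfolding U_def
    by (intro open_Collect_neq cont\<pi> continuous_intros)
  have SU: "S \<subseteq> U" by (auto simp: S_def U_def not_le)
  have far: "X x = 0 \<or> \<pi> x = 0 \<or> ln (norm (\<pi> x)) \<notin> {t0..t1}" if "x \<notin> S" for x
  proof (cases "\<pi> x = 0 \<or> norm (x - \<pi> x) > \<rho>")
    case False
    then have "norm (\<pi> x) > 0" "norm (x - \<pi> x) \<le> \<rho>" by auto
    then show ?thesis using that ln_ge_iff[of "norm (\<pi> x)" t0] ln_le_cancel_iff[of "norm (\<pi> x)" "exp t1"]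
      by (auto simp: S_def)
  qed (use X0 in \<open>auto simp: \<pi>_def\<close>)
  have \<psi>0: "\<psi> x = 0" if "x \<notin> S" for x
    using far[OF that] H0 by (auto simp: \<psi>_def \<eta>_def)
  have \<psi>'0: "\<psi>' u x = 0" if "x \<notin> S" for x u
    using far[OF that] H0 by (auto simp: \<psi>'_def \<eta>'_def)
  have \<eta>: "(\<eta> has_real_derivative \<eta>' s) (at s)" if "s > 0" for s
  proof -
    have "(\<eta> has_real_derivative (h (ln s) * (1 / s)) * s powr (- m) + H (ln s) * (- m * s powr (- m - 1))) (at s)"
      unfolding \<eta>_def using that
      by (auto intro!: derivative_eq_intros DERIV_chain2[OF H])
    moreover have "s powr (- m - 1) = s powr (- m) / s" using that by (simp add: powr_diff)
    ultimately show ?thesis by (elim DERIV_cong) (simp add: \<eta>'_def field_simps diff_divide_distrib)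
  qed
  have contH: "continuous_on A H" for A
    using H by (meson DERIV_isCont continuous_at_imp_continuous_on)
  have lnpos: "continuous_on {0<..} (ln :: real \<Rightarrow> real)" by (auto intro!: continuous_intros)
  have cont\<eta>: "continuous_on {0<..} \<eta>"
    using \<eta> by (meson DERIV_isCont continuous_at_imp_continuous_on greaterThan_iff)
  have cont\<eta>': "continuous_on {0<..} \<eta>'"
    unfolding \<eta>'_def by (intro continuous_intros continuous_on_compose2[OF contH lnpos] continuous_on_compose2[OF h lnpos]) auto
  have contN: "continuous_on A (\<lambda>x. norm (\<pi> x))" for A by (intro continuous_intros cont\<pi>)
  have \<psi>cont: "continuous_on UNIV \<psi>"
  proof (rule continuous_on_UNIV_extend_zero[OF _ U compact_imp_closed[OF S] SU \<psi>0])
    show "continuous_on U \<psi>" unfolding \<psi>_def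
      by (intro continuous_intros continuous_on_subset[OF X(1)] continuous_on_compose2[OF cont\<eta> contN]) (auto simp: U_def)
  qed
  have \<psi>'cont: "continuous_on UNIV (\<psi>' u)" for u
  proof (rule continuous_on_UNIV_extend_zero[OF _ U compact_imp_closed[OF S] SU \<psi>'0])
    show "continuous_on U (\<psi>' u)" unfolding \<psi>'_def
      by (intro continuous_intros continuous_on_subset[OF X(1)] continuous_on_compose2[OF cont\<eta>' contN] contN cont\<pi>) (auto simp: U_def)
  qed
  have deriv: "((\<lambda>t. \<psi> (x + t *\<^sub>R u)) has_real_derivative \<psi>' u x) (at 0)" if u: "u \<in> W" for x u
  proof (cases "x \<in> U")
    case True
    then have n0: "norm (\<pi> x) > 0" by (simp add: U_def)
    have sq: "norm (\<pi> x + t *\<^sub>R u) = sqrt ((norm (\<pi> x))\<^sup>2 + 2 * t * (x \<bullet> u) + t\<^sup>2)" for t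
    proof -
      have "(norm (\<pi> x + t *\<^sub>R u))\<^sup>2 = (norm (\<pi> x))\<^sup>2 + 2 * t * (x \<bullet> u) + t\<^sup>2"
        using inner_W[OF u u] proj_inner[OF u, of x]
        unfolding power2_norm_eq_inner inner_add_left inner_add_right
        by (simp add: \<pi>_def inner_commute[of u "proj W x"] power2_eq_square)
      then show ?thesis by (metis norm_ge_zero real_sqrt_abs abs_of_nonneg)
    qed
    have "((\<lambda>t. sqrt ((norm (\<pi> x))\<^sup>2 + 2 * t * (x \<bullet> u) + t\<^sup>2)) has_real_derivative (x \<bullet> u) / norm (\<pi> x)) (at 0)"
      using n0 by (auto intro!: derivative_eq_intros simp: field_simps)
    then have N: "((\<lambda>t. norm (\<pi> x + t *\<^sub>R u)) has_real_derivative (x \<bullet> u) / norm (\<pi> x)) (at 0)"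
      by (simp only: sq)
    have "(\<eta> has_real_derivative \<eta>' (norm (\<pi> x))) (at (norm (\<pi> x + 0 *\<^sub>R u)))"
      using \<eta>[OF n0] by simp
    from DERIV_cmult[OF DERIV_chain2[OF this N], of "X x"] show ?thesis
      by (simp add: \<psi>_def \<psi>'_def X(2)[OF u] \<pi>_def proj_shift[OF u])
  next
    case False
    then have xS: "x \<notin> S" using SU by blast
    have "((\<lambda>t. \<psi> (x + t *\<^sub>R u)) has_real_derivative 0) (at 0)"
      by (rule directional_derivative_zero_outside[OF compact_imp_closed[OF S] xS \<psi>0])
    then show ?thesis using \<psi>'0[OF xS] by simp
  qed
  have ibp: "integrable lborel (\<lambda>x. (x \<bullet> u) * \<psi>' u x)"
      "(\<integral>x. (x \<bullet> u) * \<psi>' u x \<partial>lborel) = - (\<integral>x. \<psi> x \<partial>lborel)" if u: "u \<in> W" for u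
  proof -
    have uu: "u \<bullet> u = 1" using inner_W[OF u u] by simp
    \<comment> \<open>The increments of \<open>x \<bullet> u\<close> along \<open>u\<close> are exact, so both signs give an equality.\<close>
    note up = integration_by_parts_inequality[of "\<lambda>x. x \<bullet> u" \<psi> "\<psi>' u" S u 1,
        OF _ \<psi>cont \<psi>'cont S \<psi>0 deriv[OF u]]
    note dn = integration_by_parts_inequality[of "\<lambda>x. - (x \<bullet> u)" \<psi> "\<psi>' u" S u "- 1",
        OF _ \<psi>cont \<psi>'cont S \<psi>0 deriv[OF u]]
    show "integrable lborel (\<lambda>x. (x \<bullet> u) * \<psi>' u x)"
      by (rule up(1)) (auto intro!: continuous_intros simp: inner_add_left uu)
    have "(\<integral>x. (x \<bullet> u) * \<psi>' u x \<partial>lborel) \<le> - 1 * (\<integral>x. \<psi> x \<partial>lborel)"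
      by (rule up(2)) (auto intro!: continuous_intros simp: inner_add_left uu)
    moreover have "(\<integral>x. - (x \<bullet> u) * \<psi>' u x \<partial>lborel) \<le> - (- 1) * (\<integral>x. \<psi> x \<partial>lborel)"
      by (rule dn(2)) (auto intro!: continuous_intros simp: inner_add_left uu algebra_simps)
    ultimately show "(\<integral>x. (x \<bullet> u) * \<psi>' u x \<partial>lborel) = - (\<integral>x. \<psi> x \<partial>lborel)" by simp
  qed
  have i\<psi>: "integrable lborel \<psi>"
    by (rule integrable_continuous_compact_support[OF S continuous_on_subset[OF \<psi>cont] \<psi>0]) auto
  have eq: "X x * (h (ln (norm (proj W x))) * norm (proj W x) powr (- real (card W)))
      = (\<Sum>u\<in>W. (x \<bullet> u) * \<psi>' u x) + m * \<psi> x" for x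
  proof (cases "x \<in> S")
    case True
    then have n0: "norm (\<pi> x) > 0" using SU by (auto simp: U_def)
    have "(\<Sum>u\<in>W. (x \<bullet> u) * \<psi>' u x) = (\<Sum>u\<in>W. X x * \<eta>' (norm (\<pi> x)) / norm (\<pi> x) * (x \<bullet> u)\<^sup>2)"
      by (intro sum.cong) (auto simp: \<psi>'_def power2_eq_square)
    also have "\<dots> = X x * \<eta>' (norm (\<pi> x)) / norm (\<pi> x) * (norm (\<pi> x))\<^sup>2"
      by (simp only: \<pi>_def norm_proj_square sum_distrib_left)
    also have "\<dots> = X x * (h (ln (norm (\<pi> x))) - m * H (ln (norm (\<pi> x)))) * norm (\<pi> x) powr (- m)"
      using n0 by (simp add: \<eta>'_def power2_eq_square)
    finally show ?thesis by (simp add: \<psi>_def \<eta>_def m_def \<pi>_def algebra_simps)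
  next
    case False
    then show ?thesis using far[OF False] H0 by (auto simp: \<psi>0 \<psi>'0 \<pi>_def)
  qed
  have "(\<integral>x. X x * (h (ln (norm (proj W x))) * norm (proj W x) powr (- real (card W))) \<partial>lborel)
      = (\<Sum>u\<in>W. \<integral>x. (x \<bullet> u) * \<psi>' u x \<partial>lborel) + m * (\<integral>x. \<psi> x \<partial>lborel)"
    unfolding eq using ibp(1) i\<psi> by simp
  also have "\<dots> = 0" by (simp add: ibp(2) m_def)
  finally show ?thesis .
qed

text \<open>
Cover the closed ball of radius \<open>2\<close> in the kernel of the projection by finitely many unit balls with
centres there; scaling by \<open>\<rho>\<close> and translating by the centres, which does not change \<open>proj W x\<close>,
covers the doubled slab by that many copies of the slab.
\<close>

lemma slab_doubling_exists: "\<exists>M. slab_doubling W M"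
proof -
  define L where "L = {x. proj W x = 0}"
  have "closed L" unfolding L_def
    by (intro closed_Collect_eq continuous_on_proj continuous_intros)
  then have "compact (cball 0 2 \<inter> L)" by (simp add: compact_Int_closed)
  then obtain C where C: "finite C" "C \<subseteq> cball 0 2 \<inter> L" "cball 0 2 \<inter> L \<subseteq> (\<Union>c\<in>C. ball c 1)"
    using compactE_image[of "cball 0 2 \<inter> L" "cball 0 2 \<inter> L" "\<lambda>c. ball c 1"] by (metis (no_types, lifting) UN_I centre_in_ball open_ball subsetI zero_less_one)
  show ?thesis
    unfolding slab_doubling_def
  proof (intro exI[of _ "real (card C + 1)"] conjI allI impI)
    fix \<rho> s1 :: real and \<kappa> :: "'a \<Rightarrow> real"
    assume \<rho>: "\<rho> > 0" and cont: "continuous_on UNIV (\<lambda>x. \<kappa> (proj W x))"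
      and "\<forall>z. \<kappa> z \<ge> 0" and "\<forall>z. norm z > s1 \<longrightarrow> \<kappa> z = 0"
    then have pos: "\<And>z. \<kappa> z \<ge> 0" and supp: "\<And>z. norm z > s1 \<Longrightarrow> \<kappa> z = 0" by blast+
    define F where "F = (\<lambda>b x. indicator {x. norm (x - proj W x) < b} x * \<kappa> (proj W x))"
    have slab: "open {x. norm (x - proj W x) < b}" for b
      by (intro open_Collect_less continuous_intros continuous_on_proj)
    have Fm[measurable]: "F b \<in> borel_measurable borel" for b
      unfolding F_def using slab[of b] cont
      by (intro borel_measurable_times borel_measurable_indicator borel_measurable_continuous_onI) auto
    have iF: "integrable lborel (F b)" for b
    proof -
      define S where "S = {x. norm (x - proj W x) \<le> b \<and> 0 \<le> norm (proj W x) \<and> norm (proj W x) \<le> s1}"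
      have "integrable lborel (\<lambda>x. indicator S x *\<^sub>R \<kappa> (proj W x))"
        using compact_shell[of b 0 s1] continuous_on_subset[OF cont]
        unfolding S_def by (intro borel_integrable_compact) auto
      then show ?thesis
      proof (rule Bochner_Integration.integrable_bound)
        show "AE x in lborel. norm (F b x) \<le> norm (indicator S x *\<^sub>R \<kappa> (proj W x))"
          using supp by (intro AE_I2) (auto simp: F_def S_def indicator_def not_le)
      qed simp
    qed
    have F0: "F b x \<ge> 0" for b x using pos by (simp add: F_def)
    have cover: "F (2 * \<rho>) x \<le> (\<Sum>c\<in>C. F \<rho> (x + - (\<rho> *\<^sub>R c)))" for x
    proof (cases "norm (x - proj W x) < 2 * \<rho>")
      case True
      have "norm ((1 / \<rho>) *\<^sub>R (x - proj W x)) \<le> 2"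
        using True \<rho> unfolding norm_scaleR by (simp add: field_simps)
      moreover have "proj W ((1 / \<rho>) *\<^sub>R (x - proj W x)) = 0"
        by (simp only: linear_scale[OF linear_proj] linear_diff[OF linear_proj] proj_proj) simp
      ultimately have "(1 / \<rho>) *\<^sub>R (x - proj W x) \<in> cball 0 2 \<inter> L"
        by (simp add: L_def del: scaleR_diff_right)
      then obtain c where c': "c \<in> C" "(1 / \<rho>) *\<^sub>R (x - proj W x) \<in> ball c 1"
        using C(3) by blast
      then have c: "c \<in> C" "norm (c - (1 / \<rho>) *\<^sub>R (x - proj W x)) < 1"
        by (simp_all only: mem_ball dist_norm)
      have pc: "proj W c = 0" using c C(2) by (auto simp: L_def)
      have px: "proj W (x + - (\<rho> *\<^sub>R c)) = proj W x"
        by (simp add: linear_diff[OF linear_proj] linear_scale[OF linear_proj] pc)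
      have "(x + - (\<rho> *\<^sub>R c)) - proj W x = - (\<rho> *\<^sub>R (c - (1 / \<rho>) *\<^sub>R (x - proj W x)))"
        using \<rho> by (simp add: scaleR_diff_right)
      then have "norm ((x + - (\<rho> *\<^sub>R c)) - proj W x) < \<rho>"
        using c(2) \<rho> by simp
      then have mem: "x + - (\<rho> *\<^sub>R c) \<in> {x. norm (x - proj W x) < \<rho>}"
        by (simp only: mem_Collect_eq px)
      have "F \<rho> (x + - (\<rho> *\<^sub>R c)) = F (2 * \<rho>) x"
        unfolding F_def px by (subst indicator_simps(1)[OF mem]) (simp add: True)
      moreover have "F \<rho> (x + - (\<rho> *\<^sub>R c)) \<le> (\<Sum>c\<in>C. F \<rho> (x + - (\<rho> *\<^sub>R c)))"
        using C(1) c(1) F0 by (intro member_le_sum) auto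
      ultimately show ?thesis by simp
    next
      case False
      then have "F (2 * \<rho>) x = 0" by (simp add: F_def)
      then show ?thesis by (simp add: sum_nonneg F0)
    qed
    have iT: "integrable lborel (\<lambda>x. F \<rho> (x + v))" for v
    proof -
      have "integrable (distr lborel borel ((+) v)) (F \<rho>)" by (simp only: lborel_distr_plus iF)
      then have "integrable lborel (\<lambda>x. F \<rho> (v + x))" by (rule integrable_distr[rotated]) simp
      then show ?thesis by (simp add: add.commute)
    qed
    have "(\<integral>x. F (2 * \<rho>) x \<partial>lborel) \<le> (\<integral>x. (\<Sum>c\<in>C. F \<rho> (x + - (\<rho> *\<^sub>R c))) \<partial>lborel)"
      by (rule integral_mono[OF iF _ cover]) (intro Bochner_Integration.integrable_sum iT)
    also have "\<dots> = (\<Sum>c\<in>C. \<integral>x. F \<rho> (x + - (\<rho> *\<^sub>R c)) \<partial>lborel)"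
      by (intro Bochner_Integration.integral_sum iT)
    also have "\<dots> = card C * (\<integral>x. F \<rho> x \<partial>lborel)"
      by (simp only: lborel_integral_translation[OF Fm] sum_constant)
    also have "\<dots> \<le> real (card C + 1) * (\<integral>x. F \<rho> x \<partial>lborel)"
      using F0 by (intro mult_right_mono integral_nonneg_AE) auto
    finally show "(\<integral>x. indicator {x. norm (x - proj W x) < 2 * \<rho>} x * \<kappa> (proj W x) \<partial>lborel)
      \<le> real (card C + 1) * (\<integral>x. indicator {x. norm (x - proj W x) < \<rho>} x * \<kappa> (proj W x) \<partial>lborel)"
      by (simp add: F_def)
  qed simp
qed

end

section \<open>A bump function and elementary estimates\<close>

definition bump :: "real \<Rightarrow> real" where
  "bump t = (max 0 (1 - t\<^sup>2))\<^sup>2"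

definition bump' :: "real \<Rightarrow> real" where
  "bump' t = - 4 * t * max 0 (1 - t\<^sup>2)"

lemma max_square_has_derivative:
  "((\<lambda>x. (max 0 x)\<^sup>2) has_real_derivative 2 * max 0 x) (at (x::real))"
proof -
  consider "x < 0" | "x > 0" | "x = 0" by linarith
  then show ?thesis
  proof cases
    case 1
    have "eventually (\<lambda>y. y \<in> {..<0}) (nhds x)" using 1 by (intro eventually_nhds_in_open) auto
    then have "((\<lambda>x. (max 0 x)\<^sup>2) has_real_derivative 0) (at x) \<longleftrightarrow> ((\<lambda>x. 0) has_real_derivative 0) (at x)"
      by (intro DERIV_cong_ev) (auto elim!: eventually_mono)
    then show ?thesis using 1 by simp
  next
    case 2
    have "eventually (\<lambda>y. y \<in> {0<..}) (nhds x)" using 2 by (intro eventually_nhds_in_open) auto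
    then have "((\<lambda>x. (max 0 x)\<^sup>2) has_real_derivative 2 * x) (at x) \<longleftrightarrow> ((\<lambda>x. x\<^sup>2) has_real_derivative 2 * x) (at x)"
      by (intro DERIV_cong_ev) (auto elim!: eventually_mono)
    moreover have "((\<lambda>x. x\<^sup>2) has_real_derivative 2 * x) (at x)" by (auto intro!: derivative_eq_intros)
    ultimately show ?thesis using 2 by simp
  next
    case 3
    have "((\<lambda>h. (max 0 h)\<^sup>2 / h) \<longlongrightarrow> 0) (at (0::real))"
    proof (rule Lim_null_comparison)
      show "\<forall>\<^sub>F h in at 0. norm ((max 0 h)\<^sup>2 / h) \<le> \<bar>h\<bar>" for h :: real
        by (intro always_eventually allI) (auto simp: max_def power2_eq_square)
      show "((\<lambda>h. \<bar>h\<bar>) \<longlongrightarrow> 0) (at (0::real))" by (auto intro!: tendsto_eq_intros)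
    qed
    then show ?thesis using 3 by (simp add: DERIV_def)
  qed
qed

lemma bump_has_derivative: "(bump has_real_derivative bump' t) (at t)"
proof -
  have "((\<lambda>t. 1 - t\<^sup>2) has_real_derivative - 2 * t) (at t)"
    by (auto intro!: derivative_eq_intros)
  from DERIV_chain2[OF max_square_has_derivative this]
  show ?thesis by (simp add: bump_def[abs_def] bump'_def algebra_simps)
qed

lemma continuous_bump: "continuous_on A bump" "continuous_on A bump'"
  unfolding bump_def[abs_def] bump'_def[abs_def] by ((intro continuous_intros)+)

lemma bump_nonneg: "bump t \<ge> 0" by (simp add: bump_def)
lemma bump_zero: "\<bar>t\<bar> \<ge> 1 \<Longrightarrow> bump t = 0" "\<bar>t\<bar> \<ge> 1 \<Longrightarrow> bump' t = 0"
  using one_le_power[of "\<bar>t\<bar>" 2] by (simp_all add: bump_def bump'_def)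
lemma bump_pos: "\<bar>t\<bar> < 1 \<Longrightarrow> bump t > 0"
  using abs_square_less_1[of t] by (simp add: bump_def)
lemma bump_ge: "\<bar>t\<bar> \<le> 1 / 2 \<Longrightarrow> bump t \<ge> 9 / 16"
proof -
  assume "\<bar>t\<bar> \<le> 1 / 2"
  then have "t\<^sup>2 \<le> (1 / 2)\<^sup>2" by (metis abs_ge_zero power2_abs power_mono)
  then have "1 - t\<^sup>2 \<ge> 3 / 4" by (simp add: power2_eq_square)
  then have "(max 0 (1 - t\<^sup>2))\<^sup>2 \<ge> (3 / 4)\<^sup>2" by (intro power_mono) auto
  then show ?thesis by (simp add: bump_def power2_eq_square)
qed

text \<open>
The number \<open>\<kappa>\<close> is \<open>\<integral> |bump'|\<^sup>p / \<integral> bump\<^sup>p\<close>, which makes the total integral of the difference zero,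
so that its antiderivative \<open>H\<close> has compact support. In this form the ratio of the two integrals can
be transported by \<open>log_radial_integral_zero\<close>.
\<close>

lemma bump_antiderivative:
  fixes p :: real assumes p: "p \<ge> 1"
  obtains \<kappa> H where "\<And>t. (H has_real_derivative (\<bar>bump' t\<bar> powr p - \<kappa> * bump t powr p)) (at t)"
    "\<And>t. \<bar>t\<bar> \<ge> 1 \<Longrightarrow> H t = 0"
proof -
  have anti: "\<exists>F. \<forall>t. (F has_real_derivative f t) (at t)" if "continuous_on UNIV f" for f :: "real \<Rightarrow> real"
  proof -
    have "\<exists>F. \<forall>x :: real. - \<infinity> < ereal x \<longrightarrow> ereal x < \<infinity> \<longrightarrow> (F has_vector_derivative f x) (at x)"
      by (rule einterval_antiderivative) (use that in \<open>auto simp: continuous_on_eq_continuous_at\<close>)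
    then show ?thesis by (auto simp: has_real_derivative_iff_has_vector_derivative)
  qed
  have c1: "continuous_on UNIV (\<lambda>t. \<bar>bump' t\<bar> powr p)" and c2: "continuous_on UNIV (\<lambda>t. bump t powr p)"
    using p bump_nonneg by ((intro continuous_on_powr' continuous_intros continuous_bump; auto)+)
  obtain F1 where F1: "\<And>t. (F1 has_real_derivative \<bar>bump' t\<bar> powr p) (at t)" using anti[OF c1] by blast
  obtain F0 where F0: "\<And>t. (F0 has_real_derivative bump t powr p) (at t)" using anti[OF c2] by blast
  have I0: "F0 1 - F0 (-1) > 0"
  proof -
    have "F0 (-1) < F0 1"
    proof (rule DERIV_pos_imp_increasing_open[of "-1" 1 F0])
      show "\<exists>y. (F0 has_real_derivative y) (at x) \<and> 0 < y" if "- 1 < x" "x < 1" for x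
        using F0[of x] bump_pos[of x] that by (intro exI[of _ "bump x powr p"]) (auto simp: abs_less_iff)
      show "continuous_on {- 1..1} F0"
        using F0 by (meson DERIV_isCont continuous_at_imp_continuous_on)
    qed simp
    then show ?thesis by simp
  qed
  define \<kappa> where "\<kappa> = (F1 1 - F1 (-1)) / (F0 1 - F0 (-1))"
  define H where "H = (\<lambda>t. (F1 t - F1 (-1)) - \<kappa> * (F0 t - F0 (-1)))"
  have H: "(H has_real_derivative (\<bar>bump' t\<bar> powr p - \<kappa> * bump t powr p)) (at t)" for t
    unfolding H_def by (auto intro!: derivative_eq_intros F1 F0)
  have H1: "H 1 = 0" using I0 by (simp add: H_def \<kappa>_def)
  have Hm: "H (-1) = 0" by (simp add: H_def)
  have Hz: "(H has_real_derivative 0) (at t)" if "\<bar>t\<bar> \<ge> 1" for t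
    using H[of t] bump_zero[OF that] p by simp
  have "H t = 0" if "\<bar>t\<bar> \<ge> 1" for t
  proof (cases "t \<ge> 1")
    case True
    have "H 1 = H t"
    proof (cases "t = 1")
      case False
      have cH: "continuous_on {1..t} H"
        using H by (meson DERIV_isCont continuous_at_imp_continuous_on)
      have "(H has_real_derivative 0) (at x)" if "1 < x" "x < t" for x
        using Hz that by simp
      then show ?thesis
        using DERIV_isconst_end[of 1 t H] True False cH by simp
    qed simp
    then show ?thesis using H1 by simp
  next
    case False
    then have t: "t \<le> -1" using that by linarith
    have "H (-1) = H t"
    proof (cases "t = -1")
      case False
      have cH: "continuous_on {t..-1} H"
        using H by (meson DERIV_isCont continuous_at_imp_continuous_on)
      have "(H has_real_derivative 0) (at x)" if "t < x" "x < -1" for x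
        using Hz that by simp
      then show ?thesis
        using DERIV_isconst_end[of t "-1" H] t False cH by simp
    qed simp
    then show ?thesis using Hm by simp
  qed
  then show thesis using that H by blast
qed

lemma powr_add_le_convex:
  fixes A C p \<theta> :: real
  assumes "p \<ge> 1" "A \<ge> 0" "C \<ge> 0" "0 < \<theta>" "\<theta> < 1"
  shows "(A + C) powr p \<le> \<theta> powr (1 - p) * A powr p + (1 - \<theta>) powr (1 - p) * C powr p"
proof -
  have ge1: "b powr (1 - p) \<ge> 1" if "0 < b" "b < 1" for b :: real
    using powr_mono'[of "1 - p" 0 b] that assms(1) by simp
  consider "A = 0" | "C = 0" | "A > 0" "C > 0" using assms by linarith
  then show ?thesis
  proof cases
    case 1
    then show ?thesis using ge1[of "1 - \<theta>"] assms mult_right_mono[of 1 "(1 - \<theta>) powr (1 - p)" "C powr p"] by simp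
  next
    case 2
    then show ?thesis using ge1[of \<theta>] assms mult_right_mono[of 1 "\<theta> powr (1 - p)" "A powr p"] by simp
  next
    case 3
    have scale: "b * (x / b) powr p = b powr (1 - p) * x powr p" if "b > 0" "x > 0" for b x :: real
      using that by (simp add: powr_divide powr_diff)
    have "((1 - \<theta>) *\<^sub>R (C / (1 - \<theta>)) + \<theta> *\<^sub>R (A / \<theta>)) powr p
        \<le> (1 - \<theta>) * (C / (1 - \<theta>)) powr p + \<theta> * (A / \<theta>) powr p"
      using convex_onD[OF powr_convex[OF assms(1)], of \<theta> "C / (1 - \<theta>)" "A / \<theta>"] assms 3 by simp
    then show ?thesis using assms 3 by (simp add: scale add.commute)
  qed
qed

text \<open>
Whatever the length of a logarithmic window, it can be moved far enough towards \<open>0\<close> (if \<open>\<delta> \<le> \<delta>'\<close>) or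
towards infinity (if \<open>\<delta>' < \<delta>\<close>) for the weight to behave like the power \<open>s\<^bsup>min \<delta> \<delta>'\<^esup>\<close> on it.
\<close>

lemma hardy_log_deriv_near_min:
  assumes u: "u > 0"
  obtains \<tau> where "\<And>t. \<bar>t - \<tau>\<bar> \<le> N \<Longrightarrow> hardy_log_deriv \<delta> \<delta>' (exp t) \<le> min \<delta> \<delta>' + u"
proof (cases "\<delta> \<le> \<delta>'")
  case True
  define \<tau> where "\<tau> = ln (u / (\<delta>' - \<delta> + 1)) - N"
  have "hardy_log_deriv \<delta> \<delta>' (exp t) \<le> min \<delta> \<delta>' + u" if "\<bar>t - \<tau>\<bar> \<le> N" for t
  proof -
    have "t \<le> ln (u / (\<delta>' - \<delta> + 1))" using that by (simp add: \<tau>_def abs_le_iff)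
    then have "exp t \<le> u / (\<delta>' - \<delta> + 1)" using u True by (simp add: ln_ge_iff)
    then have 1: "(\<delta>' - \<delta> + 1) * exp t \<le> u" using True by (simp add: field_simps)
    have "exp t / (1 + exp t) \<le> exp t"
      by (simp add: pos_divide_le_eq add_pos_pos algebra_simps)
    then have "(\<delta>' - \<delta>) * (exp t / (1 + exp t)) \<le> (\<delta>' - \<delta>) * exp t"
      using True by (intro mult_left_mono) auto
    also have "\<dots> \<le> u"
      using 1 exp_ge_zero[of t] unfolding distrib_right[of "\<delta>' - \<delta>" 1] by linarith
    finally show ?thesis using True by (simp add: hardy_log_deriv_def)
  qed
  then show thesis by (rule that)
next
  case False
  define \<tau> where "\<tau> = ln ((\<delta> - \<delta>') / u) + N"
  have "hardy_log_deriv \<delta> \<delta>' (exp t) \<le> min \<delta> \<delta>' + u" if "\<bar>t - \<tau>\<bar> \<le> N" for t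
  proof -
    have "t \<ge> ln ((\<delta> - \<delta>') / u)" using that by (simp add: \<tau>_def abs_le_iff)
    then have "exp t \<ge> (\<delta> - \<delta>') / u" using u False
      by (metis divide_pos_pos exp_le_cancel_iff exp_ln diff_gt_0_iff_gt not_le)
    then have 1: "\<delta> - \<delta>' \<le> u * exp t" using u by (simp add: field_simps)
    also have "\<dots> \<le> u * (1 + exp t)" using u by simp
    finally have "(\<delta> - \<delta>') / (1 + exp t) \<le> u"
      by (simp add: pos_divide_le_eq add_pos_pos)
    moreover have "hardy_log_deriv \<delta> \<delta>' (exp t) = \<delta>' + (\<delta> - \<delta>') / (1 + exp t)"
    proof -
      have "1 + exp t \<noteq> 0" using exp_gt_zero[of t] by linarith
      then show ?thesis by (simp add: hardy_log_deriv_def field_simps)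
    qed
    ultimately show ?thesis using False by simp
  qed
  then show thesis by (rule that)
qed

section \<open>Product test functions\<close>

definition test_fn :: "'a::euclidean_space set \<Rightarrow> real \<Rightarrow> (real \<Rightarrow> real) \<Rightarrow> 'a \<Rightarrow> real" where
  "test_fn W R f w = bump (norm (w - proj W w) / R) * f (norm (proj W w))"

text \<open>
The gradient of the test function. Where \<open>proj W w = 0\<close> both summands vanish, because division by
zero gives zero and the radial factors vanish near the axis.
\<close>

definition test_grad :: "'a::euclidean_space set \<Rightarrow> real \<Rightarrow> (real \<Rightarrow> real) \<Rightarrow> (real \<Rightarrow> real) \<Rightarrow> 'a \<Rightarrow> 'a" where
  "test_grad W R f f' w =
     (- 4 * max 0 (1 - (norm (w - proj W w) / R)\<^sup>2) / R\<^sup>2 * f (norm (proj W w))) *\<^sub>R (w - proj W w)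
     + (bump (norm (w - proj W w) / R) * f' (norm (proj W w)) / norm (proj W w)) *\<^sub>R proj W w"

context
  fixes B W :: "'a::euclidean_space set" and R s0 s1 :: real and f f' :: "real \<Rightarrow> real"
  assumes B: "orthonormal_basis B" and W: "W \<subseteq> B" and R: "R > 0" and s0: "s0 > 0"
    and f: "\<And>s. s > 0 \<Longrightarrow> (f has_real_derivative f' s) (at s)" and f': "continuous_on {0<..} f'"
    and f0: "\<And>s. s \<ge> 0 \<Longrightarrow> s \<notin> {s0..s1} \<Longrightarrow> f s = 0" "\<And>s. s \<ge> 0 \<Longrightarrow> s \<notin> {s0..s1} \<Longrightarrow> f' s = 0"
begin

lemma test_support:
  assumes "w \<notin> {x. norm (x - proj W x) \<le> R \<and> s0 \<le> norm (proj W x) \<and> norm (proj W x) \<le> s1}"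
  shows "test_fn W R f w = 0" "test_grad W R f f' w = 0"
proof -
  consider "norm (w - proj W w) > R" | "norm (proj W w) \<notin> {s0..s1}" using assms by auto
  then have "test_fn W R f w = 0 \<and> test_grad W R f f' w = 0"
  proof cases
    case 1
    then have r: "\<bar>norm (w - proj W w) / R\<bar> \<ge> 1" using R by simp
    moreover have "max 0 (1 - (norm (w - proj W w) / R)\<^sup>2) = 0"
      using one_le_power[of "norm (w - proj W w) / R" 2] 1 R by simp
    ultimately show ?thesis by (simp add: test_fn_def test_grad_def bump_zero)
  next
    case 2
    then show ?thesis by (simp add: test_fn_def test_grad_def f0)
  qed
  then show "test_fn W R f w = 0" "test_grad W R f f' w = 0" by auto
qed

lemma compact_test_support:
  "compact {x. norm (x - proj W x) \<le> R \<and> s0 \<le> norm (proj W x) \<and> norm (proj W x) \<le> s1}"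
  by (rule compact_shell[OF B W])

lemma continuous_test_grad: "continuous_on UNIV (test_grad W R f f')"
proof (rule continuous_on_UNIV_extend_zero[OF _ _ compact_imp_closed[OF compact_test_support] _ test_support(2)])
  have c: "continuous_on A (\<lambda>w. norm (proj W w))" for A
    by (intro continuous_intros continuous_on_proj[OF B W])
  have cf: "continuous_on {0<..} f"
    using f by (meson DERIV_isCont continuous_at_imp_continuous_on greaterThan_iff)
  show "open {w. proj W w \<noteq> 0}"
    by (intro open_Collect_neq continuous_on_proj[OF B W] continuous_intros)
  show "continuous_on {w. proj W w \<noteq> 0} (test_grad W R f f')"
    unfolding test_grad_def[abs_def] using R
    by (intro continuous_intros continuous_on_proj[OF B W] continuous_on_compose2[OF cf c]
        continuous_on_compose2[OF f' c] continuous_on_compose2[OF continuous_bump(1)[of UNIV]]) auto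
qed (use s0 in auto)

lemma test_fn_has_derivative: "(test_fn W R f has_derivative (\<lambda>v. test_grad W R f f' w \<bullet> v)) (at w)"
proof (cases "proj W w = 0")
  case False
  define y where "y = (\<lambda>w. w - proj W w)"
  have n0: "norm (proj W w) > 0" using False by simp
  note lin = linear_proj[OF B W]
  have dproj: "(proj W has_derivative proj W) (at w)"
    using lin by (intro bounded_linear_imp_has_derivative) (simp add: linear_conv_bounded_linear)
  have dy: "(y has_derivative y) (at w)"
    unfolding y_def using has_derivative_diff[OF has_derivative_ident dproj] .
  have yv: "y w \<bullet> y v = y w \<bullet> v" "proj W w \<bullet> proj W v = proj W w \<bullet> v" for v
  proof -
    have "y w \<bullet> y v = y w \<bullet> v - proj W v \<bullet> y w"
      by (simp add: y_def inner_diff_right inner_diff_left inner_commute[of "proj W v" w]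
          inner_commute[of "proj W v" "proj W w"])
    then show "y w \<bullet> y v = y w \<bullet> v"
      using proj_orthogonal[OF B W, of v w] by (simp add: y_def)
    have "proj W w \<bullet> v = proj W w \<bullet> proj W v + proj W w \<bullet> (v - proj W v)"
      by (simp add: inner_diff_right)
    then show "proj W w \<bullet> proj W v = proj W w \<bullet> v"
      using proj_orthogonal[OF B W, of w v] by simp
  qed
  have beq: "bump (norm (y w) / R) = (max 0 (1 - 1 / R\<^sup>2 * (y w \<bullet> y w)))\<^sup>2" for w
    by (simp add: bump_def power_divide power2_norm_eq_inner)
  have dq: "((\<lambda>w. y w \<bullet> y w) has_derivative (\<lambda>v. 2 * (y w \<bullet> v))) (at w)"
    by (rule has_derivative_eq_rhs[OF has_derivative_inner[OF dy dy]])
      (simp add: fun_eq_iff yv inner_commute[of "y v" "y w" for v])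
  have "((\<lambda>w. 1 - 1 / R\<^sup>2 * (y w \<bullet> y w)) has_derivative (\<lambda>v. 0 - 1 / R\<^sup>2 * (2 * (y w \<bullet> v)))) (at w)"
    by (intro has_derivative_diff has_derivative_const has_derivative_mult_right dq)
  from has_derivative_compose[OF this max_square_has_derivative[unfolded has_field_derivative_def]]
  have dA: "((\<lambda>w. bump (norm (y w) / R)) has_derivative
      (\<lambda>v. (2 * max 0 (1 - (norm (y w) / R)\<^sup>2)) * (- (2 * (y w \<bullet> v)) / R\<^sup>2))) (at w)"
    unfolding beq by (simp add: power_divide power2_norm_eq_inner)
  have "((\<lambda>w. norm (proj W w)) has_derivative (\<lambda>v. (proj W w \<bullet> v) / norm (proj W w))) (at w)"
    using has_derivative_compose[OF dproj has_derivative_norm[OF False]] yv(2)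
    by (simp add: sgn_div_norm inner_commute[of "proj W _" "proj W w"] divide_inverse mult.commute)
  from has_derivative_compose[OF this f[OF n0, unfolded has_field_derivative_def]]
  have df: "((\<lambda>w. f (norm (proj W w))) has_derivative
     (\<lambda>v. f' (norm (proj W w)) * ((proj W w \<bullet> v) / norm (proj W w)))) (at w)" .
  have grad: "test_grad W R f f' w = (- 4 * max 0 (1 - (norm (y w) / R)\<^sup>2) / R\<^sup>2 * f (norm (proj W w))) *\<^sub>R y w
     + (bump (norm (y w) / R) * f' (norm (proj W w)) / norm (proj W w)) *\<^sub>R proj W w"
    by (simp add: test_grad_def y_def)
  have "((\<lambda>w. bump (norm (y w) / R) * f (norm (proj W w))) has_derivative
      (\<lambda>v. test_grad W R f f' w \<bullet> v)) (at w)"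
    by (rule has_derivative_eq_rhs[OF has_derivative_mult[OF dA df]])
      (simp add: fun_eq_iff grad inner_add_left inner_diff_left mult_ac)
  then show ?thesis by (simp add: test_fn_def[abs_def] y_def)
next
  case True
  define S where "S = {x. norm (x - proj W x) \<le> R \<and> s0 \<le> norm (proj W x) \<and> norm (proj W x) \<le> s1}"
  have wS: "w \<in> - S" using True s0 by (simp add: S_def)
  have "open (- S)" using compact_test_support by (simp add: S_def compact_imp_closed open_Compl)
  then have ev: "eventually (\<lambda>y. y \<in> - S) (nhds w)" using wS by (intro eventually_nhds_in_open) auto
  have "((\<lambda>w. 0) has_derivative (\<lambda>v. 0)) (at w)" by simp
  then have "(test_fn W R f has_derivative (\<lambda>v. 0)) (at w)"
  proof (rule has_derivative_transform_eventually)
    show "\<forall>\<^sub>F y in at w. 0 = test_fn W R f y"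
      unfolding eventually_at_filter using ev
      by (rule eventually_mono) (use test_support(1) S_def in auto)
    show "0 = test_fn W R f w" using wS test_support(1) by (simp add: S_def)
  qed simp
  then show ?thesis using wS test_support(2) by (simp add: S_def)
qed

lemma norm_test_grad_le:
  "norm (test_grad W R f f' w) \<le> bump (norm (w - proj W w) / R) * \<bar>f' (norm (proj W w))\<bar>
     + 4 / R * indicator {x. norm (x - proj W x) < R} w * \<bar>f (norm (proj W w))\<bar>"
proof -
  define b where "b = norm (w - proj W w)"
  have b0: "b \<ge> 0" by (simp add: b_def)
  have "\<bar>- 4 * max 0 (1 - (b / R)\<^sup>2) / R\<^sup>2\<bar> * b \<le> 4 / R * indicator {x. norm (x - proj W x) < R} w"
  proof (cases "b < R")
    case True
    have "max 0 (1 - (b / R)\<^sup>2) * b \<le> 1 * R"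
      using True b0 by (intro mult_mono) auto
    then have "4 * max 0 (1 - (b / R)\<^sup>2) * b / R\<^sup>2 \<le> 4 * R / R\<^sup>2"
      by (intro divide_right_mono) auto
    then show ?thesis using True R by (simp add: b_def[symmetric] power2_eq_square abs_mult)
  next
    case False
    then have "1 \<le> (b / R)\<^sup>2" using R one_le_power[of "b / R" 2] by simp
    then show ?thesis using R by (simp add: zero_le_divide_iff)
  qed
  then have "\<bar>- 4 * max 0 (1 - (b / R)\<^sup>2) / R\<^sup>2\<bar> * b * \<bar>f (norm (proj W w))\<bar>
      \<le> 4 / R * indicator {x. norm (x - proj W x) < R} w * \<bar>f (norm (proj W w))\<bar>"
    by (intro mult_right_mono) auto
  then have 1: "norm ((- 4 * max 0 (1 - (b / R)\<^sup>2) / R\<^sup>2 * f (norm (proj W w))) *\<^sub>R (w - proj W w))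
      \<le> 4 / R * indicator {x. norm (x - proj W x) < R} w * \<bar>f (norm (proj W w))\<bar>"
    by (simp add: abs_mult b_def[symmetric] mult_ac)
  have 2: "norm ((bump (b / R) * f' (norm (proj W w)) / norm (proj W w)) *\<^sub>R proj W w)
      \<le> bump (b / R) * \<bar>f' (norm (proj W w))\<bar>"
    by (cases "proj W w = 0") (simp_all add: abs_mult bump_nonneg)
  show ?thesis
    unfolding test_grad_def b_def[symmetric] using norm_triangle_mono[OF 1 2] by (simp add: add.commute)
qed

end

text \<open>
Over a relative ball contained in \<open>K\<close> the set looks like its affine hull: the foot of the
perpendicular on the hull already belongs to \<open>K\<close>.
\<close>

lemma infdist_eq_norm_proj:
  fixes K :: "'a::euclidean_space set"
  assumes B: "orthonormal_basis B" "W \<subseteq> B" and x0: "x0 \<in> K"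
    and orth: "\<And>u y z. u \<in> W \<Longrightarrow> y \<in> K \<Longrightarrow> z \<in> K \<Longrightarrow> u \<bullet> (y - z) = 0"
    and ball: "\<And>v. norm v \<le> R \<Longrightarrow> proj W v = 0 \<Longrightarrow> x0 + v \<in> K"
    and w: "norm (w - proj W w) \<le> R"
  shows "infdist (x0 + w) K = norm (proj W w)"
proof (rule antisym)
  have "proj W (w - proj W w) = 0"
    by (simp add: linear_diff[OF linear_proj[OF B]] proj_proj[OF B])
  then have "x0 + (w - proj W w) \<in> K" using ball w by blast
  then have "infdist (x0 + w) K \<le> dist (x0 + w) (x0 + (w - proj W w))" by (rule infdist_le)
  then show "infdist (x0 + w) K \<le> norm (proj W w)" by (simp add: dist_norm)
  have "norm (proj W w) \<le> dist (x0 + w) q" if q: "q \<in> K" for q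
  proof -
    have "proj W (x0 - q) = 0"
      unfolding proj_def using orth[OF _ x0 q] by (simp add: inner_commute)
    then have "proj W ((x0 - q) + w) = proj W w"
      using linear_add[OF linear_proj[OF B]] by simp
    moreover have "norm (proj W ((x0 - q) + w)) \<le> norm ((x0 - q) + w)"
      by (rule norm_proj_le[OF B])
    ultimately show ?thesis by (simp add: dist_norm algebra_simps)
  qed
  moreover have ne: "K \<noteq> {}" using x0 by auto
  ultimately show "norm (proj W w) \<le> infdist (x0 + w) K"
    unfolding infdist_notempty[OF ne] by (intro cINF_greatest[OF ne])
qed

section \<open>Almost optimal test functions\<close>

text \<open>
The virtual minimiser of the Hardy quotient is \<open>(c(s) s\<^bsup>m - p\<^esup>)\<^bsup>-1/p\<^esup>\<close> with \<open>m\<close> the codimension: it turns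
the weighted measure \<open>c(s) s\<^bsup>-p\<^esup> f(s)\<^sup>p dz\<close> into the dilation invariant one. It is truncated to the
logarithmic window \<open>|ln s - \<tau>| \<le> N\<close>. Absorbing the whole weight \<open>c\<close> into the profile, and not only a
power, makes the denominator of the quotient exact.
\<close>

definition profile :: "real \<Rightarrow> real \<Rightarrow> real \<Rightarrow> real \<Rightarrow> real \<Rightarrow> real \<Rightarrow> real \<Rightarrow> real" where
  "profile m p \<delta> \<delta>' \<tau> N s =
     bump ((ln s - \<tau>) / N) * (hardy_weight \<delta> \<delta>' s * s powr (m - p)) powr (- 1 / p)"

definition profile' :: "real \<Rightarrow> real \<Rightarrow> real \<Rightarrow> real \<Rightarrow> real \<Rightarrow> real \<Rightarrow> real \<Rightarrow> real" where
  "profile' m p \<delta> \<delta>' \<tau> N s =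
     (bump' ((ln s - \<tau>) / N) / N - (hardy_log_deriv \<delta> \<delta>' s + (m - p)) / p * bump ((ln s - \<tau>) / N))
       * (hardy_weight \<delta> \<delta>' s * s powr (m - p)) powr (- 1 / p) / s"

lemma continuous_on_pos_hardy: "continuous_on {0<..} (\<lambda>s. hardy_weight \<delta> \<delta>' s * s powr b)"
  using hardy_weight_powr_deriv by (meson DERIV_isCont continuous_at_imp_continuous_on greaterThan_iff)

lemma profile_has_derivative:
  assumes s: "s > 0" and p: "p \<ge> 1" and N: "N > 0"
  shows "(profile m p \<delta> \<delta>' \<tau> N has_real_derivative profile' m p \<delta> \<delta>' \<tau> N s) (at s)"
proof -
  define w where "w = (\<lambda>s. hardy_weight \<delta> \<delta>' s * s powr (m - p))"
  define l where "l = hardy_log_deriv \<delta> \<delta>' s + (m - p)"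
  have w: "w s > 0" using s by (simp add: w_def hardy_weight_pos)
  have dw: "(w has_real_derivative w s * (l / s)) (at s)"
    using hardy_weight_powr_deriv[OF s, of \<delta> \<delta>' "m - p"] by (simp add: w_def l_def)
  have "((\<lambda>s. (ln s - \<tau>) / N) has_real_derivative 1 / s / N) (at s)"
    using s N by (auto intro!: derivative_eq_intros)
  from DERIV_chain2[OF bump_has_derivative this]
  have db: "((\<lambda>s. bump ((ln s - \<tau>) / N)) has_real_derivative bump' ((ln s - \<tau>) / N) * (1 / s / N)) (at s)" .
  have d1: "((\<lambda>s. w s powr (- 1 / p)) has_real_derivative (- 1 / p) * w s powr (- 1 / p - 1) * (w s * (l / s))) (at s)"
    using DERIV_fun_powr[OF dw w, of "- 1 / p"] by simp
  have e1: "w s powr (- 1 / p - 1) * w s = w s powr (- 1 / p)"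
    using w powr_mult_base[of "w s" "- 1 / p - 1"] by (simp add: mult.commute)
  have "(- 1 / p) * w s powr (- 1 / p - 1) * (w s * (l / s)) = - (l / p) * (w s powr (- 1 / p - 1) * w s) / s"
    by (simp add: mult_ac)
  then have dv: "((\<lambda>s. w s powr (- 1 / p)) has_real_derivative - (l / p) * w s powr (- 1 / p) / s) (at s)"
    unfolding e1 by (rule DERIV_cong[OF d1])
  have "((\<lambda>s. bump ((ln s - \<tau>) / N) * w s powr (- 1 / p)) has_real_derivative
      bump' ((ln s - \<tau>) / N) * (1 / s / N) * w s powr (- 1 / p)
      + (- (l / p) * w s powr (- 1 / p) / s) * bump ((ln s - \<tau>) / N)) (at s)"
    by (rule DERIV_mult[OF db dv])
  moreover have "bump' ((ln s - \<tau>) / N) * (1 / s / N) * w s powr (- 1 / p)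
      + (- (l / p) * w s powr (- 1 / p) / s) * bump ((ln s - \<tau>) / N) = profile' m p \<delta> \<delta>' \<tau> N s"
    using s N p by (simp add: profile'_def w_def l_def field_simps)
  ultimately show ?thesis by (simp add: profile_def[abs_def] w_def)
qed

lemma continuous_profile':
  assumes p: "p \<ge> 1" and N: "N > 0"
  shows "continuous_on {0<..} (profile' m p \<delta> \<delta>' \<tau> N)"
proof -
  have pos: "hardy_weight \<delta> \<delta>' s * s powr (m - p) \<noteq> 0" if "s > 0" for s
    using hardy_weight_pos[OF that, of \<delta> \<delta>'] that by simp
  have c: "continuous_on {0<..} (\<lambda>s. (ln s - \<tau>) / N)" 
    using N by (intro continuous_intros) auto
  have c2: "continuous_on {0<..} (\<lambda>s. (hardy_weight \<delta> \<delta>' s * s powr (m - p)) powr (- 1 / p))"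
    by (rule continuous_on_powr[OF continuous_on_pos_hardy continuous_on_const]) (use pos in auto)
  have c3: "continuous_on {0<..} (\<lambda>s::real. \<delta> + (\<delta>' - \<delta>) * (s / (1 + s)) + (m - p))"
    by (intro continuous_intros) auto
  show ?thesis
    unfolding profile'_def hardy_log_deriv_def using N p
    by (intro continuous_on_mult continuous_on_divide continuous_on_diff continuous_on_const continuous_on_id c2 c3
        continuous_on_compose2[OF continuous_bump(1)[of UNIV] c]
        continuous_on_compose2[OF continuous_bump(2)[of UNIV] c]) auto
qed

lemma bump_log_zero:
  fixes s \<tau> N :: real
  assumes s: "s \<ge> 0" "s \<notin> {exp (\<tau> - N)..exp (\<tau> + N)}" and N: "N > 0"
  shows "s = 0 \<or> \<bar>(ln s - \<tau>) / N\<bar> \<ge> 1"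
proof (cases "s = 0")
  case False
  then have "s > 0" using s(1) by linarith
  then have "ln s < \<tau> - N \<or> ln s > \<tau> + N"
    using s(2) by (metis atLeastAtMost_iff exp_ln exp_le_cancel_iff not_le)
  then have "\<bar>ln s - \<tau>\<bar> \<ge> N" by linarith
  then show ?thesis using N by (simp add: pos_le_divide_eq)
qed simp

lemma profile_zero:
  assumes "s \<ge> 0" "s \<notin> {exp (\<tau> - N)..exp (\<tau> + N)}" "N > 0"
  shows "profile m p \<delta> \<delta>' \<tau> N s = 0" "profile' m p \<delta> \<delta>' \<tau> N s = 0"
  using bump_log_zero[OF assms] by (auto simp: profile_def profile'_def bump_zero)

text \<open>
The identity behind the choice of the profile: dividing it by \<open>s\<close>, the order of magnitude of its
derivative, makes the weight disappear and leaves the dilation invariant density.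
\<close>

lemma weight_profile:
  assumes s: "s > 0" and p: "p \<ge> 1" and X: "X \<ge> 0"
  shows "hardy_weight \<delta> \<delta>' s * ((hardy_weight \<delta> \<delta>' s * s powr (m - p)) powr (- 1 / p) / s * X) powr p
    = s powr (- m) * X powr p"
proof -
  define c where "c = hardy_weight \<delta> \<delta>' s"
  have c: "c > 0" using hardy_weight_pos[OF s] by (simp add: c_def)
  have "((c * s powr (m - p)) powr (- 1 / p) / s * X) powr p
      = ((c * s powr (m - p)) powr (- 1 / p)) powr p / s powr p * X powr p"
    using s X by (simp add: powr_mult powr_divide)
  also have "((c * s powr (m - p)) powr (- 1 / p)) powr p = inverse (c * s powr (m - p))"
  proof -
    have "- 1 / p * p = - 1" "c * s powr (m - p) > 0" using c s p by simp_all
    then show ?thesis unfolding powr_powr by (simp add: powr_neg_one inverse_eq_divide)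
  qed
  also have "c * (inverse (c * s powr (m - p)) / s powr p * X powr p) = s powr (- m) * X powr p"
  proof -
    have "s powr m = s powr (m - p) * s powr p" using s by (simp add: powr_add[symmetric])
    then show ?thesis using c s by (simp add: powr_minus field_simps)
  qed
  finally show ?thesis by (simp add: c_def)
qed

text \<open>
On the support the distance to \<open>K\<close> is \<open>s = |z|\<close>, where \<open>z\<close> is the component orthogonal to \<open>K\<close>. With
\<open>D\<close> the denominator, the gradient has three parts. The logarithmic derivative of the untruncated
profile gives at most \<open>(a + u)\<^sup>p D\<close>; the derivative of the truncation gives \<open>\<kappa> N\<^bsup>-p\<^esup> D\<close>, exactly, by
invariance in \<open>ln s\<close>; the derivative of the cut-off along \<open>K\<close> is at most \<open>4 s / R\<close> relative to the
profile, and its integral over the slab of radius \<open>R\<close> is compared with \<open>D\<close>, which controls the slab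
of radius \<open>R / 2\<close>, by doubling. The parts are separated by convexity of the \<open>p\<close>-th power, with weight
\<open>1 - u\<close> on the first. For small \<open>u\<close>, then large \<open>N\<close>, a suitable \<open>\<tau>\<close> and finally large \<open>R\<close>, the
factor tends to \<open>a\<^sup>p\<close>.
\<close>

lemma test_function_ratio:
  fixes K :: "(real^'n::finite) set" and p \<delta> \<delta>' R u N \<tau> \<kappa> M :: real
  assumes x0: "x0 \<in> K"
    and B: "orthonormal_basis B" "W \<subseteq> B"
    and orth: "\<And>u y z. u \<in> W \<Longrightarrow> y \<in> K \<Longrightarrow> z \<in> K \<Longrightarrow> u \<bullet> (y - z) = 0"
    and R: "R > 0" and ball: "\<And>v. norm v \<le> R \<Longrightarrow> proj W v = 0 \<Longrightarrow> x0 + v \<in> K"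
    and Wne: "W \<noteq> {}"
    and p: "p \<ge> 1" and pos: "card W + min \<delta> \<delta>' - p > 0"
    and u: "0 < u" "u < 1" and N: "N > 0"
    and \<tau>: "\<And>t. \<bar>t - \<tau>\<bar> \<le> N \<Longrightarrow> hardy_log_deriv \<delta> \<delta>' (exp t) \<le> min \<delta> \<delta>' + p * u"
    and H: "\<And>t. (H has_real_derivative (\<bar>bump' t\<bar> powr p - \<kappa> * bump t powr p)) (at t)"
      "\<And>t. \<bar>t\<bar> \<ge> 1 \<Longrightarrow> H t = 0"
    and dbl: "slab_doubling W M"
  defines "a \<equiv> (card W + min \<delta> \<delta>' - p) / p"
  defines "c1 \<equiv> (1 - u) powr (1 - p) * (a + u) powr p"
  defines "c2 \<equiv> u powr (1 - p) * (1 / 2) powr (1 - p)"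
  defines "w \<equiv> \<lambda>x. hardy_weight \<delta> \<delta>' (infdist x K)"
  shows "\<exists>\<phi>\<in>C1c (- K). \<phi> \<noteq> (\<lambda>x. 0) \<and>
     (LINT x:-K|lborel. w x * infdist x K powr (-p) * \<bar>\<phi> x\<bar> powr p) > 0 \<and>
     (LINT x:-K|lborel. w x * grad_norm \<phi> x powr p)
     \<le> (c1 + c2 * (\<kappa> * (1 / N) powr p + (4 * exp (\<tau> + N) / R) powr p * (M * (16 / 9) powr p)))
        * (LINT x:-K|lborel. w x * infdist x K powr (-p) * \<bar>\<phi> x\<bar> powr p)"
proof -
  have M: "M > 0" using dbl by (simp add: slab_doubling_def)
  define m where "m = real (card W)"
  define f where "f = profile m p \<delta> \<delta>' \<tau> N"
  define f' where "f' = profile' m p \<delta> \<delta>' \<tau> N"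
  define s0 where "s0 = exp (\<tau> - N)"
  define s1 where "s1 = exp (\<tau> + N)"
  have s0: "s0 > 0" by (simp add: s0_def)
  have df: "\<And>s. s > 0 \<Longrightarrow> (f has_real_derivative f' s) (at s)"
    unfolding f_def f'_def by (rule profile_has_derivative[OF _ p N])
  have cf': "continuous_on {0<..} f'" unfolding f'_def by (rule continuous_profile'[OF p N])
  have fz: "\<And>s. s \<ge> 0 \<Longrightarrow> s \<notin> {s0..s1} \<Longrightarrow> f s = 0" "\<And>s. s \<ge> 0 \<Longrightarrow> s \<notin> {s0..s1} \<Longrightarrow> f' s = 0"
    unfolding f_def f'_def s0_def s1_def using profile_zero[OF _ _ N] by (blast+)
  note tst = B R s0 df cf' fz
  define \<Phi> where "\<Phi> = test_fn W R f"
  define G where "G = test_grad W R f f'"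
  define \<phi> where "\<phi> = (\<lambda>x. \<Phi> (x - x0))"
  define S where "S = {x. norm (x - proj W x) \<le> R \<and> s0 \<le> norm (proj W x) \<and> norm (proj W x) \<le> s1}"
  have S: "compact S" unfolding S_def by (rule compact_test_support[OF tst])
  have \<Phi>out: "\<Phi> v = 0" and Gout: "G v = 0" if "v \<notin> S" for v
    using test_support[OF tst] that by (simp_all add: \<Phi>_def G_def S_def)
  have d\<Phi>: "(\<Phi> has_derivative (\<lambda>v. G w \<bullet> v)) (at w)" for w
    unfolding \<Phi>_def G_def by (rule test_fn_has_derivative[OF tst])
  have d\<phi>: "(\<phi> has_derivative (\<lambda>v. G (x - x0) \<bullet> v)) (at x)" for x
  proof -
    have "((\<lambda>x. x - x0) has_derivative (\<lambda>v. v)) (at x)" by (auto intro!: derivative_eq_intros)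
    from has_derivative_compose[OF this d\<Phi>] show ?thesis by (simp add: \<phi>_def)
  qed
  have fd: "frechet_derivative \<phi> (at x) = (\<lambda>v. G (x - x0) \<bullet> v)" for x
    using frechet_derivative_at[OF d\<phi>[of x]] by simp
  have pd: "partial_deriv j \<phi> x = G (x - x0) $ j" for j x
    by (simp add: partial_deriv_def fd inner_axis)
  have gn: "grad_norm \<phi> x = norm (G (x - x0))" for x
    by (simp add: grad_norm_def pd norm_vec_def L2_set_def)
  have projK: "proj W (x - x0) = 0" if "x \<in> K" for x
    unfolding proj_def using orth[OF _ that x0] by (simp add: inner_commute)
  have SK: "x \<notin> K" if "x - x0 \<in> S" for x
    using that projK[of x] s0 by (auto simp: S_def)
  have mem: "\<phi> \<in> C1c (- K)"
  proof -
    have sub: "{x. \<phi> x \<noteq> 0} \<subseteq> (+) x0 ` S"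
    proof
      fix x assume "x \<in> {x. \<phi> x \<noteq> 0}"
      then have "x - x0 \<in> S" using \<Phi>out by (auto simp: \<phi>_def)
      then have "x0 + (x - x0) \<in> (+) x0 ` S" by (rule imageI)
      then show "x \<in> (+) x0 ` S" by simp
    qed
    have cS: "compact ((+) x0 ` S)" using S by (rule compact_translation)
    have clos: "closure {x. \<phi> x \<noteq> 0} \<subseteq> (+) x0 ` S"
      using sub compact_imp_closed[OF cS] by (rule closure_minimal)
    have "compact (closure {x. \<phi> x \<noteq> 0})"
      using compact_Int_closed[OF cS closed_closure, of "{x. \<phi> x \<noteq> 0}"] clos by (simp add: Int_absorb1)
    moreover have "(+) x0 ` S \<subseteq> - K" using SK by auto
    moreover have "\<phi> differentiable_on UNIV"
      using d\<phi> by (auto simp: differentiable_on_def differentiable_def)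
    moreover have "continuous_on UNIV (partial_deriv j \<phi>)" for j
    proof -
      have "continuous_on UNIV (\<lambda>x. G (x - x0))" unfolding G_def
        by (rule continuous_on_compose2[OF continuous_test_grad[OF tst]]) (auto intro!: continuous_intros)
      then have "continuous_on UNIV (\<lambda>x. G (x - x0) $ j)" by (intro continuous_intros)
      then show ?thesis by (simp add: pd[abs_def])
    qed
    ultimately show ?thesis using clos by (auto simp: C1c_def)
  qed
  define A where "A = (\<lambda>x. bump (norm (x - proj W x) / R) powr p)"
  define b where "b = (\<lambda>z::real^'n. bump ((ln (norm z) - \<tau>) / N) powr p * norm z powr (- m))"
  define b' where "b' = (\<lambda>z::real^'n. \<bar>bump' ((ln (norm z) - \<tau>) / N)\<bar> powr p * norm z powr (- m))"
  define I where "I = (\<lambda>\<rho> x. indicator {x. norm (x - proj W x) < \<rho>} x :: real)"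
  have bz: "b z = 0" "b' z = 0" if "norm z \<notin> {s0..s1}" for z
    using bump_log_zero[of "norm z" \<tau> N] that N by (auto simp: b_def b'_def s0_def s1_def bump_zero)
  have b0: "b z \<ge> 0" "b' z \<ge> 0" for z by (simp_all add: b_def b'_def)
  have A0: "A x \<ge> 0" for x by (simp add: A_def)
  have cnp: "continuous_on X (\<lambda>x. norm (proj W x))" for X
    by (intro continuous_intros continuous_on_proj[OF B])
  have cA: "continuous_on X A" for X unfolding A_def
    using R p bump_nonneg
    by (intro continuous_on_powr' continuous_on_compose2[OF continuous_bump(1)[of UNIV]]
        continuous_intros continuous_on_proj[OF B]) auto
  have cb: "continuous_on UNIV (\<lambda>x. b (proj W x))" "continuous_on UNIV (\<lambda>x. b' (proj W x))"
  proof -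
    define U where "U = {x. proj W x \<noteq> 0}"
    have U: "open U" unfolding U_def
      by (intro open_Collect_neq continuous_on_proj[OF B] continuous_intros)
    define T where "T = {x. s0 \<le> norm (proj W x) \<and> norm (proj W x) \<le> s1}"
    have T: "closed T" "T \<subseteq> U" unfolding T_def U_def using s0
      by (auto intro!: closed_Collect_conj closed_Collect_le cnp continuous_intros)
    have cl: "continuous_on U (\<lambda>x. (ln (norm (proj W x)) - \<tau>) / N)"
      using N by (intro continuous_intros continuous_on_proj[OF B]) (auto simp: U_def)
    have cq: "continuous_on U (\<lambda>x. norm (proj W x) powr (- m))"
      by (intro continuous_intros continuous_on_proj[OF B]) (auto simp: U_def)
    have "continuous_on U (\<lambda>x. b (proj W x))" unfolding b_def using p bump_nonneg
      by (intro continuous_on_mult cq continuous_on_powr' continuous_on_const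
          continuous_on_compose2[OF continuous_bump(1)[of UNIV] cl]) auto
    from continuous_on_UNIV_extend_zero[OF this U T]
    show "continuous_on UNIV (\<lambda>x. b (proj W x))" using bz by (simp add: T_def)
    have "continuous_on U (\<lambda>x. b' (proj W x))" unfolding b'_def using p
      by (intro continuous_on_mult cq continuous_on_powr' continuous_on_const continuous_on_rabs
          continuous_on_compose2[OF continuous_bump(2)[of UNIV] cl]) auto
    from continuous_on_UNIV_extend_zero[OF this U T]
    show "continuous_on UNIV (\<lambda>x. b' (proj W x))" using bz by (simp add: T_def)
  qed
  have Aout: "A x * b (proj W x) = 0" "A x * b' (proj W x) = 0" if "x \<notin> S" for x
  proof -
    have "A x = 0 \<or> norm (proj W x) \<notin> {s0..s1}"
      using that R by (auto simp: S_def A_def not_le bump_zero)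
    then show "A x * b (proj W x) = 0" "A x * b' (proj W x) = 0" using bz by auto
  qed
  have iAb: "integrable lborel (\<lambda>x. A x * b (proj W x))"
    by (rule integrable_continuous_compact_support[OF S _ Aout(1)])
      (intro continuous_on_mult cA continuous_on_subset[OF cb(1)] subset_UNIV)
  have iAb': "integrable lborel (\<lambda>x. A x * b' (proj W x))"
    by (rule integrable_continuous_compact_support[OF S _ Aout(2)])
      (intro continuous_on_mult cA continuous_on_subset[OF cb(2)] subset_UNIV)
  have iI: "integrable lborel (\<lambda>x. I \<rho> x * b (proj W x))" if "\<rho> \<le> R" for \<rho>
  proof -
    have "integrable lborel (\<lambda>x. indicator S x *\<^sub>R b (proj W x))"
      using S continuous_on_subset[OF cb(1)] by (intro borel_integrable_compact) auto
    then show ?thesis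
    proof (rule Bochner_Integration.integrable_bound)
      show "AE x in lborel. norm (I \<rho> x * b (proj W x)) \<le> norm (indicator S x *\<^sub>R b (proj W x))"
        using bz \<open>\<rho> \<le> R\<close> by (intro AE_I2) (auto simp: I_def S_def indicator_def)
      have "open {x. norm (x - proj W x) < \<rho>}"
        by (intro open_Collect_less continuous_intros continuous_on_proj[OF B])
      then show "(\<lambda>x. I \<rho> x * b (proj W x)) \<in> borel_measurable lborel"
        unfolding I_def using cb(1)
        by (intro borel_measurable_times borel_measurable_indicator)
          (auto intro: borel_measurable_continuous_onI)
    qed
  qed
  define D where "D = (\<integral>x. A x * b (proj W x) \<partial>lborel)"
  have Dpos: "D > 0"
    unfolding D_def
  proof (rule integral_pos_of_pos_on_open[OF iAb])
    define U where "U = {x. norm (x - proj W x) < R \<and> s0 < norm (proj W x) \<and> norm (proj W x) < s1}"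
    show "open U" unfolding U_def
      by (intro open_Collect_conj open_Collect_less continuous_intros continuous_on_proj[OF B])
    obtain v where v: "v \<in> W" using Wne by blast
    have "norm v = 1" using inner_W[OF B v v] by (simp add: norm_eq_1)
    moreover have "proj W (exp \<tau> *\<^sub>R v) = exp \<tau> *\<^sub>R v"
      using linear_scale[OF linear_proj[OF B]] proj_unit[OF B v] by simp
    ultimately have "exp \<tau> *\<^sub>R v \<in> U" using R N by (simp add: U_def s0_def s1_def)
    then show "U \<noteq> {}" by blast
    show "A x * b (proj W x) > 0" if "x \<in> U" for x
    proof -
      have n: "norm (x - proj W x) < R" "exp (\<tau> - N) < norm (proj W x)" "norm (proj W x) < exp (\<tau> + N)"
        using that by (auto simp: U_def s0_def s1_def)
      have n0: "norm (proj W x) > 0" using n(2) exp_gt_zero[of "\<tau> - N"] by linarith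
      have "\<tau> - N < ln (norm (proj W x))" "ln (norm (proj W x)) < \<tau> + N"
        using n n0 by (metis exp_less_cancel_iff exp_ln, metis exp_less_cancel_iff exp_ln)
      then have "\<bar>(ln (norm (proj W x)) - \<tau>) / N\<bar> < 1" using N by (simp add: abs_less_iff field_simps)
      then have "b (proj W x) > 0" using bump_pos n0 by (simp add: b_def less_imp_neq[THEN not_sym])
      moreover have "\<bar>norm (x - proj W x) / R\<bar> < 1" using n(1) R by simp
      then have "A x > 0" using bump_pos by (simp add: A_def less_imp_neq[THEN not_sym])
      ultimately show ?thesis by simp
    qed
  qed (simp add: A0 b0)
  have E: "(\<integral>x. A x * b' (proj W x) \<partial>lborel) = \<kappa> * D"
  proof -
    define h where "h = (\<lambda>t. \<bar>bump' ((t - \<tau>) / N)\<bar> powr p - \<kappa> * bump ((t - \<tau>) / N) powr p)"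
    define H' where "H' = (\<lambda>t. N * H ((t - \<tau>) / N))"
    have far: "\<bar>(t - \<tau>) / N\<bar> \<ge> 1" if "t \<notin> {\<tau> - N..\<tau> + N}" for t
    proof -
      have "\<bar>t - \<tau>\<bar> \<ge> N" using that by auto
      then show ?thesis using N by (simp add: pos_le_divide_eq)
    qed
    have "(\<integral>x. A x * (h (ln (norm (proj W x))) * norm (proj W x) powr (- real (card W))) \<partial>lborel) = 0"
    proof (rule log_radial_integral_zero[OF B cA, where \<rho>=R and H=H' and ?t0.0="\<tau> - N" and ?t1.0="\<tau> + N"])
      show "A (x + t *\<^sub>R u) = A x" if "u \<in> W" for x u t
        by (simp add: A_def proj_shift[OF B that])
      show "A x = 0" if "R < norm (x - proj W x)" for x
        using that R by (simp add: A_def bump_zero)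
      show "(H' has_real_derivative h t) (at t)" for t
      proof -
        have "((\<lambda>t. (t - \<tau>) / N) has_real_derivative 1 / N) (at t)"
          using N by (auto intro!: derivative_eq_intros)
        from DERIV_cmult[OF DERIV_chain2[OF H(1) this], of N]
        show ?thesis using N by (simp add: H'_def h_def)
      qed
      have c: "continuous_on UNIV (\<lambda>t. (t - \<tau>) / N)" using N by (intro continuous_intros) auto
      show "continuous_on UNIV h" unfolding h_def using p bump_nonneg
        by (intro continuous_on_diff continuous_on_mult continuous_on_powr' continuous_on_const continuous_on_rabs
            continuous_on_compose2[OF continuous_bump(1)[of UNIV] c]
            continuous_on_compose2[OF continuous_bump(2)[of UNIV] c]) auto
      show "H' t = 0" "h t = 0" if "t \<notin> {\<tau> - N..\<tau> + N}" for t
        using far[OF that] H(2) p by (simp_all add: H'_def h_def bump_zero)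
    qed
    moreover have "A x * (h (ln (norm (proj W x))) * norm (proj W x) powr (- real (card W)))
        = A x * b' (proj W x) - \<kappa> * (A x * b (proj W x))" for x
      by (simp add: h_def b_def b'_def m_def algebra_simps)
    ultimately show ?thesis using iAb iAb' by (simp add: D_def)
  qed
  have T: "(\<integral>x. I R x * b (proj W x) \<partial>lborel) \<le> M * ((16 / 9) powr p * D)"
  proof -
    have "(\<integral>x. I R x * b (proj W x) \<partial>lborel) \<le> M * (\<integral>x. I (R / 2) x * b (proj W x) \<partial>lborel)"
      using dbl[unfolded slab_doubling_def, THEN conjunct2, rule_format, of "R / 2" b s1] R cb(1) b0 bz
      by (simp add: I_def)
    also have "\<dots> \<le> M * (\<integral>x. (16 / 9) powr p * (A x * b (proj W x)) \<partial>lborel)"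
    proof (intro mult_left_mono integral_mono iI integrable_mult_right iAb)
      show "I (R / 2) x * b (proj W x) \<le> (16 / 9) powr p * (A x * b (proj W x))" for x
      proof (cases "norm (x - proj W x) < R / 2")
        case True
        \<comment> \<open>The factor \<open>16/9\<close> is the inverse of the cut-off at half its radius.\<close>
        then have "bump (norm (x - proj W x) / R) \<ge> 9 / 16"
          using R by (intro bump_ge) (simp add: field_simps)
        then have "(9 / 16) powr p \<le> A x" unfolding A_def using p by (intro powr_mono2) auto
        then have "(16 / 9) powr p * (9 / 16) powr p \<le> (16 / 9) powr p * A x"
          by (intro mult_left_mono) auto
        moreover have "(16 / 9 :: real) powr p * (9 / 16) powr p = 1"
          by (simp add: powr_mult[symmetric])
        ultimately have "1 * b (proj W x) \<le> ((16 / 9) powr p * A x) * b (proj W x)"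
          using b0 by (intro mult_right_mono) auto
        then show ?thesis using True by (simp add: I_def mult_ac)
      qed (use A0 b0 in \<open>simp add: I_def\<close>)
    qed (use M R in auto)
    finally show ?thesis by (simp add: D_def)
  qed
  have inf: "infdist (x0 + v) K = norm (proj W v)" if "norm (v - proj W v) \<le> R" for v
    by (rule infdist_eq_norm_proj[OF B x0 orth ball that])
  have den: "(LINT x:-K|lborel. w x * infdist x K powr (-p) * \<bar>\<phi> x\<bar> powr p) = D"
  proof -
    define g where "g = (\<lambda>v. A v * b (proj W v))"
    have gm: "g \<in> borel_measurable borel" using iAb by (simp add: g_def integrable_iff_bounded)
    have "(LINT x:-K|lborel. w x * infdist x K powr (-p) * \<bar>\<phi> x\<bar> powr p) = (\<integral>x. g (x + - x0) \<partial>lborel)"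
      unfolding set_lebesgue_integral_def
    proof (rule Bochner_Integration.integral_cong[OF refl])
      fix x
      define v where "v = x - x0"
      have x: "x = x0 + v" by (simp add: v_def)
      show "indicator (- K) x *\<^sub>R (w x * infdist x K powr - p * \<bar>\<phi> x\<bar> powr p) = g (x + - x0)"
      proof (cases "v \<in> S")
        case True
        then have vR: "norm (v - proj W v) \<le> R" and n0: "norm (proj W v) > 0"
          using s0 by (auto simp: S_def)
        define s where "s = norm (proj W v)"
        have d: "infdist x K = s" using inf[OF vR] by (simp add: x s_def)
        have "x \<notin> K" using SK True by (simp add: v_def)
        moreover have "hardy_weight \<delta> \<delta>' s * s powr - p * \<bar>\<Phi> v\<bar> powr p = g v"
        proof -
          define t where "t = bump (norm (v - proj W v) / R) * bump ((ln s - \<tau>) / N)"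
          have t0: "t \<ge> 0" by (simp add: t_def bump_nonneg)
          have s: "s > 0" using n0 by (simp add: s_def)
          define V where "V = (hardy_weight \<delta> \<delta>' s * s powr (m - p)) powr (- 1 / p) / s"
          have V: "V \<ge> 0" using s by (simp add: V_def)
          have "(hardy_weight \<delta> \<delta>' s * s powr (m - p)) powr (- 1 / p) = V * s"
            using s by (simp add: V_def)
          then have "\<bar>\<Phi> v\<bar> = V * t * s"
            using s V by (simp add: \<Phi>_def test_fn_def f_def profile_def s_def[symmetric] t_def abs_mult bump_nonneg mult_ac)
          then have "\<bar>\<Phi> v\<bar> powr p = (V * t) powr p * s powr p"
            using s t0 V by (simp add: powr_mult)
          moreover have "s powr - p * s powr p = 1" using s by (simp add: powr_add[symmetric])
          ultimately have "hardy_weight \<delta> \<delta>' s * s powr - p * \<bar>\<Phi> v\<bar> powr p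
              = hardy_weight \<delta> \<delta>' s * (V * t) powr p"
            by (simp add: mult_ac)
          also have "\<dots> = s powr (- m) * t powr p"
            unfolding V_def by (rule weight_profile[OF s p t0])
          also have "\<dots> = g v"
            by (simp add: g_def A_def b_def s_def[symmetric] t_def powr_mult bump_nonneg)
          finally show ?thesis .
        qed
        ultimately show ?thesis by (simp add: w_def d \<phi>_def v_def[symmetric])
      next
        case False
        then show ?thesis using \<Phi>out[OF False] Aout(1)[OF False] by (simp add: \<phi>_def v_def[symmetric] g_def)
      qed
    qed
    also have "\<dots> = (\<integral>x. g x \<partial>lborel)" by (rule lborel_integral_translation[OF gm])
    finally show ?thesis by (simp add: g_def D_def)
  qed
  define q where "q = (4 * exp (\<tau> + N) / R) powr p"
  define Q where "Q = (\<lambda>v. c1 * (A v * b (proj W v)) + c2 * ((1 / N) powr p * (A v * b' (proj W v)) + q * (I R v * b (proj W v))))"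
  have a: "a > 0" using pos p by (simp add: a_def)
  have c: "c1 \<ge> 0" "c2 \<ge> 0" by (simp_all add: c1_def c2_def)
  have pw: "hardy_weight \<delta> \<delta>' (norm (proj W v)) * norm (G v) powr p \<le> Q v" if "v \<in> S" for v
  proof -
    define s where "s = norm (proj W v)"
    define t where "t = (ln s - \<tau>) / N"
    define A1 where "A1 = bump (norm (v - proj W v) / R)"
    define V where "V = (hardy_weight \<delta> \<delta>' s * s powr (m - p)) powr (- 1 / p) / s"
    define \<alpha> where "\<alpha> = (hardy_log_deriv \<delta> \<delta>' s + (m - p)) / p"
    have sS: "s0 \<le> s" "s \<le> s1" using that by (auto simp: S_def s_def)
    have s: "s > 0" using s0 sS by linarith
    have A1: "A1 \<ge> 0" by (simp add: A1_def bump_nonneg)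
    have V: "V \<ge> 0" using s by (simp add: V_def)
    have lns: "\<bar>ln s - \<tau>\<bar> \<le> N"
    proof -
      have "\<tau> - N \<le> ln s" "ln s \<le> \<tau> + N"
        using sS s unfolding s0_def s1_def by (metis exp_le_cancel_iff exp_ln, metis exp_le_cancel_iff exp_ln)
      then show ?thesis by (simp add: abs_le_iff)
    qed
    have \<alpha>: "0 \<le> \<alpha>" "\<alpha> \<le> a + u"
    proof -
      have "hardy_log_deriv \<delta> \<delta>' s \<le> min \<delta> \<delta>' + p * u" using \<tau>[OF lns] s by simp
      then have "\<alpha> \<le> (min \<delta> \<delta>' + p * u + (m - p)) / p"
        unfolding \<alpha>_def using p by (intro divide_right_mono) auto
      also have "\<dots> = a + u" using p by (simp add: a_def m_def field_simps)
      finally show "\<alpha> \<le> a + u" .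
      have "0 \<le> (min \<delta> \<delta>' + (m - p)) / p" using pos p by (simp add: m_def)
      also have "\<dots> \<le> \<alpha>" unfolding \<alpha>_def
        using p hardy_log_deriv_ge[OF s, of \<delta> \<delta>'] by (intro divide_right_mono) auto
      finally show "0 \<le> \<alpha>" .
    qed
    define X1 where "X1 = A1 * ((a + u) * bump t)"
    define X2 where "X2 = A1 * (\<bar>bump' t\<bar> / N)"
    define X3 where "X3 = 4 * s1 / R * I R v * bump t"
    have X: "X1 \<ge> 0" "X2 \<ge> 0" "X3 \<ge> 0"
      using A1 a u N R by (auto simp: X1_def X2_def X3_def bump_nonneg s1_def I_def)
    have f'e: "f' s = (bump' t / N - \<alpha> * bump t) * V"
      by (simp add: f'_def profile'_def t_def V_def \<alpha>_def)
    have fe: "f s = bump t * (V * s)"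
      using s by (simp add: f_def profile_def t_def V_def)
    have "\<bar>bump' t / N - \<alpha> * bump t\<bar> \<le> \<bar>bump' t / N\<bar> + \<bar>\<alpha> * bump t\<bar>" by (rule abs_triangle_ineq4)
    also have "\<dots> = \<bar>bump' t\<bar> / N + \<alpha> * bump t"
      using N \<alpha>(1) by (simp add: abs_mult bump_nonneg)
    also have "\<dots> \<le> \<bar>bump' t\<bar> / N + (a + u) * bump t"
      using \<alpha>(2) by (intro add_left_mono mult_right_mono bump_nonneg)
    finally have "A1 * \<bar>f' s\<bar> \<le> A1 * ((\<bar>bump' t\<bar> / N + (a + u) * bump t) * V)"
      using V A1 by (intro mult_left_mono) (auto simp: f'e abs_mult intro!: mult_right_mono)
    also have "\<dots> = V * (X1 + X2)" by (simp add: X1_def X2_def algebra_simps)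
    finally have 1: "A1 * \<bar>f' s\<bar> \<le> V * (X1 + X2)" .
    have "4 / R * I R v * \<bar>f s\<bar> = 4 / R * I R v * (bump t * (V * s))"
      using V s by (simp add: fe abs_mult bump_nonneg)
    also have "\<dots> \<le> 4 / R * I R v * (bump t * (V * s1))"
      using sS V R by (intro mult_left_mono) (auto simp: I_def bump_nonneg)
    also have "\<dots> = V * X3" by (simp add: X3_def)
    finally have 2: "4 / R * I R v * \<bar>f s\<bar> \<le> V * X3" .
    have "norm (G v) \<le> A1 * \<bar>f' s\<bar> + 4 / R * I R v * \<bar>f s\<bar>"
      unfolding G_def A1_def s_def I_def by (rule norm_test_grad_le[OF tst])
    also have "\<dots> \<le> V * (X1 + (X2 + X3))" using 1 2 by (simp add: algebra_simps)
    finally have "norm (G v) powr p \<le> (V * (X1 + (X2 + X3))) powr p"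
      using p by (intro powr_mono2) auto
    then have "hardy_weight \<delta> \<delta>' s * norm (G v) powr p \<le> hardy_weight \<delta> \<delta>' s * (V * (X1 + (X2 + X3))) powr p"
      using hardy_weight_pos[OF s, of \<delta> \<delta>'] by (intro mult_left_mono) auto
    also have "\<dots> = s powr (- m) * (X1 + (X2 + X3)) powr p"
      unfolding V_def using X by (intro weight_profile[OF s p]) auto
    also have "\<dots> \<le> s powr (- m) * ((1 - u) powr (1 - p) * X1 powr p
        + u powr (1 - p) * ((1 / 2) powr (1 - p) * X2 powr p + (1 / 2) powr (1 - p) * X3 powr p))"
    proof (intro mult_left_mono)
      have "(X1 + (X2 + X3)) powr p \<le> (1 - u) powr (1 - p) * X1 powr p + u powr (1 - p) * (X2 + X3) powr p"
        using powr_add_le_convex[OF p X(1), of "X2 + X3" "1 - u"] X u by simp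
      also have "\<dots> \<le> (1 - u) powr (1 - p) * X1 powr p
        + u powr (1 - p) * ((1 / 2) powr (1 - p) * X2 powr p + (1 / 2) powr (1 - p) * X3 powr p)"
        using powr_add_le_convex[OF p X(2,3), of "1 / 2"] by (intro add_left_mono mult_left_mono) auto
      finally show "(X1 + (X2 + X3)) powr p \<le> (1 - u) powr (1 - p) * X1 powr p
        + u powr (1 - p) * ((1 / 2) powr (1 - p) * X2 powr p + (1 / 2) powr (1 - p) * X3 powr p)" .
    qed simp
    also have "\<dots> = Q v"
    proof -
      have x1: "X1 powr p = (a + u) powr p * (A v * bump t powr p)"
        using A1 a u by (simp add: X1_def powr_mult bump_nonneg A_def A1_def[symmetric] mult_ac)
      have x2: "X2 powr p = (1 / N) powr p * (A v * \<bar>bump' t\<bar> powr p)"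
        using A1 N by (simp add: X2_def powr_mult powr_divide A_def A1_def[symmetric] mult_ac)
      have x3: "X3 powr p = q * (I R v * bump t powr p)"
      proof -
        have "(4 * s1 / R * bump t) powr p = (4 * s1 / R) powr p * bump t powr p"
          by (rule powr_mult)
        then show ?thesis by (simp add: X3_def q_def s1_def I_def indicator_def)
      qed
      show ?thesis
        by (simp add: Q_def c1_def c2_def x1 x2 x3 b_def b'_def s_def[symmetric] t_def[symmetric] algebra_simps)
    qed
    finally show ?thesis by (simp add: s_def)
  qed
  have iQ: "integrable lborel Q"
    unfolding Q_def using iAb iAb' iI[of R] by simp
  have Q0: "Q v \<ge> 0" for v
    unfolding Q_def using c A0 b0 by (intro add_nonneg_nonneg mult_nonneg_nonneg) (auto simp: q_def I_def)
  have "(LINT x:-K|lborel. w x * grad_norm \<phi> x powr p) \<le> (\<integral>x. Q (x + - x0) \<partial>lborel)"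
    unfolding set_lebesgue_integral_def
  proof (rule integral_mono')
    have "integrable (distr lborel borel ((+) (- x0))) Q" by (simp only: lborel_distr_plus iQ)
    then have "integrable lborel (\<lambda>x. Q (- x0 + x))" by (rule integrable_distr[rotated]) simp
    then show "integrable lborel (\<lambda>x. Q (x + - x0))" by (simp add: add.commute)
    fix x
    define v where "v = x - x0"
    have x: "x = x0 + v" by (simp add: v_def)
    show "0 \<le> Q (x + - x0)" by (rule Q0)
    show "indicator (- K) x *\<^sub>R (w x * grad_norm \<phi> x powr p) \<le> Q (x + - x0)"
    proof (cases "v \<in> S")
      case True
      then have vR: "norm (v - proj W v) \<le> R" by (simp add: S_def)
      have "x \<notin> K" using SK True by (simp add: v_def)
      then show ?thesis
        using pw[OF True] inf[OF vR] by (simp add: w_def gn v_def[symmetric] x[symmetric])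
    next
      case False
      then show ?thesis using Q0[of v] by (simp add: gn v_def[symmetric] Gout)
    qed
  qed
  also have "\<dots> = (\<integral>x. Q x \<partial>lborel)"
    using iQ by (intro lborel_integral_translation) (simp add: integrable_iff_bounded)
  also have "\<dots> = c1 * D + c2 * ((1 / N) powr p * (\<kappa> * D) + q * (\<integral>x. I R x * b (proj W x) \<partial>lborel))"
    unfolding Q_def using iAb iAb' iI[of R] by (simp add: D_def[symmetric] E)
  also have "\<dots> \<le> c1 * D + c2 * ((1 / N) powr p * (\<kappa> * D) + q * (M * ((16 / 9) powr p * D)))"
    using T c by (intro add_left_mono mult_left_mono) (auto simp: q_def)
  also have "\<dots> = (c1 + c2 * (\<kappa> * (1 / N) powr p + q * (M * (16 / 9) powr p))) * D"
    by (simp add: algebra_simps)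
  finally have num: "(LINT x:-K|lborel. w x * grad_norm \<phi> x powr p)
      \<le> (c1 + c2 * (\<kappa> * (1 / N) powr p + q * (M * (16 / 9) powr p))) * D" .
  show ?thesis
  proof (intro bexI[of _ \<phi>] conjI)
    show "\<phi> \<noteq> (\<lambda>x. 0)"
    proof
      assume "\<phi> = (\<lambda>x. 0)"
      then have "D = 0" unfolding den[symmetric] using p by (simp add: set_lebesgue_integral_def)
      with Dpos show False by simp
    qed
    show "(LINT x:-K|lborel. w x * infdist x K powr (-p) * \<bar>\<phi> x\<bar> powr p) > 0"
      unfolding den by (rule Dpos)
    show "(LINT x:-K|lborel. w x * grad_norm \<phi> x powr p)
     \<le> (c1 + c2 * (\<kappa> * (1 / N) powr p + (4 * exp (\<tau> + N) / R) powr p * (M * (16 / 9) powr p)))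
        * (LINT x:-K|lborel. w x * infdist x K powr (-p) * \<bar>\<phi> x\<bar> powr p)"
      unfolding den using num by (simp only: q_def)
  qed (rule mem)
qed

section \<open>The optimal constant\<close>

text \<open>
The frame of the affine set is completed to an orthonormal basis \<open>B\<close> of the whole space; \<open>W\<close> is the
added part, and the kernel of \<open>proj W\<close> is the direction space of the affine set.
\<close>

lemma frame_orthogonal_complement:
  fixes e :: "nat \<Rightarrow> 'a::euclidean_space"
  assumes fr: "is_frame k a e A"
  obtains B W where "orthonormal_basis B" "W \<subseteq> B" "k + card W = DIM('a)"
    "\<And>u y z. u \<in> W \<Longrightarrow> y \<in> A \<Longrightarrow> z \<in> A \<Longrightarrow> u \<bullet> (y - z) = 0"
    "\<And>x v. x \<in> A \<Longrightarrow> proj W v = 0 \<Longrightarrow> x + v \<in> A"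
proof -
  have on: "e i \<bullet> e j = (if i = j then 1 else 0)" if "i < k" "j < k" for i j
    using fr that by (simp add: is_frame_def)
  have inj: "inj_on e {..<k}"
  proof (rule inj_onI)
    fix i j assume "i \<in> {..<k}" "j \<in> {..<k}" "e i = e j"
    then show "i = j" using on[of i j] on[of i i] by (auto split: if_splits)
  qed
  define E where "E = e ` {..<k}"
  have E: "finite E" "card E = k" using inj by (auto simp: E_def card_image)
  have Eon: "u \<bullet> v = (if u = v then 1 else 0)" if "u \<in> E" "v \<in> E" for u v
    using that on inj by (auto simp: E_def inj_on_eq_iff)
  have "pairwise orthogonal E" using Eon by (auto simp: pairwise_def orthogonal_def)
  moreover have "0 \<notin> E" using Eon[of 0 0] by auto
  ultimately have indE: "independent E" by (rule pairwise_orthogonal_independent)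
  define P where "P = {y \<in> UNIV. \<forall>x \<in> span E. orthogonal x y}"
  have subP: "subspace P"
    unfolding P_def by (auto simp: subspace_def orthogonal_def inner_add_right)
  have dimP: "dim P + k = DIM('a)"
  proof -
    have "dim P + dim (span E) = dim (UNIV :: 'a set)"
      unfolding P_def by (rule dim_subspace_orthogonal_to_vectors) (auto simp: subspace_span)
    then show ?thesis using dim_eq_card_independent[OF indE] E by simp
  qed
  obtain W where W: "W \<subseteq> P" "pairwise orthogonal W" "\<And>x. x \<in> W \<Longrightarrow> norm x = 1"
      "independent W" "card W = dim P" "span W = P"
    by (rule orthonormal_basis_subspace[OF subP], rule that)
  have finW: "finite W" using W(4) by (rule independent_imp_finite)
  have WE: "w \<bullet> x = 0" "x \<bullet> w = 0" if "w \<in> W" "x \<in> span E" for w x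
    using W(1) that by (auto simp: P_def orthogonal_def inner_commute)
  have Won: "u \<bullet> v = (if u = v then 1 else 0)" if "u \<in> W" "v \<in> W" for u v
    using W(2,3) that by (auto simp: pairwise_def orthogonal_def norm_eq_1)
  define B where "B = E \<union> W"
  have Bon: "u \<bullet> v = (if u = v then 1 else 0)" if "u \<in> B" "v \<in> B" for u v
  proof -
    have "E \<subseteq> span E" by (rule span_superset)
    have "E \<inter> W = {}" using WE(1) Eon \<open>E \<subseteq> span E\<close> Won by (metis disjoint_iff one_neq_zero subsetD)
    then show ?thesis using that Eon Won WE \<open>E \<subseteq> span E\<close> unfolding B_def
      by (metis UnE disjoint_iff subsetD)
  qed
  have finB: "finite B" using E finW by (simp add: B_def)
  have pB: "pairwise orthogonal B" using Bon by (auto simp: pairwise_def orthogonal_def)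
  have "0 \<notin> B" using Bon[of 0 0] by auto
  then have indB: "independent B" using pB by (rule pairwise_orthogonal_independent[rotated])
  have "E \<inter> W = {}"
  proof (rule ccontr)
    assume "E \<inter> W \<noteq> {}"
    then obtain u where u: "u \<in> E" "u \<in> W" by blast
    then have "u \<bullet> u = 0" using WE(1)[OF u(2) span_base[OF u(1)]] by simp
    then show False using Eon[OF u(1,1)] by simp
  qed
  then have "card B = DIM('a)" using E finW W(5) dimP by (simp add: B_def card_Un_disjoint)
  then have "UNIV \<subseteq> span B" by (intro card_ge_dim_independent indB) auto
  have nB: "norm u = 1" if "u \<in> B" for u using Bon[OF that that] by (simp add: norm_eq_1)
  have exp: "x = (\<Sum>u\<in>B. (x \<bullet> u) *\<^sub>R u)" for x
  proof -
    have "x \<in> span B" using \<open>UNIV \<subseteq> span B\<close> by blast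
    from orthonormal_basis_expand[OF pB nB this finB] show ?thesis by simp
  qed
  have ONB: "orthonormal_basis B"
    unfolding orthonormal_basis_def using finB Bon exp by blast
  have frame: "A = frame_map k a e ` ({..<k} \<rightarrow>\<^sub>E UNIV)" using fr by (simp add: is_frame_def)
  have diff: "u \<bullet> (y - z) = 0" if "u \<in> W" "y \<in> A" "z \<in> A" for u y z
  proof -
    obtain s t where "y = a + (\<Sum>i<k. s i *\<^sub>R e i)" "z = a + (\<Sum>i<k. t i *\<^sub>R e i)"
      using \<open>y \<in> A\<close> \<open>z \<in> A\<close> unfolding frame by (auto simp: frame_map_def)
    then have "y - z = (\<Sum>i<k. (s i - t i) *\<^sub>R e i)"
      by (simp add: scaleR_diff_left sum_subtractf)
    also have "\<dots> \<in> span E"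
      by (intro span_sum span_scale span_base) (auto simp: E_def)
    finally show ?thesis using WE \<open>u \<in> W\<close> by blast
  qed
  have shift: "x + v \<in> A" if x: "x \<in> A" and v: "proj W v = 0" for x v
  proof -
    have WB: "W \<subseteq> B" by (simp add: B_def)
    obtain s where s: "x = a + (\<Sum>i<k. s i *\<^sub>R e i)"
      using x unfolding frame by (auto simp: frame_map_def)
    have "v = (\<Sum>u\<in>E. (v \<bullet> u) *\<^sub>R u) + proj W v"
      using exp[of v] \<open>E \<inter> W = {}\<close> E finW by (simp add: B_def sum.union_disjoint proj_def)
    then have "v = (\<Sum>i<k. (v \<bullet> e i) *\<^sub>R e i)"
      using v inj by (simp add: E_def sum.reindex)
    then have "x + v = a + (\<Sum>i<k. (s i + v \<bullet> e i) *\<^sub>R e i)"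
      using s by (simp add: scaleR_add_left sum.distrib)
    also have "\<dots> = frame_map k a e (restrict (\<lambda>i. s i + v \<bullet> e i) {..<k})"
      by (simp add: frame_map_def)
    also have "\<dots> \<in> A" unfolding frame by (rule imageI) (simp add: PiE_iff extensional_def)
    finally show ?thesis .
  qed
  show thesis
    by (rule that[OF ONB _ _ diff shift]) (use W(5) dimP in \<open>auto simp: B_def\<close>)
qed

text \<open>
Positivity matters because a quotient with denominator zero would count as zero in the infimum.
\<close>

lemma hardy_denominator_pos:
  fixes K :: "(real^'n::finite) set"
  assumes K: "closed K" "K \<noteq> {}" and p: "p \<ge> 1" and \<phi>: "\<phi> \<in> C1c (- K)" "\<phi> \<noteq> (\<lambda>x. 0)"
  shows "(LINT x:-K|lborel. hardy_weight \<delta> \<delta>' (infdist x K) * infdist x K powr (-p) * \<bar>\<phi> x\<bar> powr p) > 0"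
proof -
  define S where "S = closure {x. \<phi> x \<noteq> 0}"
  have S: "compact S" "S \<subseteq> - K" using \<phi>(1) by (auto simp: C1c_def S_def)
  have SU: "{x. \<phi> x \<noteq> 0} \<subseteq> S" unfolding S_def by (rule closure_subset)
  have c\<phi>: "continuous_on X \<phi>" for X
  proof -
    have "\<phi> differentiable_on UNIV" using \<phi>(1) by (simp add: C1c_def)
    then show ?thesis by (meson differentiable_imp_continuous_on continuous_on_subset subset_UNIV)
  qed
  have d: "infdist x K > 0" if "x \<in> S" for x
    using infdist_pos_not_in_closed[OF K] that S(2) by blast
  define g where "g = (\<lambda>x. hardy_weight \<delta> \<delta>' (infdist x K) * infdist x K powr (-p) * \<bar>\<phi> x\<bar> powr p)"
  have g0: "g x = 0" if "x \<notin> S" for x using that SU by (auto simp: g_def)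
  have "(\<integral>x. g x \<partial>lborel) > 0"
  proof (rule integral_pos_of_pos_on_open)
    have cd: "continuous_on S (\<lambda>x. infdist x K)" by (intro continuous_intros)
    have "continuous_on S (\<lambda>x. hardy_weight \<delta> \<delta>' (infdist x K) * infdist x K powr (-p))"
      by (rule continuous_on_compose2[OF continuous_on_pos_hardy cd]) (use d in auto)
    moreover have "continuous_on S (\<lambda>x. \<bar>\<phi> x\<bar> powr p)"
      using p by (intro continuous_on_powr' continuous_on_const continuous_on_rabs c\<phi>) auto
    ultimately have "continuous_on S g"
      unfolding g_def by (rule continuous_on_mult)
    then show "integrable lborel g"
      by (rule integrable_continuous_compact_support[OF S(1) _ g0])
    show "g x \<ge> 0" for x by (simp add: g_def hardy_weight_def)
    show "open {x. \<phi> x \<noteq> 0}" by (intro open_Collect_neq c\<phi> continuous_on_const)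
    show "{x. \<phi> x \<noteq> 0} \<noteq> {}" using \<phi>(2) by auto
    show "g x > 0" if "x \<in> {x. \<phi> x \<noteq> 0}" for x
    proof -
      have "infdist x K > 0" using d that SU by blast
      then show ?thesis using that by (simp add: g_def hardy_weight_pos)
    qed
  qed
  also have "(\<integral>x. g x \<partial>lborel) = (LINT x:-K|lborel. g x)"
    unfolding set_lebesgue_integral_def
  proof (intro Bochner_Integration.integral_cong refl)
    show "g x = indicator (- K) x *\<^sub>R g x" for x
      using g0[of x] S(2) by (cases "x \<in> S") (auto simp: indicator_def)
  qed
  finally show ?thesis by (simp add: g_def)
qed

lemma tendsto_zero_pick_positive:
  fixes g :: "real \<Rightarrow> real"
  assumes "(g \<longlongrightarrow> 0) at_top" "\<epsilon> > 0"
  obtains x where "x > 0" "g x < \<epsilon>"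
proof -
  have "eventually (\<lambda>x. g x < \<epsilon> \<and> x > 0) at_top"
    using order_tendstoD(2)[OF assms] eventually_gt_at_top[of 0] by (rule eventually_conj)
  then show thesis using that eventually_happens'[OF trivial_limit_at_top_linorder] by blast
qed

theorem theorem4p5:
  fixes K \<Omega> :: "(real^'n) set" and k :: nat and \<delta> \<delta>' p :: real
    and a :: "real^'n" and e :: "nat \<Rightarrow> real^'n"
  assumes "closed K" and "convex K"
    and "aff_dim K = int k" and "1 \<le> k" and "k \<le> CARD('n) - 1"
    and "is_frame k a e (affine hull K)"
    and "dim_at_infinity k a e K = ereal (real k)"
    and "\<Omega> = - K"
    and "\<delta> \<ge> 0" and "\<delta>' \<ge> 0"
    and "p \<ge> 1"
    and "real CARD('n) - real k + min \<delta> \<delta>' - p > 0"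
  shows "hardy_constant p (hardy_weight \<delta> \<delta>' \<circ> bdry_dist \<Omega>) \<Omega>
           = ((real CARD('n) - real k + min \<delta> \<delta>' - p) / p) powr p"
proof -
  note K = assms(1,2) and p = assms(11)
  have Kne: "K \<noteq> {}" using assms(3,4) by auto
  obtain B W where B: "orthonormal_basis B" "W \<subseteq> B" and cW: "k + card W = DIM(real^'n)"
    and orthA: "\<And>u y z. u \<in> W \<Longrightarrow> y \<in> affine hull K \<Longrightarrow> z \<in> affine hull K \<Longrightarrow> u \<bullet> (y - z) = 0"
    and shift: "\<And>x v. x \<in> affine hull K \<Longrightarrow> proj W v = 0 \<Longrightarrow> x + v \<in> affine hull K"
    by (rule frame_orthogonal_complement[OF assms(6)], rule that)
  have orth: "\<And>u y z. u \<in> W \<Longrightarrow> y \<in> K \<Longrightarrow> z \<in> K \<Longrightarrow> u \<bullet> (y - z) = 0"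
    using orthA hull_subset[of K affine] by blast
  have cardW: "real (card W) = real CARD('n) - real k" using cW by simp
  have "card W \<noteq> 0" using cW assms(4,5) by simp
  then have Wne: "W \<noteq> {}" by auto
  have pos: "card W + min \<delta> \<delta>' - p > 0" using assms(12) by (simp add: cardW)
  define \<alpha> where "\<alpha> = (card W + min \<delta> \<delta>' - p) / p"
  have \<alpha>: "\<alpha> > 0" using pos p by (simp add: \<alpha>_def)
  define w where "w = (\<lambda>x. hardy_weight \<delta> \<delta>' (infdist x K))"
  define num where "num = (\<lambda>\<phi>. LINT x:-K|lborel. w x * grad_norm \<phi> x powr p)"
  define den where "den = (\<lambda>\<phi>. LINT x:-K|lborel. w x * infdist x K powr (-p) * \<bar>\<phi> x\<bar> powr p)"
  define Q where "Q = {num \<phi> / den \<phi> | \<phi>. \<phi> \<in> C1c (- K) \<and> \<phi> \<noteq> (\<lambda>x. 0)}"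
  have const: "hardy_constant p (hardy_weight \<delta> \<delta>' \<circ> bdry_dist \<Omega>) \<Omega> = Inf Q"
    by (simp add: hardy_constant_def Q_def num_def den_def w_def bdry_dist_def assms(8))
  have lower: "\<alpha> powr p \<le> q" if q: "q \<in> Q" for q
  proof -
    obtain \<phi> where \<phi>: "q = num \<phi> / den \<phi>" "\<phi> \<in> C1c (- K)" "\<phi> \<noteq> (\<lambda>x. 0)"
      using q unfolding Q_def by blast
    have "den \<phi> > 0"
      unfolding den_def w_def by (rule hardy_denominator_pos[OF K(1) Kne p \<phi>(2,3)])
    moreover have "\<alpha> powr p * den \<phi> \<le> num \<phi>"
      unfolding den_def num_def w_def \<alpha>_def
      by (rule hardy_inequality_convex[OF K Kne B orth p pos \<phi>(2)])
    ultimately show ?thesis by (simp add: \<phi>(1) pos_le_divide_eq)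
  qed
  obtain \<kappa> H where H:
    "\<And>t. (H has_real_derivative (\<bar>bump' t\<bar> powr p - \<kappa> * bump t powr p)) (at t)"
    "\<And>t. \<bar>t\<bar> \<ge> 1 \<Longrightarrow> H t = 0"
    by (rule bump_antiderivative[OF p], rule that)
  obtain M where M: "slab_doubling W M"
    using slab_doubling_exists[OF B] by blast
  have upper: "\<exists>q\<in>Q. q \<le> \<alpha> powr p + \<epsilon>" if \<epsilon>: "\<epsilon> > 0" for \<epsilon>
  proof -
    have "((\<lambda>u. (1 - u) powr (1 - p) * (\<alpha> + u) powr p) \<longlongrightarrow> (1 - 0) powr (1 - p) * (\<alpha> + 0) powr p) (at_right 0)"
      using \<alpha> by (intro tendsto_intros) auto
    then have "eventually (\<lambda>u. (1 - u) powr (1 - p) * (\<alpha> + u) powr p < \<alpha> powr p + \<epsilon> / 3) (at_right 0)"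
      using \<epsilon> by (intro order_tendstoD(2)) auto
    moreover have "eventually (\<lambda>u::real. u < 1) (at_right 0)"
      by (rule eventually_at_rightI[of 0 1]) auto
    ultimately have "eventually (\<lambda>u. ((1 - u) powr (1 - p) * (\<alpha> + u) powr p < \<alpha> powr p + \<epsilon> / 3 \<and> u < 1) \<and> 0 < u) (at_right 0)"
      by (intro eventually_conj eventually_at_right_less)
    then obtain u where u: "(1 - u) powr (1 - p) * (\<alpha> + u) powr p < \<alpha> powr p + \<epsilon> / 3" "u < 1" "0 < u"
      using eventually_happens'[OF trivial_limit_at_right_real] by blast
    \<comment> \<open>The order of choice matters: \<open>N\<close> depends on \<open>u\<close>, \<open>\<tau>\<close> on both, and \<open>R\<close> on all three.\<close>
    define c2 where "c2 = u powr (1 - p) * (1 / 2) powr (1 - p)"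
    have scale0: "((\<lambda>x::real. (b / x) powr p) \<longlongrightarrow> 0) at_top" if "b > 0" for b
    proof -
      have "((\<lambda>x. (b / x) powr p) \<longlongrightarrow> 0 powr p) at_top"
      proof (rule tendsto_powr')
        show "((\<lambda>x. b / x) \<longlongrightarrow> 0) at_top"
          by (intro tendsto_divide_0[OF tendsto_const] filterlim_at_top_imp_at_infinity filterlim_ident)
        show "0 \<noteq> 0 \<or> 0 < p \<and> (\<forall>\<^sub>F x in at_top. 0 \<le> b / x)"
          using p eventually_mono[OF eventually_gt_at_top[of "0::real"], of "\<lambda>x. 0 \<le> b / x"] that by simp
      qed simp
      then show ?thesis using p by simp
    qed
    have third: "\<epsilon> / 3 > 0" using \<epsilon> by simp
    have limN: "((\<lambda>N. c2 * \<kappa> * (1 / N) powr p) \<longlongrightarrow> 0) at_top"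
      by (intro tendsto_mult_right_zero scale0) simp
    obtain N where N: "N > 0" "c2 * \<kappa> * (1 / N) powr p < \<epsilon> / 3"
      by (rule tendsto_zero_pick_positive[OF limN third], rule that)
    have pu: "p * u > 0" using p u by simp
    obtain \<tau> where \<tau>: "\<And>t. \<bar>t - \<tau>\<bar> \<le> N \<Longrightarrow> hardy_log_deriv \<delta> \<delta>' (exp t) \<le> min \<delta> \<delta>' + p * u"
      by (rule hardy_log_deriv_near_min[OF pu, of N \<delta> \<delta>'], rule that)
    have limR: "((\<lambda>R. (c2 * (M * (16 / 9) powr p)) * (4 * exp (\<tau> + N) / R) powr p) \<longlongrightarrow> 0) at_top"
      by (intro tendsto_mult_right_zero scale0) simp
    obtain R where R: "R > 0" "(c2 * (M * (16 / 9) powr p)) * (4 * exp (\<tau> + N) / R) powr p < \<epsilon> / 3"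
      by (rule tendsto_zero_pick_positive[OF limR third], rule that)
    obtain x0 where x0: "x0 \<in> K" and big: "\<And>y. y \<in> affine hull K \<Longrightarrow> dist x0 y \<le> R \<Longrightarrow> y \<in> K"
      using large_relative_balls[OF K assms(4,6,7), of R] by blast
    have ball: "x0 + v \<in> K" if "norm v \<le> R" "proj W v = 0" for v
      using big[of "x0 + v"] shift[OF hull_inc[OF x0] that(2)] that(1) by (simp add: dist_norm)
    obtain \<phi> where \<phi>: "\<phi> \<in> C1c (- K)" "\<phi> \<noteq> (\<lambda>x. 0)" "den \<phi> > 0"
      "num \<phi> \<le> ((1 - u) powr (1 - p) * (\<alpha> + u) powr p
         + c2 * (\<kappa> * (1 / N) powr p + (4 * exp (\<tau> + N) / R) powr p * (M * (16 / 9) powr p))) * den \<phi>"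
      using test_function_ratio[OF x0 B orth R(1) ball Wne p pos u(3,2) N(1) \<tau> H M]
      unfolding num_def den_def w_def \<alpha>_def c2_def by blast
    have "num \<phi> / den \<phi> \<le> (1 - u) powr (1 - p) * (\<alpha> + u) powr p
         + c2 * (\<kappa> * (1 / N) powr p + (4 * exp (\<tau> + N) / R) powr p * (M * (16 / 9) powr p))"
      using \<phi>(3,4) by (simp add: pos_divide_le_eq)
    also have "\<dots> = (1 - u) powr (1 - p) * (\<alpha> + u) powr p + c2 * \<kappa> * (1 / N) powr p
         + (c2 * (M * (16 / 9) powr p)) * (4 * exp (\<tau> + N) / R) powr p"
      by (simp add: algebra_simps)
    also have "\<dots> \<le> \<alpha> powr p + \<epsilon>" using u(1) N(2) R(2) by linarith
    finally show ?thesis using \<phi>(1,2) by (auto simp: Q_def)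
  qed
  have bdd: "bdd_below Q" using lower by (rule bdd_belowI)
  have "Inf Q = \<alpha> powr p"
  proof (rule antisym)
    show "Inf Q \<le> \<alpha> powr p"
    proof (rule field_le_epsilon)
      fix \<epsilon> :: real assume "\<epsilon> > 0"
      then obtain q where "q \<in> Q" "q \<le> \<alpha> powr p + \<epsilon>" using upper by blast
      then show "Inf Q \<le> \<alpha> powr p + \<epsilon>" using cInf_lower[OF _ bdd] by force
    qed
    have "Q \<noteq> {}" using upper[of 1] by auto
    then show "\<alpha> powr p \<le> Inf Q" using lower by (rule cInf_greatest)
  qed
  then show ?thesis unfolding const by (simp add: \<alpha>_def cardW)
qed

end
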